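(* Let $G,N$ be Banach--Lie groups, let $\pi: G\to \mathrm{Aut}(N)$ be a homomorphism defining a continuous action of $G$ on $N$, and let $H:=N\rtimes_\pi G$ and $I=[0,1]$. Let $\gamma_1=(\alpha_1,\beta_1),\gamma_2=(\alpha_2,\beta_2): I\to H$ be $C^1$-curves with $\gamma_1(0)=\gamma_2(0)=1_H$, and assume that $(\gamma_1,\gamma_2)$ has the following property $(\star)$: there exists a $C^1$-curve $\alpha_3: I\to N$ with $\alpha_3(0)=1_N$ such that the map $h: I\to N$, $t\mapsto \pi(\beta_1(t))\alpha_3(t)$, is $C^1$ and $\alpha_3'(0)=h'(0)=\alpha_2'(0)$. Then $$\lim_{n\to\infty}\big(\gamma_1(\tfrac{t}{n})\gamma_2(\tfrac{t}{n})\big)^n=\exp_H\big(t(\gamma_1'(0)+\gamma_2'(0))\big)$$ uniformly in $t$ on compact subsets of $[0,\infty[$.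
   Context: $\mathrm{Aut}(N)$ is the group of Lie group automorphisms of $N$; "$\pi$ defines a continuous action" means that $G\times N\to N$, $(g,n)\mapsto \pi(g)n$, is continuous. $H=N\rtimes_\pi G$ is the product Banach manifold $N\times G$ with multiplication $(n_1,g_1)(n_2,g_2)=(n_1\cdot\pi(g_1)n_2,\,g_1g_2)$; it is a topological group whose left multiplications $\lambda_h: x\mapsto hx$ are smooth (right multiplications are in general only continuous). Put $\mathfrak h:=T_1H=\mathfrak n\times\mathfrak g$ and, for $h\in H$, $x\in\mathfrak h$, $h.x:=T_1(\lambda_h)x\in T_hH$. The exponential function $\exp_H:\mathfrak h\to H$ is $\exp_H(x):=\eta(1)$, where $\eta:[0,1]\to H$ is the unique (existing) $C^1$ solution of $\eta'(t)=\eta(t).x$, $\eta(0)=1_H$. For a given compact subset of $[0,\infty[$, $\gamma_i(t/n)$ is defined for all sufficiently large $n$. Uniform convergence $c_n(t)\to c(t)$ on a compact set means: for each identity neighbourhood $U$ in $H$ one has $c(t)^{-1}c_n(t)\in U$ for all $t$ in that set and all large $n$. *)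

theory Defs
  imports "HOL-Analysis.Analysis" "HOL-Algebra.Bij"
begin

definition bounded_multilinear ::
    "nat \<Rightarrow> ('a::real_normed_vector list \<Rightarrow> 'b::real_normed_vector) \<Rightarrow> bool" where
  "bounded_multilinear k M \<longleftrightarrow>
     (\<forall>vs i. length vs = k \<longrightarrow> i < k \<longrightarrow> linear (\<lambda>v. M (vs[i := v]))) \<and>
     (\<exists>C. \<forall>vs. length vs = k \<longrightarrow> norm (M vs) \<le> C * (\<Prod>v\<leftarrow>vs. norm v))"

text \<open>
  Smooth means infinitely often Frechet differentiable. The type of the iterated
  derivative \<open>D\<^sup>k f : U \<rightarrow> L(E, L(E, \<dots>, F))\<close> depends on \<open>k\<close>, so \<open>D\<^sup>k f(x)\<close> is represented by the
  corresponding bounded \<open>k\<close>-linear map \<open>D k x\<close>, applied to lists of length \<open>k\<close>. The last clause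
  says that \<open>D (Suc k) x\<close> is the Frechet derivative of \<open>D k\<close> at \<open>x\<close> with respect to the norm
  of bounded \<open>k\<close>-linear maps.
\<close>

definition smooth_on ::
    "'a::real_normed_vector set \<Rightarrow> ('a \<Rightarrow> 'b::real_normed_vector) \<Rightarrow> bool" where
  "smooth_on U f \<longleftrightarrow> open U \<and>
     (\<exists>D :: nat \<Rightarrow> 'a \<Rightarrow> 'a list \<Rightarrow> 'b.
        (\<forall>x\<in>U. D 0 x [] = f x) \<and>
        (\<forall>k. \<forall>x\<in>U. bounded_multilinear k (D k x)) \<and>
        (\<forall>k. \<forall>x\<in>U. \<forall>\<epsilon>>0. \<exists>\<delta>>0. \<forall>y\<in>U. norm (y - x) < \<delta> \<longrightarrow>
           (\<forall>vs. length vs = k \<longrightarrow>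
              norm (D k y vs - D k x vs - D (Suc k) x ((y - x) # vs))
                \<le> \<epsilon> * norm (y - x) * (\<Prod>v\<leftarrow>vs. norm v))))"

type_synonym ('a, 'e) chart = "'a set \<times> ('a \<Rightarrow> 'e)"

record ('a, 'e) manifold =
  topol :: "'a topology"
  atlas :: "('a, 'e) chart set"

definition banach_manifold :: "('a, 'e::banach) manifold \<Rightarrow> bool" where
  "banach_manifold M \<longleftrightarrow>
     Hausdorff_space (topol M) \<and>
     topspace (topol M) = (\<Union>(U, \<phi>)\<in>atlas M. U) \<and>
     (\<forall>(U, \<phi>)\<in>atlas M.
        openin (topol M) U \<and> open (\<phi> ` U) \<and>
        homeomorphic_map (subtopology (topol M) U) (top_of_set (\<phi> ` U)) \<phi>) \<and>
     (\<forall>(U, \<phi>)\<in>atlas M. \<forall>(V, \<psi>)\<in>atlas M.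
        smooth_on (\<phi> ` (U \<inter> V)) (\<psi> \<circ> inv_into U \<phi>))"

definition smooth_map ::
    "('a, 'e::banach) manifold \<Rightarrow> ('b, 'f::banach) manifold \<Rightarrow> ('a \<Rightarrow> 'b) \<Rightarrow> bool" where
  "smooth_map M M' f \<longleftrightarrow>
     continuous_map (topol M) (topol M') f \<and>
     (\<forall>(U, \<phi>)\<in>atlas M. \<forall>(V, \<psi>)\<in>atlas M'.
        smooth_on (\<phi> ` (U \<inter> f -` V)) (\<psi> \<circ> f \<circ> inv_into U \<phi>))"

definition prod_manifold ::
    "('a, 'e::banach) manifold \<Rightarrow> ('b, 'f::banach) manifold \<Rightarrow> ('a \<times> 'b, 'e \<times> 'f) manifold" where
  "prod_manifold M M' =
     \<lparr>topol = prod_topology (topol M) (topol M'),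
      atlas = {(U \<times> V, map_prod \<phi> \<psi>) | U \<phi> V \<psi>. (U, \<phi>) \<in> atlas M \<and> (V, \<psi>) \<in> atlas M'}\<rparr>"

text \<open>
  A tangent vector \<open>v\<close> at a point \<open>p\<close> is represented by the family of its coordinates in all
  charts: \<open>v (U, \<phi>)\<close> is the coordinate of \<open>v\<close> in the chart \<open>(U, \<phi>)\<close> if that chart contains \<open>p\<close>,
  and \<open>0\<close> otherwise; coordinates in different charts are related by the derivative of the
  change of charts. The vector space operations are pointwise.
\<close>

type_synonym ('a, 'e) tangent = "('a, 'e) chart \<Rightarrow> 'e"

definition tangent_add ::
    "('a, 'e::banach) tangent \<Rightarrow> ('a, 'e) tangent \<Rightarrow> ('a, 'e) tangent" where
  "tangent_add v w = (\<lambda>c. v c + w c)"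

definition tangent_scale :: "real \<Rightarrow> ('a, 'e::banach) tangent \<Rightarrow> ('a, 'e) tangent" where
  "tangent_scale r v = (\<lambda>c. r *\<^sub>R v c)"

text \<open>
  The coordinate of \<open>T\<^sub>p f v\<close> in a chart of the codomain does not depend on the chart \<open>(U, \<phi>)\<close>
  at \<open>p\<close> used to compute it.
\<close>

definition tangent_map ::
    "('a, 'e::banach) manifold \<Rightarrow> ('b, 'f::banach) manifold \<Rightarrow> ('a \<Rightarrow> 'b) \<Rightarrow> 'a
      \<Rightarrow> ('a, 'e) tangent \<Rightarrow> ('b, 'f) tangent" where
  "tangent_map M M' f p v =
     (let (U, \<phi>) = (SOME c. c \<in> atlas M \<and> p \<in> fst c)
      in (\<lambda>(V, \<psi>).
           if (V, \<psi>) \<in> atlas M' \<and> f p \<in> V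
           then frechet_derivative (\<psi> \<circ> f \<circ> inv_into U \<phi>) (at (\<phi> p)) (v (U, \<phi>))
           else 0))"

text \<open>Derivatives are taken within the interval, so they are one-sided at its end points.\<close>

definition C1_curve :: "('a, 'e::banach) manifold \<Rightarrow> (real \<Rightarrow> 'a) \<Rightarrow> bool" where
  "C1_curve M c \<longleftrightarrow>
     continuous_map (top_of_set {0..1}) (topol M) c \<and>
     (\<forall>(U, \<phi>)\<in>atlas M. \<exists>d.
        continuous_on ({0..1} \<inter> c -` U) d \<and>
        (\<forall>t\<in>{0..1} \<inter> c -` U. ((\<phi> \<circ> c) has_vector_derivative d t) (at t within {0..1})))"

definition velocity ::
    "('a, 'e::banach) manifold \<Rightarrow> (real \<Rightarrow> 'a) \<Rightarrow> real \<Rightarrow> ('a, 'e) tangent" where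
  "velocity M c t = (\<lambda>(U, \<phi>).
     if (U, \<phi>) \<in> atlas M \<and> c t \<in> U
     then vector_derivative (\<phi> \<circ> c) (at t within {0..1}) else 0)"

record ('a, 'e) manifold_group = "'a monoid" +
  mfd :: "('a, 'e) manifold"

definition banach_lie_group :: "('a, 'e::banach) manifold_group \<Rightarrow> bool" where
  "banach_lie_group G \<longleftrightarrow>
     group G \<and>
     banach_manifold (mfd G) \<and>
     topspace (topol (mfd G)) = carrier G \<and>
     smooth_map (prod_manifold (mfd G) (mfd G)) (mfd G) (\<lambda>(x, y). x \<otimes>\<^bsub>G\<^esub> y) \<and>
     smooth_map (mfd G) (mfd G) (\<lambda>x. inv\<^bsub>G\<^esub> x)"

definition LieAut :: "('a, 'e::banach) manifold_group \<Rightarrow> ('a \<Rightarrow> 'a) monoid" where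
  "LieAut N = (BijGroup (carrier N))
     \<lparr>carrier := {f \<in> auto N. smooth_map (mfd N) (mfd N) f \<and>
                              smooth_map (mfd N) (mfd N) (inv_into (carrier N) f)}\<rparr>"

definition continuous_action ::
    "('b, 'f::banach) manifold_group \<Rightarrow> ('a, 'e::banach) manifold_group \<Rightarrow> ('b \<Rightarrow> 'a \<Rightarrow> 'a) \<Rightarrow> bool"
  where
  "continuous_action G N \<pi> \<longleftrightarrow>
     continuous_map (prod_topology (topol (mfd G)) (topol (mfd N))) (topol (mfd N))
       (\<lambda>(g, n). \<pi> g n)"

definition semidirect_product ::
    "('a, 'e::banach) manifold_group \<Rightarrow> ('b \<Rightarrow> 'a \<Rightarrow> 'a) \<Rightarrow> ('b, 'f::banach) manifold_group
      \<Rightarrow> ('a \<times> 'b, 'e \<times> 'f) manifold_group" where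
  "semidirect_product N \<pi> G =
     \<lparr>carrier = carrier N \<times> carrier G,
      mult = (\<lambda>(n1, g1) (n2, g2). (n1 \<otimes>\<^bsub>N\<^esub> \<pi> g1 n2, g1 \<otimes>\<^bsub>G\<^esub> g2)),
      one = (\<one>\<^bsub>N\<^esub>, \<one>\<^bsub>G\<^esub>),
      mfd = prod_manifold (mfd N) (mfd G)\<rparr>"

definition left_translate ::
    "('a, 'e::banach) manifold_group \<Rightarrow> 'a \<Rightarrow> ('a, 'e) tangent \<Rightarrow> ('a, 'e) tangent" where
  "left_translate H h x = tangent_map (mfd H) (mfd H) (\<lambda>y. h \<otimes>\<^bsub>H\<^esub> y) \<one>\<^bsub>H\<^esub> x"

definition lie_exp :: "('a, 'e::banach) manifold_group \<Rightarrow> ('a, 'e) tangent \<Rightarrow> 'a" where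
  "lie_exp H x = (THE y. \<exists>\<eta>.
     C1_curve (mfd H) \<eta> \<and> \<eta> 0 = \<one>\<^bsub>H\<^esub> \<and>
     (\<forall>t\<in>{0..1}. velocity (mfd H) \<eta> t = left_translate H (\<eta> t) x) \<and>
     y = \<eta> 1)"

definition group_uniform_limit ::
    "('a, 'e::banach) manifold_group \<Rightarrow> real set \<Rightarrow> (nat \<Rightarrow> real \<Rightarrow> 'a) \<Rightarrow> (real \<Rightarrow> 'a) \<Rightarrow> bool" where
  "group_uniform_limit H K c_seq c \<longleftrightarrow>
     (\<forall>U. (\<exists>V. openin (topol (mfd H)) V \<and> \<one>\<^bsub>H\<^esub> \<in> V \<and> V \<subseteq> U) \<longrightarrow>
        (\<forall>\<^sub>F n in sequentially. \<forall>t\<in>K. inv\<^bsub>H\<^esub> (c t) \<otimes>\<^bsub>H\<^esub> c_seq n t \<in> U))"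

end

(* Automorphisms of a Banach-Lie group are uniformly well approximated by their derivatives: in a
   chart at the identity the powers of a point y grow linearly while they stay in the chart; hence,
   if all pi(g) with g near g0 map a fixed small ball into the chart, then
   pi(g) y = L(g) y + O(|y|^2) uniformly in g, where L(g) is the derivative of pi(g) at 1.
   Continuity of the action thus makes L strongly continuous, so that gamma1 gamma2 is
   differentiable at 0 with derivative gamma1'(0) + gamma2'(0) =: (x, y).

   The curve eta(t) = exp_H(t (x, y)) = (d(t), c(t)) is obtained by solving two ordinary differential
   equations: c has the constant left logarithmic derivative y in G, and d has the left logarithmic
   derivative L(c(t)) x in N. In the components of eta(ks)^-1 (gamma1(s) gamma2(s))^k, k = 0, 1, 2, ...,
   one step has the form e -> q^-1 e p with q, p = O(s) and p - q = o(s), which changes the coordinate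
   of e by at most O(|e| s) + o(s). A discrete Gronwall argument then gives the convergence. *)

theory Submission
  imports Defs
begin

text \<open>The action is only jointly continuous: g -> pi(g) n need not be differentiable, and L(g)
  depends on g only strongly continuously. So eta' = eta.X cannot be treated as an ordinary
  differential equation with Lipschitz right-hand side on H. What rescues it is the triangular form:
  the equation in G does not involve N, and once c is known, the equation in N has a right-hand side
  that is Lipschitz in the unknown and merely continuous in time, through t -> L(c(t)) x. The same
  order governs uniqueness and the convergence estimate: the G-components are compared first, and
  their closeness makes the increments in N close, because L is evaluated at the single vector x
  along the compact curve c([0, T]).

  Curves may leave every chart, but quotients of nearby curves do not. Hence everything is expressed
  by left logarithmic derivatives and by points pt(z) near the identity, so that one chart of each
  group, centred at the identity, carries all estimates; other charts enter only where velocities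
  are translated.\<close>

section \<open>Auxiliary facts from analysis and group theory\<close>

text \<open>A mean value inequality with no derivative to compute. The local hypothesis compares
  only with the centre t; the comparisons on the two sides of t add up, since \<open>Bolzano\<close>
  offers intervals that contain t. \<open>ld_unique\<close> applies it to a coordinate whose growth
  is only estimated.\<close>

lemma local_lipschitz_bound:
  fixes f :: "real \<Rightarrow> 'e::real_normed_vector"
  assumes "a \<le> b"
    and loc: "\<And>t. t \<in> {a..b} \<Longrightarrow> \<exists>\<delta>>0. \<forall>s\<in>{a..b}. \<bar>s - t\<bar> < \<delta> \<longrightarrow> norm (f s - f t) \<le> K * \<bar>s - t\<bar>"
  shows "norm (f b - f a) \<le> K * (b - a)"
proof -
  define P where "P x y \<longleftrightarrow> (a \<le> x \<and> y \<le> b \<longrightarrow> norm (f y - f x) \<le> K * (y - x))" for x y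
  have "P a b"
  proof (rule Bolzano[OF \<open>a \<le> b\<close>])
    fix x y z assume "P x y" "P y z" "x \<le> y" "y \<le> z"
    then show "P x z"
      using norm_triangle_ineq[of "f z - f y" "f y - f x"] by (auto simp: P_def algebra_simps)
  next
    fix x assume "a \<le> x" "x \<le> b"
    then obtain \<delta> where \<delta>: "\<delta> > 0" "\<And>s. s \<in> {a..b} \<Longrightarrow> \<bar>s - x\<bar> < \<delta> \<Longrightarrow> norm (f s - f x) \<le> K * \<bar>s - x\<bar>"
      using loc[of x] by auto
    show "\<exists>d>0. \<forall>u v. u \<le> x \<and> x \<le> v \<and> v - u < d \<longrightarrow> P u v"
    proof (intro exI[of _ \<delta>] conjI allI impI)
      fix u v assume uv: "u \<le> x \<and> x \<le> v \<and> v - u < \<delta>"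
      show "P u v" unfolding P_def
      proof
        assume "a \<le> u \<and> v \<le> b"
        then have "norm (f u - f x) \<le> K * (x - u)" "norm (f v - f x) \<le> K * (v - x)"
          using \<delta>(2)[of u] \<delta>(2)[of v] uv \<open>a \<le> x\<close> \<open>x \<le> b\<close> by auto
        then show "norm (f v - f u) \<le> K * (v - u)"
          using norm_triangle_ineq4[of "f v - f x" "f u - f x"] by (auto simp: algebra_simps)
      qed
    qed (use \<delta> in auto)
  qed
  then show ?thesis by (simp add: P_def)
qed

text \<open>Continuity is asked along continuous paths, the form in which
  \<open>continuous_on_F\<close> supplies it. Paths on the short interval are extended by constants
  to the whole line, so that the fixed point is sought in the complete space of bounded continuous
  functions.\<close>

lemma picard_local:
  fixes f :: "real \<Rightarrow> 'e::banach \<Rightarrow> 'e"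
  assumes "0 < a" "0 < \<rho>" "0 \<le> B" "0 \<le> K"
    and cont: "\<And>x. continuous_on {0..a} x \<Longrightarrow> (\<And>t. t \<in> {0..a} \<Longrightarrow> norm (x t) \<le> \<rho>) \<Longrightarrow>
       continuous_on {0..a} (\<lambda>t. f t (x t))"
    and bound: "\<And>t x. t \<in> {0..a} \<Longrightarrow> norm x \<le> \<rho> \<Longrightarrow> norm (f t x) \<le> B"
    and lip: "\<And>t x y. t \<in> {0..a} \<Longrightarrow> norm x \<le> \<rho> \<Longrightarrow> norm y \<le> \<rho> \<Longrightarrow> norm (f t x - f t y) \<le> K * norm (x - y)"
  shows "\<exists>\<delta> x. 0 < \<delta> \<and> \<delta> \<le> a \<and> x 0 = 0 \<and>
    (\<forall>t\<in>{0..\<delta>}. norm (x t) \<le> \<rho> \<and> (x has_vector_derivative f t (x t)) (at t within {0..\<delta>}))"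
proof -
  \<comment> \<open>The second entry makes the integral operator preserve the ball of radius \<rho>,
    the third makes it contract by 1/2; the added 1 avoids division by zero.\<close>
  define \<delta> where "\<delta> = min a (min (\<rho> / (B + 1)) (1 / (2 * (K + 1))))"
  have \<delta>: "0 < \<delta>" "\<delta> \<le> a" using assms by (auto simp: \<delta>_def)
  have "\<delta> \<le> \<rho> / (B + 1)" "\<delta> \<le> 1 / (2 * (K + 1))" by (auto simp: \<delta>_def)
  then have "\<delta> * (B + 1) \<le> \<rho>" "\<delta> * (2 * (K + 1)) \<le> 1"
    using assms by (simp_all add: le_divide_eq)
  then have \<delta>B: "B * \<delta> \<le> \<rho>" and \<delta>K: "K * \<delta> \<le> 1 / 2" using \<delta> by (simp_all add: algebra_simps)
  define cl where "cl t = max 0 (min t \<delta>)" for t :: real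
  have cl: "cl t \<in> {0..\<delta>}" "t \<in> {0..\<delta>} \<Longrightarrow> cl t = t" for t using \<delta> by (auto simp: cl_def)
  have ccl: "continuous_on UNIV cl" unfolding cl_def by (intro continuous_intros)
  define S where "S = PiC UNIV (\<lambda>_::real. cball (0::'e) \<rho>)"
  have S: "x \<in> S \<longleftrightarrow> (\<forall>t. norm (apply_bcontfun x t) \<le> \<rho>)" for x
    by (auto simp: S_def mem_PiC_iff Pi_iff)
  define I where "I x t = integral {0..t} (\<lambda>\<tau>. f \<tau> (apply_bcontfun x \<tau>))" for x t
  have cf: "continuous_on {0..t} (\<lambda>\<tau>. f \<tau> (apply_bcontfun x \<tau>))" if "x \<in> S" "t \<le> \<delta>" for x t
    using cont[of "apply_bcontfun x"] that S[of x] \<delta> by (auto intro: continuous_on_subset)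
  have Iv: "(I x has_vector_derivative f t (apply_bcontfun x t)) (at t within {0..\<delta>})"
    if "x \<in> S" "t \<in> {0..\<delta>}" for x t
    using integral_has_vector_derivative[OF cf[OF that(1) order_refl] that(2)] unfolding I_def .
  have Ic: "continuous_on {0..\<delta>} (I x)" if "x \<in> S" for x
    using Iv[OF that] by (intro continuous_on_vector_derivative) auto
  have Ib: "norm (I x t) \<le> \<rho>" if "x \<in> S" "t \<in> {0..\<delta>}" for x t
  proof -
    have "norm (I x t) \<le> B * (t - 0)" unfolding I_def
    proof (rule integral_bound)
      show "continuous_on {0..t} (\<lambda>\<tau>. f \<tau> (apply_bcontfun x \<tau>))" using that by (intro cf) auto
      show "\<And>\<tau>. \<tau> \<in> {0..t} \<Longrightarrow> norm (f \<tau> (apply_bcontfun x \<tau>)) \<le> B"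
        using that S[of x] \<delta> by (intro bound) auto
    qed (use that in auto)
    also have "\<dots> \<le> B * \<delta>" using that assms by (intro mult_left_mono) auto
    finally show ?thesis using \<delta>B by simp
  qed
  define T where "T x = Bcontfun (\<lambda>t. I x (cl t))" for x
  have T: "apply_bcontfun (T x) t = I x (cl t)" if "x \<in> S" for x t
  proof -
    have "continuous_on UNIV (I x \<circ> cl)"
      using ccl Ic[OF that] cl(1) by (intro continuous_on_compose) (auto intro: continuous_on_subset)
    then have "(\<lambda>t. I x (cl t)) \<in> bcontfun"
      using Ib[OF that cl(1)] by (intro bcontfun_normI[of _ \<rho>]) (auto simp: o_def)
    then show ?thesis by (simp add: T_def Bcontfun_inverse)
  qed
  have "\<exists>!x\<in>S. T x = x"
  proof (rule Banach_fix)
    show "complete S" unfolding S_def by (intro closed_PiC[THEN complete_eq_closed[THEN iffD2]]) auto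
    show "S \<noteq> {}" using S[of "const_bcontfun 0"] assms by (auto simp: const_bcontfun.rep_eq)
    show "T ` S \<subseteq> S" using T Ib cl S by auto
    fix x y assume xy: "x \<in> S" "y \<in> S"
    show "dist (T x) (T y) \<le> (1 / 2) * dist x y"
    proof (rule dist_bound)
      fix t
      have c: "continuous_on {0..cl t} (\<lambda>\<tau>. f \<tau> (apply_bcontfun x \<tau>))" "continuous_on {0..cl t} (\<lambda>\<tau>. f \<tau> (apply_bcontfun y \<tau>))"
        using cl xy by (auto intro!: cf)
      have "norm (I x (cl t) - I y (cl t)) =
          norm (integral {0..cl t} (\<lambda>\<tau>. f \<tau> (apply_bcontfun x \<tau>) - f \<tau> (apply_bcontfun y \<tau>)))"
        unfolding I_def by (subst integral_diff) (auto intro!: integrable_continuous_real c)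
      also have "\<dots> \<le> (K * dist x y) * (cl t - 0)"
      proof (rule integral_bound)
        fix \<tau> assume \<tau>: "\<tau> \<in> {0..cl t}"
        have "norm (f \<tau> (apply_bcontfun x \<tau>) - f \<tau> (apply_bcontfun y \<tau>)) \<le> K * norm (apply_bcontfun x \<tau> - apply_bcontfun y \<tau>)"
          using \<tau> cl[of t] \<delta> xy S by (intro lip) auto
        also have "\<dots> \<le> K * dist x y"
          using dist_bounded[of x \<tau> y] assms by (intro mult_left_mono) (auto simp: dist_norm)
        finally show "norm (f \<tau> (apply_bcontfun x \<tau>) - f \<tau> (apply_bcontfun y \<tau>)) \<le> K * dist x y" .
      qed (use cl[of t] in \<open>auto intro!: continuous_intros c\<close>)
      also have "\<dots> \<le> (K * dist x y) * \<delta>" using cl[of t] assms by (intro mult_left_mono) auto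
      also have "\<dots> = (K * \<delta>) * dist x y" by simp
      also have "\<dots> \<le> (1 / 2) * dist x y" using \<delta>K by (intro mult_right_mono) auto
      finally show "dist (apply_bcontfun (T x) t) (apply_bcontfun (T y) t) \<le> (1 / 2) * dist x y"
        using T xy by (simp add: dist_norm)
    qed
  qed auto
  then obtain x where x: "x \<in> S" "T x = x" by blast
  have eq: "apply_bcontfun x t = I x t" if "t \<in> {0..\<delta>}" for t
    using T[OF x(1), of t] cl(2)[OF that] x(2) by simp
  show ?thesis
  proof (rule exI[of _ \<delta>], rule exI[of _ "apply_bcontfun x"], intro conjI ballI)
    show "apply_bcontfun x 0 = 0" using eq[of 0] \<delta> by (simp add: I_def)
    fix t assume t: "t \<in> {0..\<delta>}"
    show "norm (apply_bcontfun x t) \<le> \<rho>" using x S by auto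
    show "(apply_bcontfun x has_vector_derivative f t (apply_bcontfun x t)) (at t within {0..\<delta>})"
      using Iv[OF x(1) t] t eq by (rule has_vector_derivative_transform[rotated 2])
  qed (use \<delta> in auto)
qed

text \<open>The extension is eta(t/n)^n for any n with t/n \<le> \<delta>. Two choices m and n agree
  because both values are the power of exponent m n of eta(t/(m n)).\<close>

lemma (in group) semigroup_extend:
  fixes \<eta> :: "real \<Rightarrow> 'a"
  assumes "\<delta> > 0" and cl: "\<And>t. 0 \<le> t \<Longrightarrow> t \<le> \<delta> \<Longrightarrow> \<eta> t \<in> carrier G"
    and add: "\<And>s t. 0 \<le> s \<Longrightarrow> 0 \<le> t \<Longrightarrow> s + t \<le> \<delta> \<Longrightarrow> \<eta> (s + t) = \<eta> s \<otimes> \<eta> t"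
  shows "\<exists>h. (\<forall>t\<ge>0. h t \<in> carrier G) \<and> (\<forall>t. 0 \<le> t \<and> t \<le> \<delta> \<longrightarrow> h t = \<eta> t) \<and>
    (\<forall>s\<ge>0. \<forall>t\<ge>0. h (s + t) = h s \<otimes> h t)"
proof -
  have "\<eta> 0 = \<eta> 0 \<otimes> \<eta> 0" using add[of 0 0] \<open>\<delta> > 0\<close> by simp
  then have \<eta>0: "\<eta> 0 = \<one>" using cl[of 0] \<open>\<delta> > 0\<close> by (metis l_cancel_one' less_eq_real_def)
  have pow: "0 \<le> s \<Longrightarrow> real k * s \<le> \<delta> \<Longrightarrow> \<eta> (real k * s) = \<eta> s [^] k" for s and k :: nat
  proof (induction k)
    case (Suc k)
    have "real k * s \<le> \<delta>" using Suc.prems by (simp add: algebra_simps)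
    then show ?case using Suc add[of "real k * s" s] by (simp add: algebra_simps)
  qed (simp add: \<eta>0)
  have indep: "\<eta> (t / real m) [^] m = \<eta> (t / real n) [^] n"
    if "0 \<le> t" "m \<ge> 1" "n \<ge> 1" "t / real m \<le> \<delta>" "t / real n \<le> \<delta>" for t and m n :: nat
  proof -
    define s where "s = t / (real m * real n)"
    have s: "0 \<le> s" "t / real m = real n * s" "t / real n = real m * s" using that by (auto simp: s_def)
    have "s \<le> real n * s" using s(1) that mult_right_mono[of 1 "real n" s] by simp
    then have sc: "\<eta> s \<in> carrier G" using s that cl by simp
    have "\<eta> (t / real m) = \<eta> s [^] n" "\<eta> (t / real n) = \<eta> s [^] m"
      using pow[of s n] pow[of s m] s that by simp_all
    then show ?thesis using sc by (simp add: nat_pow_pow mult.commute)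
  qed
  \<comment> \<open>Some fixed admissible exponent; the successor keeps it positive.\<close>
  define m where "m t = Suc (nat \<lceil>t / \<delta>\<rceil>)" for t
  define h where "h t = \<eta> (t / real (m t)) [^] (m t)" for t
  have m: "t / real (m t) \<le> \<delta>" if "0 \<le> t" for t
  proof -
    have "t / \<delta> \<le> real (m t)" using real_nat_ceiling_ge[of "t / \<delta>"] by (simp add: m_def)
    then show ?thesis using \<open>\<delta> > 0\<close> by (simp add: m_def field_simps)
  qed
  have h: "h t = \<eta> (t / real n) [^] n" if "0 \<le> t" "n \<ge> 1" "t / real n \<le> \<delta>" for t n
    unfolding h_def using that m[OF that(1)] by (intro indep) (auto simp: m_def)
  have "h (s + t) = h s \<otimes> h t" if st: "0 \<le> s" "0 \<le> t" for s t
  proof -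
    define n where "n = m (s + t)"
    have n: "n \<ge> 1" "(s + t) / real n \<le> \<delta>" using m[of "s + t"] st by (auto simp: n_def m_def)
    have sn: "s / real n + t / real n \<le> \<delta>" "0 \<le> s / real n" "0 \<le> t / real n"
      using n st by (auto simp: add_divide_distrib)
    then have sn2: "s / real n \<le> \<delta>" "t / real n \<le> \<delta>" by linarith+
    \<comment> \<open>Addition of reals commutes, hence so do the two factors; this lets the n-th
      power of their product split.\<close>
    have e: "\<eta> ((s + t) / real n) = \<eta> (s / real n) \<otimes> \<eta> (t / real n)"
      "\<eta> (s / real n) \<otimes> \<eta> (t / real n) = \<eta> (t / real n) \<otimes> \<eta> (s / real n)"
      using add[of "s / real n" "t / real n"] add[of "t / real n" "s / real n"] sn
      by (simp_all add: add_divide_distrib add.commute)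
    have "h (s + t) = (\<eta> (s / real n) \<otimes> \<eta> (t / real n)) [^] n" using h[of "s + t" n] n st e by simp
    also have "\<dots> = \<eta> (s / real n) [^] n \<otimes> \<eta> (t / real n) [^] n"
      using e cl sn sn2 by (intro pow_mult_distrib) auto
    also have "\<dots> = h s \<otimes> h t" using h[of s n] h[of t n] n st sn2 by simp
    finally show ?thesis .
  qed
  moreover have "h t \<in> carrier G" if "0 \<le> t" for t
    unfolding h_def using that m[OF that] by (intro nat_pow_closed cl) auto
  moreover have "h t = \<eta> t" if "0 \<le> t" "t \<le> \<delta>" for t using h[of t 1] cl[of t] that by simp
  ultimately show ?thesis by (intro exI[of _ h]) blast
qed

lemma positive_lower_bound: "\<forall>x\<in>set xs. (0::real) < x \<Longrightarrow> \<exists>R>0. \<forall>x\<in>set xs. R \<le> x"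
proof (induction xs)
  case (Cons x xs)
  then obtain R where "R > 0" "\<forall>x\<in>set xs. R \<le> x" by auto
  then show ?case using Cons.prems by (intro exI[of _ "min x R"]) (auto simp: min.coboundedI2)
qed (auto intro: zero_less_one)

section \<open>Logarithmic derivatives in a group with local coordinates\<close>

text \<open>\<open>c\<close> has left logarithmic derivative \<open>v\<close> at \<open>t\<close> within \<open>S\<close>, in the coordinates given by \<open>pt\<close>.\<close>

definition has_ld ::
    "('a, 'm) monoid_scheme \<Rightarrow> ('e::real_normed_vector \<Rightarrow> 'a) \<Rightarrow> (real \<Rightarrow> 'a) \<Rightarrow> 'e \<Rightarrow> real \<Rightarrow> real set \<Rightarrow> bool"
  where "has_ld G pt c v t S \<longleftrightarrow> (\<forall>\<epsilon>>0. \<exists>\<delta>>0. \<forall>s\<in>S. \<bar>s - t\<bar> < \<delta> \<longrightarrow>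
    (\<exists>z. c s = c t \<otimes>\<^bsub>G\<^esub> pt z \<and> norm (z - (s - t) *\<^sub>R v) \<le> \<epsilon> * \<bar>s - t\<bar>))"

lemma has_ld_subset: "has_ld G pt c v t S \<Longrightarrow> S' \<subseteq> S \<Longrightarrow> has_ld G pt c v t S'"
  unfolding has_ld_def by (meson subsetD)

text \<open>First-order contact at time 0, from the right, for a curve issuing from the identity:
  the case s = 0 forces f 0 = pt 0. The coordinate is asked to exist instead of being computed, so
  that f may leave the chart at later times.\<close>

definition curve0 :: "('e::real_normed_vector \<Rightarrow> 'a) \<Rightarrow> (real \<Rightarrow> 'a) \<Rightarrow> 'e \<Rightarrow> bool" where
  "curve0 pt f v \<longleftrightarrow> (\<forall>\<epsilon>>0. \<exists>\<delta>>0. \<forall>s. 0 \<le> s \<and> s < \<delta> \<longrightarrow> (\<exists>z. f s = pt z \<and> norm (z - s *\<^sub>R v) \<le> \<epsilon> * s))"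

lemma curve0_ex:
  assumes "curve0 pt f v" "\<epsilon> > 0" "\<rho> > 0"
  shows "\<exists>\<delta>>0. \<forall>s. 0 \<le> s \<and> s < \<delta> \<longrightarrow>
    (\<exists>z. f s = pt z \<and> norm (z - s *\<^sub>R v) \<le> \<epsilon> * s \<and> norm z \<le> (norm v + \<epsilon>) * s \<and> norm z < \<rho>)"
proof -
  obtain \<delta> where \<delta>: "\<delta> > 0" "\<And>s. 0 \<le> s \<Longrightarrow> s < \<delta> \<Longrightarrow> \<exists>z. f s = pt z \<and> norm (z - s *\<^sub>R v) \<le> \<epsilon> * s"
    using assms(1,2) unfolding curve0_def by blast
  have A: "norm v + \<epsilon> > 0" using assms norm_ge_zero[of v] by linarith
  show ?thesis
  proof (intro exI[of _ "min \<delta> (\<rho> / (norm v + \<epsilon>))"] conjI allI impI)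
    fix s assume s: "0 \<le> s \<and> s < min \<delta> (\<rho> / (norm v + \<epsilon>))"
    then obtain z where z: "f s = pt z" "norm (z - s *\<^sub>R v) \<le> \<epsilon> * s" using \<delta>(2)[of s] by auto
    have 1: "norm z \<le> (norm v + \<epsilon>) * s"
      using norm_triangle_ineq[of "z - s *\<^sub>R v" "s *\<^sub>R v"] z s by (simp add: algebra_simps)
    have "(norm v + \<epsilon>) * s < \<rho>" using s A by (simp add: field_simps)
    then have "norm z < \<rho>" using 1 by linarith
    then show "\<exists>z. f s = pt z \<and> norm (z - s *\<^sub>R v) \<le> \<epsilon> * s \<and> norm z \<le> (norm v + \<epsilon>) * s \<and> norm z < \<rho>"
      using z 1 by blast
  qed (use \<delta> A assms in simp)
qed

text \<open>\<open>pt\<close> is the inverse of a chart that maps the identity to \<open>0\<close>, defined on the ball of radius \<open>R0\<close>;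
  on the smaller ball of radius \<open>R\<close>, \<open>F q\<close> is the derivative at \<open>0\<close> of left multiplication by \<open>pt q\<close>.\<close>

locale lie_ball = group G for G :: "('a, 'm) monoid_scheme" (structure) +
  fixes pt :: "'e::banach \<Rightarrow> 'a" and F :: "'e \<Rightarrow> 'e \<Rightarrow> 'e" and R0 R C :: real
  assumes R_pos: "0 < R" and R_le: "R \<le> R0" and C_ge: "1 \<le> C" and CR: "8 * C * R \<le> 1"
    and pt_closed: "\<And>v. norm v < R0 \<Longrightarrow> pt v \<in> carrier G"
    and pt_inj: "\<And>v w. norm v < R0 \<Longrightarrow> norm w < R0 \<Longrightarrow> pt v = pt w \<Longrightarrow> v = w"
    and pt_0: "pt 0 = \<one>"
    and conj_ex: "\<And>e q p. norm e < R \<Longrightarrow> norm q < R \<Longrightarrow> norm p < R \<Longrightarrow>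
        \<exists>z. norm z < R0 \<and> inv (pt q) \<otimes> pt e \<otimes> pt p = pt z \<and>
            norm (z - e) \<le> C * (norm e * norm q + norm (p - q))"
    and mult_F: "\<And>q w. norm q < R \<Longrightarrow> norm w < R \<Longrightarrow>
        \<exists>z. norm z < R0 \<and> pt q \<otimes> pt w = pt z \<and> norm (z - q - F q w) \<le> C * (norm w)\<^sup>2"
    and F_linear: "\<And>q. norm q < R \<Longrightarrow> linear (F q)"
    and F_lipschitz: "\<And>q q' v. norm q < R \<Longrightarrow> norm q' < R \<Longrightarrow>
        norm (F q v - F q' v) \<le> C * norm (q - q') * norm v"
    and F_0: "\<And>v. F 0 v = v"
begin

section \<open>Products, powers and homomorphisms in the chart\<close>

lemma C_pos: "0 < C"
  using C_ge by simp

lemma pt_closed': "norm v < R \<Longrightarrow> pt v \<in> carrier G"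
  using pt_closed R_le by force

text \<open>The first estimate is \<open>conj_ex\<close> with conjugating point 0; the second
  combines \<open>mult_F\<close> with the Lipschitz dependence of F on its base point and F 0 = id.
  The two coordinates of the product coincide because \<open>pt\<close> is injective on the ball of
  radius \<open>R0\<close>.\<close>

lemma mult_ex:
  assumes q: "norm q < R" and w: "norm w < R"
  shows "\<exists>z. norm z < R0 \<and> pt q \<otimes> pt w = pt z \<and> norm (z - q) \<le> C * norm w \<and>
      norm (z - q - w) \<le> C * (norm q + norm w) * norm w \<and> norm (z - q - F q w) \<le> C * (norm w)\<^sup>2"
proof -
  obtain z where z: "norm z < R0" "pt q \<otimes> pt w = pt z" "norm (z - q - F q w) \<le> C * (norm w)\<^sup>2"
    using mult_F[OF q w] by blast
  obtain y where y: "norm y < R0" "inv (pt 0) \<otimes> pt q \<otimes> pt w = pt y"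
      "norm (y - q) \<le> C * (norm q * norm 0 + norm (w - 0))"
    using conj_ex[of q 0 w] q w R_pos by auto
  have "pt y = pt z"
    using y z pt_closed'[OF q] pt_closed'[OF w] by (simp add: pt_0)
  then have "y = z" using pt_inj y z by blast
  have "norm (F q w - F 0 w) \<le> C * norm (q - 0) * norm w"
    using q R_pos by (intro F_lipschitz) auto
  then have f: "norm (F q w - w) \<le> C * norm q * norm w" by (simp add: F_0)
  have "norm (z - q - w) \<le> norm (z - q - F q w) + norm (F q w - w)"
    using norm_triangle_ineq[of "z - q - F q w" "F q w - w"] by simp
  also have "\<dots> \<le> C * (norm q + norm w) * norm w"
    using f z by (simp add: algebra_simps power2_eq_square)
  finally show ?thesis using z y \<open>y = z\<close> by auto
qed

text \<open>This is \<open>conj_ex\<close> with e = 0, where the term |e| |q| drops out.\<close>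

lemma diff_ex:
  assumes q: "norm q < R" and p: "norm p < R"
  shows "\<exists>z. norm z < R0 \<and> pt p = pt q \<otimes> pt z \<and> norm z \<le> C * norm (p - q)"
proof -
  obtain z where z: "norm z < R0" "inv (pt q) \<otimes> pt 0 \<otimes> pt p = pt z"
      "norm (z - 0) \<le> C * (norm (0::'e) * norm q + norm (p - q))"
    using conj_ex[of 0 q p] q p R_pos by auto
  have "pt q \<otimes> pt z = pt p"
    using z pt_closed'[OF q] pt_closed'[OF p] by (metis inv_closed inv_solve_left pt_0 r_one m_closed pt_closed)
  then show ?thesis using z by auto
qed

text \<open>Each factor adds an error of at most C (|x m| + |w|) |w| \<le> 2 C \<rho> |w|. The
  coordinates x are given in advance, so that the lemma also applies to images under a homomorphism,
  whose powers stay in the chart for a different reason.\<close>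

lemma power_coord:
  assumes x: "\<And>k. k \<le> n \<Longrightarrow> pt w [^] k = pt (x k) \<and> norm (x k) \<le> \<rho>" and "\<rho> < R" and w: "norm w < R"
  shows "norm (x n - real n *\<^sub>R w) \<le> 2 * C * \<rho> * real n * norm w"
proof -
  have "m \<le> n \<Longrightarrow> norm (x m - real m *\<^sub>R w) \<le> 2 * C * \<rho> * real m * norm w" for m
  proof (induction m)
    case 0
    have "pt (x 0) = pt 0" using x[of 0] by (simp add: pt_0)
    moreover have "norm (x 0) < R0" using x[of 0] assms R_le by force
    ultimately have "x 0 = 0" using pt_inj[of "x 0" 0] R_pos R_le by auto
    then show ?case by simp
  next
    case (Suc m)
    have xm: "norm (x m) < R" and xs: "norm (x (Suc m)) < R0" and xr: "norm (x m) \<le> \<rho>"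
    proof -
      have "norm (x m) \<le> \<rho>" "norm (x (Suc m)) \<le> \<rho>" using x[of m] x[of "Suc m"] Suc.prems by auto
      then show "norm (x m) < R" "norm (x (Suc m)) < R0" "norm (x m) \<le> \<rho>"
        using \<open>\<rho> < R\<close> R_le by linarith+
    qed
    have "pt w = pt (x 1)" using x[of 1] Suc.prems w pt_closed' by auto
    then have "w = x 1" using pt_inj[of w "x 1"] w R_le x[of 1] Suc.prems \<open>\<rho> < R\<close> by force
    then have wr: "norm w \<le> \<rho>" using x[of 1] Suc.prems by auto
    obtain z where z: "norm z < R0" "pt (x m) \<otimes> pt w = pt z"
       "norm (z - x m - w) \<le> C * (norm (x m) + norm w) * norm w"
      using mult_ex[OF xm w] by blast
    have "pt z = pt (x (Suc m))" using z x[of m] x[of "Suc m"] Suc.prems by simp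
    then have "z = x (Suc m)" using pt_inj z xs by blast
    have "norm (x (Suc m) - real (Suc m) *\<^sub>R w) \<le> norm (x m - real m *\<^sub>R w) + norm (z - x m - w)"
      using norm_triangle_ineq[of "x m - real m *\<^sub>R w" "z - x m - w"] \<open>z = x (Suc m)\<close>
      by (simp add: algebra_simps)
    also have "\<dots> \<le> 2 * C * \<rho> * real m * norm w + C * (\<rho> + \<rho>) * norm w"
    proof (rule add_mono)
      show "norm (z - x m - w) \<le> C * (\<rho> + \<rho>) * norm w"
        using z(3) by (rule order_trans) (use xr wr C_pos in \<open>intro mult_right_mono mult_left_mono add_mono, auto\<close>)
    qed (use Suc in simp)
    finally show ?case by (simp add: algebra_simps)
  qed
  then show ?thesis by simp
qed

text \<open>The a priori bound |x j| \<le> 2 j |w| reproduces itself: it keeps the powers in the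
  ball of radius \<rho>, and there the relative error in \<open>power_coord\<close> is 2 C \<rho>
  \<le> 1, by \<open>CR\<close>.\<close>

lemma power_ex:
  assumes "2 * real n * norm w \<le> \<rho>" "\<rho> < R" "k \<le> n" "norm w < R"
  shows "\<exists>x. (\<forall>j\<le>k. pt w [^] j = pt (x j) \<and> norm (x j) \<le> 2 * real j * norm w)"
  using assms(3)
proof (induction k)
  case 0
  show ?case by (rule exI[of _ "\<lambda>_. 0"]) (simp add: pt_0)
next
  case (Suc k)
  then obtain x where x: "\<And>j. j \<le> k \<Longrightarrow> pt w [^] j = pt (x j) \<and> norm (x j) \<le> 2 * real j * norm w"
    by auto
  have mono: "2 * real j * norm w \<le> \<rho>" if "j \<le> n" for j
    using assms(1) mult_right_mono[of "2 * real j" "2 * real n" "norm w"] that by simp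
  have xk: "norm (x k) \<le> \<rho>" using x[of k] mono[of k] Suc.prems by simp
  have wr: "norm w \<le> \<rho>" using mono[of 1] Suc.prems by simp (metis norm_ge_zero order_trans mult_2 le_add_same_cancel1)
  obtain z where z: "norm z < R0" "pt (x k) \<otimes> pt w = pt z"
       "norm (z - x k - w) \<le> C * (norm (x k) + norm w) * norm w"
    using mult_ex[of "x k" w] xk assms by auto
  have "norm (x k - real k *\<^sub>R w) \<le> 2 * C * \<rho> * real k * norm w"
  proof (rule power_coord)
    show "pt w [^] j = pt (x j) \<and> norm (x j) \<le> \<rho>" if "j \<le> k" for j
      using x[OF that] mono[of j] that Suc.prems by auto
  qed (use assms in auto)
  moreover have "norm (z - x k - w) \<le> C * (\<rho> + \<rho>) * norm w"
    using z(3) by (rule order_trans) (use xk wr C_pos in \<open>intro mult_right_mono mult_left_mono add_mono, auto\<close>)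
  ultimately have d: "norm (z - real (Suc k) *\<^sub>R w) \<le> 2 * C * \<rho> * real (Suc k) * norm w"
    using norm_triangle_ineq[of "x k - real k *\<^sub>R w" "z - x k - w"]
    by (simp add: algebra_simps)
  have "C * \<rho> \<le> C * R" using \<open>\<rho> < R\<close> C_pos by simp
  then have "2 * C * \<rho> \<le> 1" using CR by linarith
  then have "2 * C * \<rho> * (real (Suc k) * norm w) \<le> 1 * (real (Suc k) * norm w)"
    by (rule mult_right_mono) simp
  then have "norm (z - real (Suc k) *\<^sub>R w) \<le> real (Suc k) * norm w"
    using d by (simp only: mult.assoc mult_1)
  then have "norm z \<le> 2 * real (Suc k) * norm w"
    using norm_triangle_ineq[of "z - real (Suc k) *\<^sub>R w" "real (Suc k) *\<^sub>R w"]
    by (simp add: distrib_right)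
  then show ?case using x z
    by (intro exI[of _ "x(Suc k := z)"]) (auto simp: le_Suc_eq)
qed

text \<open>Powers of a point grow linearly as long as they stay in the chart, so a homomorphism that maps
  a small ball into the chart is Lipschitz at the identity.\<close>

lemma hom_lipschitz:
  assumes \<theta>: "\<theta> \<in> hom G G" and \<rho>: "0 < \<rho>" "\<rho> < R"
    and f: "\<And>y. norm y \<le> \<rho> \<Longrightarrow> norm (f y) \<le> R / 2 \<and> \<theta> (pt y) = pt (f y)"
    and y: "norm y \<le> \<rho> / 4"
  shows "norm (f y) \<le> 4 * R / \<rho> * norm y"
proof (cases "y = 0")
  case True
  have "\<theta> \<one> = \<one>" using \<theta> hom_one is_group by blast
  then have "pt (f 0) = pt 0" using f[of 0] \<rho> by (simp add: pt_0)
  then have "f 0 = 0" using pt_inj[of "f 0" 0] f[of 0] \<rho> R_pos R_le by auto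
  then show ?thesis using True by simp
next
  case False
  \<comment> \<open>This n is of the largest order for which the powers of y up to n stay in the
    ball of radius \<rho>; the bound |y| \<le> \<rho> / 4 pays for rounding up. Since n f(y) differs
    from f(x n) by at most half of its own norm, |f y| \<le> R / n follows.\<close>
  define n where "n = nat \<lceil>\<rho> / (4 * norm y)\<rceil>"
  have ny: "norm y > 0" using False by simp
  have n1: "real n \<ge> \<rho> / (4 * norm y)" unfolding n_def by (rule real_nat_ceiling_ge)
  have "real n < \<rho> / (4 * norm y) + 1"
    unfolding n_def using \<rho> ny ceiling_correct[of "\<rho> / (4 * norm y)"]
    by (simp add: of_nat_nat)
  then have "2 * real n * norm y \<le> 2 * (\<rho> / (4 * norm y) + 1) * norm y"
    by (intro mult_right_mono) auto
  also have "\<dots> = \<rho> / 2 + 2 * norm y" using ny by (simp add: field_simps)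
  also have "\<dots> \<le> \<rho>" using y by simp
  finally have n2: "2 * real n * norm y \<le> \<rho>" .
  have yR: "norm y < R" using y \<rho> by simp
  obtain x where x: "\<And>j. j \<le> n \<Longrightarrow> pt y [^] j = pt (x j) \<and> norm (x j) \<le> 2 * real j * norm y"
    using power_ex[OF n2 \<rho>(2) order_refl yR] by blast
  have xr: "norm (x j) \<le> \<rho>" if "j \<le> n" for j
    using x[OF that] n2 mult_right_mono[of "2 * real j" "2 * real n" "norm y"] that by simp
  have pw: "pt (f y) [^] j = pt (f (x j)) \<and> norm (f (x j)) \<le> R / 2" if "j \<le> n" for j
  proof -
    have "pt (f y) [^] j = \<theta> (pt y [^] j)"
      using \<theta> f[of y] y \<rho> pt_closed'[OF yR] by (simp add: hom_nat_pow is_group)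
    then show ?thesis using x[OF that] f[OF xr[OF that]] by auto
  qed
  have fy: "norm (f y) \<le> R / 2" using f[of y] y \<rho> by auto
  have "norm (f (x n) - real n *\<^sub>R f y) \<le> 2 * C * (R / 2) * real n * norm (f y)"
    by (rule power_coord) (use pw fy R_pos in auto)
  also have "\<dots> = (C * R) * (real n * norm (f y))" by simp
  also have "\<dots> \<le> (1 / 2) * (real n * norm (f y))"
    using CR by (intro mult_right_mono) auto
  finally have "real n * norm (f y) \<le> 2 * norm (f (x n))"
    using norm_triangle_ineq2[of "real n *\<^sub>R f y" "f (x n)"] by (simp add: norm_minus_commute)
  then have "real n * norm (f y) \<le> R" using pw[of n] by simp
  moreover have "\<rho> / (4 * norm y) * norm (f y) \<le> real n * norm (f y)"
    using n1 by (intro mult_right_mono) auto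
  ultimately have "\<rho> / (4 * norm y) * norm (f y) \<le> R" by simp
  then show ?thesis using ny \<rho> by (simp add: field_simps)
qed

text \<open>The point is the order of quantifiers: r and K depend on \<rho> but not on \<theta>.
  With z = y / n, the n-th power of pt z has coordinate y up to O(|y|^2), and the n-th power of pt(f
  z) has coordinate n f(z) up to O(|y|^2), uniformly in n. So f(y) - n f(y / n) = O(|y|^2), and n
  f(y / n) tends to L y.\<close>

lemma hom_quadratic:
  assumes \<rho>: "0 < \<rho>" "\<rho> < R"
  shows "\<exists>r K. 0 < r \<and> 0 < K \<and> (\<forall>\<theta> f L. \<theta> \<in> hom G G \<longrightarrow>
      (\<forall>y. norm y \<le> \<rho> \<longrightarrow> norm (f y) \<le> R / 2 \<and> \<theta> (pt y) = pt (f y)) \<longrightarrow>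
      (f has_derivative L) (at 0) \<longrightarrow>
      (\<forall>y. norm y \<le> r \<longrightarrow> norm (f y - L y) \<le> K * (norm y)\<^sup>2 \<and> norm (f y) \<le> K * norm y))"
proof -
  \<comment> \<open>B is the Lipschitz constant from \<open>hom_lipschitz\<close>. In K, the term 4
    C B^2 is the error of \<open>power_coord\<close> in the image, 4 C^3 B comes from replacing x n
    by y, and the last summand B covers the linear bound.\<close>
  define B where "B = 4 * R / \<rho>"
  define r where "r = \<rho> / (16 * C)"
  define K where "K = 4 * C * B\<^sup>2 + 4 * C ^ 3 * B + B"
  have B: "B > 0" using \<rho> R_pos by (simp add: B_def)
  have r: "0 < r" "r \<le> \<rho> / 16" "16 * C * r = \<rho>"
    using \<rho> C_ge by (auto simp: r_def field_simps mult_le_cancel_left1)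
  have "R \<le> 1 / 8" using CR C_ge R_pos mult_right_mono[of 1 C R] by linarith
  have main: "norm (f y - L y) \<le> K * (norm y)\<^sup>2 \<and> norm (f y) \<le> K * norm y"
    if \<theta>: "\<theta> \<in> hom G G" and f: "\<And>y. norm y \<le> \<rho> \<Longrightarrow> norm (f y) \<le> R / 2 \<and> \<theta> (pt y) = pt (f y)"
      and L: "(f has_derivative L) (at 0)" and y: "norm y \<le> r" for \<theta> f L y
  proof -
    have lip: "norm (f z) \<le> B * norm z" if "norm z \<le> \<rho> / 4" for z
      unfolding B_def using hom_lipschitz[OF \<theta> \<rho> f that] by blast
    have f0: "f 0 = 0" using lip[of 0] \<rho> by simp
    have step: "norm (f y - real n *\<^sub>R f (y /\<^sub>R real n)) \<le> (4 * C * B\<^sup>2 + 4 * C ^ 3 * B) * (norm y)\<^sup>2"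
      if n: "n \<ge> 1" for n
    proof -
      define z where "z = y /\<^sub>R real n"
      have nz: "real n * norm z = norm y" and nzy: "real n *\<^sub>R z = y" using n by (auto simp: z_def)
      have zy: "norm z \<le> norm y" using n nz mult_right_mono[of 1 "real n" "norm z"] by simp
      have b1: "norm z < R" using zy y r \<rho> by linarith
      have b2: "2 * real n * norm z \<le> 2 * norm y" using nz by simp
      have b3: "2 * norm y < R" using y r \<rho> by linarith
      obtain x where x: "\<And>j. j \<le> n \<Longrightarrow> pt z [^] j = pt (x j) \<and> norm (x j) \<le> 2 * real j * norm z"
        using power_ex[OF b2 b3 order_refl b1] by blast
      have xr: "norm (x j) \<le> 2 * norm y" if "j \<le> n" for j
        using x[OF that] b2 mult_right_mono[of "2 * real j" "2 * real n" "norm z"] that by simp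
      have xy: "norm (x n - y) \<le> 4 * C * (norm y)\<^sup>2"
        using power_coord[of n z x "2 * norm y"] x xr b3 b1 nz nzy
        by (simp add: power2_eq_square mult.assoc)
      have fz: "norm (f z) \<le> B * norm z" using lip zy y r \<rho> by simp
      have "B * (2 * norm y) \<le> B * (2 * r)" using y B by simp
      also have "\<dots> \<le> B * (2 * (\<rho> / 16))" using r B by (intro mult_left_mono) auto
      also have "\<dots> < R" using \<rho> R_pos by (simp add: B_def)
      finally have b4: "2 * B * norm y < R" by simp
      have pw: "pt (f z) [^] j = pt (f (x j)) \<and> norm (f (x j)) \<le> 2 * B * norm y" if "j \<le> n" for j
      proof -
        have "norm (x j) \<le> \<rho> / 4" using xr[OF that] y r by linarith
        then have "norm (f (x j)) \<le> B * norm (x j)" using lip by blast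
        also have "\<dots> \<le> B * (2 * norm y)" using xr[OF that] B by (intro mult_left_mono) auto
        finally have 1: "norm (f (x j)) \<le> 2 * B * norm y" by simp
        have "pt (f z) [^] j = \<theta> (pt z [^] j)"
          using \<theta> f[of z] zy y r \<rho> pt_closed'[OF b1] by (simp add: hom_nat_pow is_group)
        also have "\<dots> = pt (f (x j))" using x[OF that] f[of "x j"] xr[OF that] y r \<rho> by simp
        finally show ?thesis using 1 by simp
      qed
      have "norm (f z) < R" using f[of z] zy y r \<rho> R_pos by force
      then have "norm (f (x n) - real n *\<^sub>R f z) \<le> 2 * C * (2 * B * norm y) * real n * norm (f z)"
        using power_coord[of n "f z" "\<lambda>j. f (x j)" "2 * B * norm y"] pw b4 by blast
      also have "\<dots> \<le> 2 * C * (2 * B * norm y) * real n * (B * norm z)"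
        using fz C_pos B by (intro mult_left_mono) auto
      also have "\<dots> = 4 * C * B\<^sup>2 * norm y * (real n * norm z)" by (simp add: power2_eq_square)
      finally have s1: "norm (f (x n) - real n *\<^sub>R f z) \<le> 4 * C * B\<^sup>2 * (norm y)\<^sup>2"
        unfolding nz by (simp add: power2_eq_square)
      have yR: "norm y < R" and xR: "norm (x n) < R" using b3 xr[of n] norm_ge_zero[of y] by linarith+
      \<comment> \<open>The error x n - y is of second order, but f is not additive; so it is split
        off as a factor pt u, to which the homomorphism property and the linear bound of f
        apply.\<close>
      obtain u where u: "norm u < R0" "pt (x n) = pt y \<otimes> pt u" "norm u \<le> C * norm (x n - y)"
        using diff_ex[OF yR xR] by blast
      have "C * norm (x n - y) \<le> C * (4 * C * (norm y)\<^sup>2)" using xy C_pos by simp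
      then have u2: "norm u \<le> 4 * C\<^sup>2 * (norm y)\<^sup>2" using u by (simp add: power2_eq_square)
      also have "4 * C\<^sup>2 * (norm y)\<^sup>2 \<le> 4 * C\<^sup>2 * r\<^sup>2" using y C_pos by (intro mult_left_mono power_mono) auto
      also have "\<dots> = \<rho> * \<rho> / 64" using C_pos by (simp add: r_def power2_eq_square)
      also have "\<dots> \<le> \<rho> / 4" using \<rho> \<open>R \<le> 1 / 8\<close> mult_left_mono[of \<rho> 16 \<rho>] by simp
      finally have u3: "norm u \<le> \<rho> / 4" .
      have fu: "norm (f u) \<le> B * norm u" using lip u3 by blast
      have "pt (f (x n)) = \<theta> (pt y \<otimes> pt u)" using u f[of "x n"] xr[of n] y r by auto
      also have "\<dots> = \<theta> (pt y) \<otimes> \<theta> (pt u)" using \<theta> pt_closed' yR u by (simp add: hom_mult pt_closed)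
      also have "\<dots> = pt (f y) \<otimes> pt (f u)" using f[of y] f[of u] y r u3 \<rho> by auto
      finally have e: "pt (f (x n)) = pt (f y) \<otimes> pt (f u)" .
      have fr: "norm (f y) < R" "norm (f u) < R" "norm (f (x n)) < R"
      proof -
        have "norm (f y) \<le> R / 2" "norm (f u) \<le> R / 2" "norm (f (x n)) \<le> R / 2"
          using f[of y] f[of u] f[of "x n"] y r(2) u3 \<rho> xr[of n] by auto
        then show "norm (f y) < R" "norm (f u) < R" "norm (f (x n)) < R" using R_pos by linarith+
      qed
      obtain v where v: "norm v < R0" "pt (f y) \<otimes> pt (f u) = pt v" "norm (v - f y) \<le> C * norm (f u)"
        using mult_ex[OF fr(1,2)] by blast
      have "v = f (x n)" using pt_inj[of v "f (x n)"] v e fr R_le by auto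
      then have "norm (f (x n) - f y) \<le> C * norm (f u)" using v by simp
      also have "\<dots> \<le> C * (B * (4 * C\<^sup>2 * (norm y)\<^sup>2))"
        using fu u2 B C_pos by (intro mult_left_mono) (auto intro: order_trans)
      finally have "norm (f (x n) - f y) \<le> 4 * C ^ 3 * B * (norm y)\<^sup>2"
        by (simp add: power2_eq_square power3_eq_cube mult_ac)
      then show ?thesis
        using s1 norm_triangle_ineq4[of "f (x n) - real n *\<^sub>R f z" "f (x n) - f y"]
        unfolding z_def by (simp add: algebra_simps)
    qed
    \<comment> \<open>The rate at which n f(y / n) approaches L y depends on f and y, but n is
      chosen last and the bound in \<open>step\<close> is independent of it.\<close>
    have "norm (f y - L y) \<le> (4 * C * B\<^sup>2 + 4 * C ^ 3 * B) * (norm y)\<^sup>2 + \<epsilon>" if "\<epsilon> > 0" for \<epsilon>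
    proof -
      define \<epsilon>' where "\<epsilon>' = \<epsilon> / (norm y + 1)"
      have "\<epsilon>' > 0" using that by (simp add: \<epsilon>'_def add_nonneg_pos)
      have "\<epsilon>' * norm y \<le> \<epsilon>' * (norm y + 1)" using \<open>\<epsilon>' > 0\<close> by simp
      also have "\<dots> = \<epsilon>" using norm_ge_zero[of y] by (simp add: \<epsilon>'_def add_nonneg_eq_0_iff)
      finally have \<epsilon>': "\<epsilon>' * norm y \<le> \<epsilon>" .
      obtain d where d: "d > 0" "\<And>h. norm h < d \<Longrightarrow> norm (f h - L h) \<le> \<epsilon>' * norm h"
        using L[unfolded has_derivative_at_alt, THEN conjunct2, rule_format, OF \<open>\<epsilon>' > 0\<close>] f0 by auto
      obtain n where n: "norm y / d < real n" using reals_Archimedean2 by blast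
      have n1: "n \<ge> 1" using n d by (cases n) (auto simp: divide_less_0_iff not_less)
      have "norm (y /\<^sub>R real n) < d" using n n1 d by (simp add: field_simps)
      then have "norm (f (y /\<^sub>R real n) - L (y /\<^sub>R real n)) \<le> \<epsilon>' * norm (y /\<^sub>R real n)" using d by blast
      then have "real n * norm (f (y /\<^sub>R real n) - L (y /\<^sub>R real n)) \<le> \<epsilon>' * norm y"
        using n1 by (simp add: field_simps)
      moreover have "real n *\<^sub>R L (y /\<^sub>R real n) = L y"
        using linear_simps(5)[OF has_derivative_bounded_linear[OF L], of "real n" "y /\<^sub>R real n"] n1 by simp
      then have "real n * norm (f (y /\<^sub>R real n) - L (y /\<^sub>R real n)) = norm (real n *\<^sub>R f (y /\<^sub>R real n) - L y)"
        using norm_scaleR[of "real n" "f (y /\<^sub>R real n) - L (y /\<^sub>R real n)"] by (simp add: scaleR_diff_right)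
      ultimately show ?thesis
        using step[OF n1] \<epsilon>' norm_triangle_ineq[of "f y - real n *\<^sub>R f (y /\<^sub>R real n)" "real n *\<^sub>R f (y /\<^sub>R real n) - L y"]
        by simp
    qed
    then have "norm (f y - L y) \<le> (4 * C * B\<^sup>2 + 4 * C ^ 3 * B) * (norm y)\<^sup>2" by (rule field_le_epsilon)
    moreover have "(4 * C * B\<^sup>2 + 4 * C ^ 3 * B) * (norm y)\<^sup>2 \<le> K * (norm y)\<^sup>2"
      using B by (intro mult_right_mono) (auto simp: K_def)
    moreover have "norm (f y) \<le> B * norm y" using lip y r \<rho> by auto
    moreover have "B * norm y \<le> K * norm y"
      using B C_pos by (intro mult_right_mono) (auto simp: K_def)
    ultimately show ?thesis by linarith
  qed
  have "K > 0" using B C_pos by (auto simp: K_def intro!: add_nonneg_pos)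
  show ?thesis
  proof (rule exI[of _ r], rule exI[of _ K], intro conjI allI impI)
    fix \<theta> and f L :: "'e \<Rightarrow> 'e" and y :: "'e"
    assume "\<theta> \<in> hom G G" "\<forall>y. norm y \<le> \<rho> \<longrightarrow> norm (f y) \<le> R / 2 \<and> \<theta> (pt y) = pt (f y)"
      "(f has_derivative L) (at 0)" "norm y \<le> r"
    then have "norm (f y - L y) \<le> K * (norm y)\<^sup>2 \<and> norm (f y) \<le> K * norm y" by (intro main) auto
    then show "norm (f y - L y) \<le> K * (norm y)\<^sup>2" "norm (f y) \<le> K * norm y" by auto
  qed (use r \<open>K > 0\<close> in auto)
qed

lemma has_ld_ex:
  assumes "has_ld G pt c v t S" "norm v \<le> A" "\<epsilon> > 0" "\<rho> > 0"
  shows "\<exists>\<delta>>0. \<forall>s\<in>S. \<bar>s - t\<bar> < \<delta> \<longrightarrow>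
    (\<exists>z. c s = c t \<otimes> pt z \<and> norm (z - (s - t) *\<^sub>R v) \<le> \<epsilon> * \<bar>s - t\<bar> \<and>
      norm z \<le> (A + \<epsilon>) * \<bar>s - t\<bar> \<and> norm z < \<rho>)"
proof -
  obtain \<delta> where \<delta>: "\<delta> > 0" "\<And>s. s \<in> S \<Longrightarrow> \<bar>s - t\<bar> < \<delta> \<Longrightarrow>
      \<exists>z. c s = c t \<otimes> pt z \<and> norm (z - (s - t) *\<^sub>R v) \<le> \<epsilon> * \<bar>s - t\<bar>"
    using assms(1,3) unfolding has_ld_def by blast
  define \<delta>' where "\<delta>' = min \<delta> (\<rho> / (A + \<epsilon>))"
  have A: "A + \<epsilon> > 0" using assms norm_ge_zero[of v] by linarith
  show ?thesis
  proof (intro exI[of _ \<delta>'] conjI ballI impI)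
    fix s assume s: "s \<in> S" "\<bar>s - t\<bar> < \<delta>'"
    then obtain z where z: "c s = c t \<otimes> pt z" "norm (z - (s - t) *\<^sub>R v) \<le> \<epsilon> * \<bar>s - t\<bar>"
      using \<delta>(2)[of s] by (auto simp: \<delta>'_def)
    have "norm z \<le> norm (z - (s - t) *\<^sub>R v) + \<bar>s - t\<bar> * norm v"
      using norm_triangle_ineq[of "z - (s - t) *\<^sub>R v" "(s - t) *\<^sub>R v"] by simp
    also have "\<bar>s - t\<bar> * norm v \<le> \<bar>s - t\<bar> * A" using assms by (intro mult_left_mono) auto
    finally have "norm z \<le> (A + \<epsilon>) * \<bar>s - t\<bar>" using z by (simp add: algebra_simps)
    moreover have "(A + \<epsilon>) * \<bar>s - t\<bar> < \<rho>" using s A by (simp add: \<delta>'_def field_simps)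
    ultimately show "\<exists>z. c s = c t \<otimes> pt z \<and> norm (z - (s - t) *\<^sub>R v) \<le> \<epsilon> * \<bar>s - t\<bar> \<and>
      norm z \<le> (A + \<epsilon>) * \<bar>s - t\<bar> \<and> norm z < \<rho>" using z by force
  qed (use \<delta> A assms in \<open>simp add: \<delta>'_def\<close>)
qed

section \<open>Comparing two curves through the coordinate of their quotient\<close>

lemma conj_group:
  assumes "x \<in> carrier G" "y \<in> carrier G" "norm q < R" "norm p < R" "norm e < R" "inv x \<otimes> y = pt e"
  shows "inv (x \<otimes> pt q) \<otimes> (y \<otimes> pt p) = inv (pt q) \<otimes> pt e \<otimes> pt p"
proof -
  have "inv (x \<otimes> pt q) \<otimes> (y \<otimes> pt p) = inv (pt q) \<otimes> (inv x \<otimes> y) \<otimes> pt p"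
    using assms(1-5) pt_closed' by (simp add: inv_mult_group m_assoc)
  then show ?thesis using assms by simp
qed

text \<open>By \<open>conj_ex\<close>, the norm of the next deviation is at most (1 + C a) |e| + C
  b. The bound C b m exp(C a m) increases with m, so \<open>small\<close>, which concerns n alone,
  keeps all earlier deviations in the ball where \<open>conj_ex\<close> applies.\<close>

lemma discrete_gronwall:
  fixes n :: nat
  assumes "c 0 = d 0" "c 0 \<in> carrier G"
    and c: "\<And>k. k < n \<Longrightarrow> c (Suc k) = c k \<otimes> pt (q k) \<and> norm (q k) < R \<and> norm (q k) \<le> a"
    and d: "\<And>k. k < n \<Longrightarrow> d (Suc k) = d k \<otimes> pt (p k) \<and> norm (p k) < R \<and> norm (p k - q k) \<le> b"
    and ab: "0 \<le> a" "0 \<le> b" and small: "C * b * n * exp (C * a * n) < R"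
  shows "c n \<in> carrier G \<and> d n \<in> carrier G \<and>
     (\<exists>z. norm z \<le> C * b * n * exp (C * a * n) \<and> inv (c n) \<otimes> d n = pt z)"
proof -
  have "m \<le> n \<Longrightarrow> c m \<in> carrier G \<and> d m \<in> carrier G \<and>
     (\<exists>z. norm z \<le> C * b * m * exp (C * a * m) \<and> inv (c m) \<otimes> d m = pt z)" for m :: nat
  proof (induction m)
    case 0
    then show ?case using assms(1,2) by (auto simp: pt_0)
  next
    case (Suc m)
    then obtain e where e: "norm e \<le> C * b * m * exp (C * a * m)" "inv (c m) \<otimes> d m = pt e"
      and cd: "c m \<in> carrier G" "d m \<in> carrier G" by auto
    note cm = c[of m] and dm = d[of m]
    have "C * b * m * exp (C * a * m) \<le> C * b * n * exp (C * a * n)"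
      using Suc.prems ab C_pos by (intro mult_mono) (auto intro!: mult_left_mono)
    then have eR: "norm e < R" using e small by simp
    obtain z where z: "norm z < R0" "inv (pt (q m)) \<otimes> pt e \<otimes> pt (p m) = pt z"
        "norm (z - e) \<le> C * (norm e * norm (q m) + norm (p m - q m))"
      using conj_ex[OF eR, of "q m" "p m"] cm dm Suc.prems by auto
    have "norm z \<le> norm e + norm (z - e)" using norm_triangle_ineq[of e "z - e"] by simp
    also have "\<dots> \<le> norm e + C * (norm e * a + b)"
      using z(3) cm dm Suc.prems C_pos
      by (auto intro!: add_left_mono order_trans[OF z(3)] mult_left_mono add_mono)
    also have "\<dots> = norm e * (1 + C * a) + C * b" by (simp add: algebra_simps)
    also have "\<dots> \<le> (C * b * m * exp (C * a * m)) * exp (C * a) + C * b * exp (C * a * Suc m)"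
    proof (rule add_mono[OF mult_mono[OF e(1)]])
      show "1 + C * a \<le> exp (C * a)" by (rule exp_ge_add_one_self)
      have "C * b * 1 \<le> C * b * exp (C * a * Suc m)" using ab C_pos by (intro mult_left_mono) auto
      then show "C * b \<le> C * b * exp (C * a * Suc m)" by simp
    qed (use ab C_pos in auto)
    also have "\<dots> = C * b * Suc m * exp (C * a * Suc m)"
      by (simp add: algebra_simps exp_add)
    finally have "norm z \<le> C * b * Suc m * exp (C * a * Suc m)" .
    moreover have "inv (c (Suc m)) \<otimes> d (Suc m) = pt z"
      using conj_group[of "c m" "d m" "q m" "p m" e] cd cm dm Suc.prems e eR z by simp
    ultimately show ?case using cd cm dm Suc.prems pt_closed' by auto
  qed
  then show ?thesis by blast
qed

lemma pt_inj': "norm v < R0 \<Longrightarrow> norm w < R \<Longrightarrow> pt v = pt w \<Longrightarrow> v = w"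
  using pt_inj[of v w] R_le by linarith

text \<open>Equality propagates over short intervals, hence by \<open>Bolzano\<close> over the whole
  one. On a short interval, any bound m for the coordinate e of the quotient also bounds its rate of
  change, up to a constant; so the bound improves by the factor 3/4, again and again, and e
  vanishes.\<close>

lemma ld_unique:
  assumes "a \<le> b" and cd: "\<And>t. t \<in> {a..b} \<Longrightarrow> c t \<in> carrier G \<and> d t \<in> carrier G"
    and \<xi>: "\<And>t. t \<in> {a..b} \<Longrightarrow> norm (\<xi> t) \<le> A"
    and c: "\<And>t. t \<in> {a..b} \<Longrightarrow> has_ld G pt c (\<xi> t) t {a..b}"
    and d: "\<And>t. t \<in> {a..b} \<Longrightarrow> has_ld G pt d (\<xi> t) t {a..b}"
    and eq: "c a = d a"
  shows "c b = d b"
proof -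
  define P where "P x y \<longleftrightarrow> (a \<le> x \<and> y \<le> b \<and> c x = d x \<longrightarrow> c y = d y)" for x y
  have A0: "0 \<le> A" using order_trans[OF norm_ge_zero \<xi>[of a]] \<open>a \<le> b\<close> by simp
  have "P a b"
  proof (rule Bolzano[OF \<open>a \<le> b\<close>])
    fix x y z assume "P x y" "P y z" "x \<le> y" "y \<le> z"
    then show "P x z" by (auto simp: P_def)
  next
    fix x assume x: "a \<le> x" "x \<le> b"
    then have xab: "x \<in> {a..b}" by simp
    \<comment> \<open>Four increments below r are combined by two quotients and one product; 8 C^2 r
      = R keeps the result in the ball of radius R.\<close>
    define r where "r = R / (8 * C\<^sup>2)"
    have CC: "C \<le> C\<^sup>2" using C_ge by (simp add: power2_eq_square)
    have "r > 0" using R_pos C_pos by (simp add: r_def)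
    obtain \<delta>1 where \<delta>1: "\<delta>1 > 0" "\<And>s. s \<in> {a..b} \<Longrightarrow> \<bar>s - x\<bar> < \<delta>1 \<Longrightarrow>
        \<exists>z. c s = c x \<otimes> pt z \<and> norm z < r"
      using has_ld_ex[OF c[OF xab] \<xi>[OF xab] zero_less_one \<open>r > 0\<close>] by blast
    obtain \<delta>2 where \<delta>2: "\<delta>2 > 0" "\<And>s. s \<in> {a..b} \<Longrightarrow> \<bar>s - x\<bar> < \<delta>2 \<Longrightarrow>
        \<exists>z. d s = d x \<otimes> pt z \<and> norm z < r"
      using has_ld_ex[OF d[OF xab] \<xi>[OF xab] zero_less_one \<open>r > 0\<close>] by blast
    \<comment> \<open>With the rate C (A + 1), the last entry limits the change over the interval to
      half of the current bound.\<close>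
    define \<delta> where "\<delta> = min (min \<delta>1 \<delta>2) (1 / (2 * C * (A + 1)))"
    have \<delta>: "\<delta> > 0" "\<delta> \<le> \<delta>1" "\<delta> \<le> \<delta>2" "C * (A + 1) * \<delta> \<le> 1 / 2"
    proof -
      have "C * (A + 1) > 0" using C_pos A0 by simp
      moreover have "\<delta> \<le> 1 / (2 * (C * (A + 1)))" by (simp add: \<delta>_def mult.assoc)
      ultimately show "C * (A + 1) * \<delta> \<le> 1 / 2" by (simp add: field_simps)
    qed (use \<delta>1 \<delta>2 C_pos A0 in \<open>auto simp: \<delta>_def\<close>)
    show "\<exists>\<delta>>0. \<forall>u v. u \<le> x \<and> x \<le> v \<and> v - u < \<delta> \<longrightarrow> P u v"
    proof (intro exI[of _ \<delta>] conjI allI impI)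
      fix u v assume uv: "u \<le> x \<and> x \<le> v \<and> v - u < \<delta>"
      show "P u v" unfolding P_def
      proof
        assume *: "a \<le> u \<and> v \<le> b \<and> c u = d u"
        have sub: "{u..v} \<subseteq> {a..b}" using * by auto
        have cx: "c x \<in> carrier G" "d x \<in> carrier G" using cd x by auto
        \<comment> \<open>Both curves are close to their own values at x, but equality is known only
          at u. Passing through u, the quotient at s is (pt qs)^-1 (pt qu) (pt pu)^-1 (pt ps), from
          which c x and d x have cancelled.\<close>
        have "\<exists>z. norm z < R \<and> inv (d s) \<otimes> c s = pt z" if s: "s \<in> {u..v}" for s
        proof -
          have near: "w \<in> {a..b}" "\<bar>w - x\<bar> < \<delta>1" "\<bar>w - x\<bar> < \<delta>2" if "w \<in> {u..v}" for w
          proof -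
            have "\<bar>w - x\<bar> < \<delta>" using uv that by auto
            then show "\<bar>w - x\<bar> < \<delta>1" "\<bar>w - x\<bar> < \<delta>2" using \<delta>(2,3) by linarith+
            show "w \<in> {a..b}" using sub that by blast
          qed
          have "u \<in> {u..v}" using uv by auto
          obtain ps where ps: "c s = c x \<otimes> pt ps" "norm ps < r"
            using \<delta>1(2)[of s] near[OF s] by blast
          obtain pu where pu: "c u = c x \<otimes> pt pu" "norm pu < r"
            using \<delta>1(2)[of u] near[OF \<open>u \<in> {u..v}\<close>] by blast
          obtain qs where qs: "d s = d x \<otimes> pt qs" "norm qs < r"
            using \<delta>2(2)[of s] near[OF s] by blast
          obtain qu where qu: "d u = d x \<otimes> pt qu" "norm qu < r"
            using \<delta>2(2)[of u] near[OF \<open>u \<in> {u..v}\<close>] by blast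
          have "8 * C\<^sup>2 * r = R" using C_pos by (simp add: r_def)
          have rC: "8 * r \<le> R" "C * (2 * r) \<le> R / 4" "C * (C * (2 * r)) = R / 4"
          proof -
            have "1 \<le> C\<^sup>2" using C_ge by simp
            then show "8 * r \<le> R" using \<open>8 * C\<^sup>2 * r = R\<close> \<open>r > 0\<close> mult_right_mono[of 1 "C\<^sup>2" "8 * r"]
              by (simp add: mult_ac)
            show "C * (2 * r) \<le> R / 4" using \<open>8 * C\<^sup>2 * r = R\<close> \<open>r > 0\<close> CC mult_right_mono[of C "C\<^sup>2" "8 * r"]
              by (simp add: mult_ac)
            show "C * (C * (2 * r)) = R / 4" using \<open>8 * C\<^sup>2 * r = R\<close> by (simp add: power2_eq_square)
          qed
          have R': "norm ps < R" "norm pu < R" "norm qs < R" "norm qu < R"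
            using ps pu qs qu rC \<open>r > 0\<close> by linarith+
          obtain y where y: "pt qu = pt qs \<otimes> pt y" "norm y \<le> C * norm (qu - qs)" "norm y < R0"
            using diff_ex[OF R'(3,4)] by blast
          obtain w where w: "pt ps = pt pu \<otimes> pt w" "norm w \<le> C * norm (ps - pu)" "norm w < R0"
            using diff_ex[OF R'(2,1)] by blast
          have "norm (qu - qs) \<le> 2 * r" "norm (ps - pu) \<le> 2 * r"
            using norm_triangle_ineq4[of qu qs] norm_triangle_ineq4[of ps pu] ps pu qs qu by linarith+
          then have yr: "C * norm (qu - qs) \<le> C * (2 * r)" and wr: "C * norm (ps - pu) \<le> C * (2 * r)"
            using C_pos by (simp_all add: mult_left_mono)
          have yR: "norm y < R" and wR: "norm w < R" and y4: "norm y \<le> R / 4" using y w rC R_pos yr wr by linarith+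
          obtain z where z: "norm z < R0" "pt y \<otimes> pt w = pt z" "norm (z - y) \<le> C * norm w"
            using mult_ex[OF yR wR] by blast
          have "C * norm w \<le> C * (C * (2 * r))" using order_trans[OF w(2) wr] C_pos by (intro mult_left_mono) simp_all
          then have "norm z < R" using z y4 rC R_pos norm_triangle_ineq[of "z - y" y] by simp
          moreover have "inv (d s) \<otimes> c s = pt z"
          proof -
            have cl: "pt ps \<in> carrier G" "pt pu \<in> carrier G" "pt qs \<in> carrier G" "pt qu \<in> carrier G"
                "pt y \<in> carrier G" "pt w \<in> carrier G"
              using R' yR wR pt_closed' by auto
            have "d x \<otimes> pt qu = c x \<otimes> pt pu" using * pu qu by simp
            then have 1: "d x \<otimes> pt qs \<otimes> pt y = c x \<otimes> pt pu"
              using y cl cx by (simp add: m_assoc)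
            have "d s \<otimes> pt z = d x \<otimes> pt qs \<otimes> pt y \<otimes> pt w"
              using qs z(2)[symmetric] cl cx by (simp add: m_assoc)
            also have "\<dots> = c s"
              using ps w cl cx unfolding 1 by (simp add: m_assoc)
            finally have "d s \<otimes> pt z = c s" .
            then show ?thesis using cd[OF near(1)[OF s]] pt_closed[OF z(1)] inv_solve_left'[of "pt z" "d s" "c s"]
              by auto
          qed
          ultimately show ?thesis by blast
        qed
        then obtain e where e: "\<And>s. s \<in> {u..v} \<Longrightarrow> norm (e s) < R \<and> inv (d s) \<otimes> c s = pt (e s)"
          using bchoice[of "{u..v}" "\<lambda>s z. norm z < R \<and> inv (d s) \<otimes> c s = pt z"] by blast
        have uu: "u \<in> {u..v}" using uv by auto
        have "pt (e u) = pt 0" using e[OF uu] * cd[of u] sub uu by (auto simp: pt_0)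
        then have eu: "e u = 0" using pt_inj[of "e u" 0] e[OF uu] R_le R_pos by auto
        have dec: "norm (e s) \<le> R * (3 / 4) ^ k" if "s \<in> {u..v}" for k s
          using that
        proof (induction k arbitrary: s)
          case 0
          then show ?case using e[of s] by auto
        next
          case (Suc k)
          define m where "m = R * (3 / 4) ^ k"
          have m: "m > 0" using R_pos by (simp add: m_def)
          have em: "norm (e t) \<le> m" if "t \<in> {u..v}" for t using Suc.IH[OF that] by (simp add: m_def)
          \<comment> \<open>The choice of \<delta> uses up m / 2 of the allowed 3 m / 4; the errors
            of the two logarithmic derivatives together contribute \<epsilon> \<le> m / 4. The bound
            1 lets A + \<epsilon> be replaced by A + 1.\<close>
          define \<epsilon> where "\<epsilon> = min 1 (m / 4)"
          have \<epsilon>: "\<epsilon> > 0" "\<epsilon> \<le> 1" "\<epsilon> \<le> m / 4" using m by (auto simp: \<epsilon>_def)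
          define M where "M = C * (m * (A + 1) + 2 * \<epsilon>)"
          have "norm (e s - e u) \<le> M * (s - u)"
          proof (rule local_lipschitz_bound)
            show "u \<le> s" using Suc.prems by auto
            fix t assume t: "t \<in> {u..s}"
            then have tv: "t \<in> {u..v}" and tb: "t \<in> {a..b}" using Suc.prems sub by auto
            obtain \<eta>1 where \<eta>1: "\<eta>1 > 0" "\<And>s. s \<in> {a..b} \<Longrightarrow> \<bar>s - t\<bar> < \<eta>1 \<Longrightarrow>
               \<exists>z. c s = c t \<otimes> pt z \<and> norm (z - (s - t) *\<^sub>R \<xi> t) \<le> \<epsilon> * \<bar>s - t\<bar> \<and> norm z \<le> (A + \<epsilon>) * \<bar>s - t\<bar> \<and> norm z < R"
              using has_ld_ex[OF c[OF tb] \<xi>[OF tb] \<epsilon>(1) R_pos] by blast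
            obtain \<eta>2 where \<eta>2: "\<eta>2 > 0" "\<And>s. s \<in> {a..b} \<Longrightarrow> \<bar>s - t\<bar> < \<eta>2 \<Longrightarrow>
               \<exists>z. d s = d t \<otimes> pt z \<and> norm (z - (s - t) *\<^sub>R \<xi> t) \<le> \<epsilon> * \<bar>s - t\<bar> \<and> norm z \<le> (A + \<epsilon>) * \<bar>s - t\<bar> \<and> norm z < R"
              using has_ld_ex[OF d[OF tb] \<xi>[OF tb] \<epsilon>(1) R_pos] by blast
            show "\<exists>\<delta>>0. \<forall>s'\<in>{u..s}. \<bar>s' - t\<bar> < \<delta> \<longrightarrow> norm (e s' - e t) \<le> M * \<bar>s' - t\<bar>"
            proof (intro exI[of _ "min \<eta>1 \<eta>2"] conjI ballI impI)
              fix s' assume s': "s' \<in> {u..s}" "\<bar>s' - t\<bar> < min \<eta>1 \<eta>2"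
              then have sv: "s' \<in> {u..v}" and sb: "s' \<in> {a..b}" using Suc.prems sub by auto
              obtain p where p: "c s' = c t \<otimes> pt p" "norm (p - (s' - t) *\<^sub>R \<xi> t) \<le> \<epsilon> * \<bar>s' - t\<bar>" "norm p < R"
                using \<eta>1(2)[OF sb] s' by auto
              obtain q where q: "d s' = d t \<otimes> pt q" "norm (q - (s' - t) *\<^sub>R \<xi> t) \<le> \<epsilon> * \<bar>s' - t\<bar>" "norm q < R"
                 "norm q \<le> (A + \<epsilon>) * \<bar>s' - t\<bar>"
                using \<eta>2(2)[OF sb] s' by auto
              have pq: "norm (p - q) \<le> 2 * \<epsilon> * \<bar>s' - t\<bar>"
                using norm_triangle_ineq4[of "p - (s' - t) *\<^sub>R \<xi> t" "q - (s' - t) *\<^sub>R \<xi> t"] p q by simp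
              obtain z where z: "norm z < R0" "inv (pt q) \<otimes> pt (e t) \<otimes> pt p = pt z"
                 "norm (z - e t) \<le> C * (norm (e t) * norm q + norm (p - q))"
                using conj_ex[of "e t" q p] e[OF tv] p q by auto
              have "inv (d s') \<otimes> c s' = pt z"
                using conj_group[of "d t" "c t" q p "e t"] cd[OF tb] p q z e[OF tv] by simp
              then have "pt z = pt (e s')" using e[OF sv] by simp
              then have "z = e s'" using pt_inj'[OF z(1)] e[OF sv] by blast
              then have "norm (e s' - e t) \<le> C * (norm (e t) * norm q + norm (p - q))" using z(3) by simp
              also have "\<dots> \<le> C * (m * ((A + 1) * \<bar>s' - t\<bar>) + 2 * \<epsilon> * \<bar>s' - t\<bar>)"
              proof (intro mult_left_mono add_mono mult_mono em tv pq)
                have "(A + \<epsilon>) * \<bar>s' - t\<bar> \<le> (A + 1) * \<bar>s' - t\<bar>" using \<epsilon> by (intro mult_right_mono) auto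
                then show "norm q \<le> (A + 1) * \<bar>s' - t\<bar>" using q by simp
              qed (use C_pos m in auto)
              also have "\<dots> = M * \<bar>s' - t\<bar>" by (simp add: M_def algebra_simps)
              finally show "norm (e s' - e t) \<le> M * \<bar>s' - t\<bar>" .
            qed (use \<eta>1 \<eta>2 in auto)
          qed
          also have "M * (s - u) \<le> M * \<delta>"
            using Suc.prems uv C_pos m A0 \<epsilon> by (intro mult_left_mono) (auto simp: M_def)
          also have "M * \<delta> = m * (C * (A + 1) * \<delta>) + 2 * \<epsilon> * (C * \<delta>)" by (simp add: M_def algebra_simps)
          also have "\<dots> \<le> m * (1 / 2) + 2 * \<epsilon> * (1 / 2)"
          proof (intro add_mono mult_left_mono \<delta>(4))
            have "C * 1 * \<delta> \<le> C * (A + 1) * \<delta>" using C_pos A0 \<delta>(1) by (intro mult_right_mono mult_left_mono) auto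
            then show "C * \<delta> \<le> 1 / 2" using \<delta>(4) by simp
          qed (use m \<epsilon> in auto)
          also have "\<dots> \<le> m * (3 / 4)" using \<epsilon> by simp
          finally show ?case using eu by (simp add: m_def)
        qed
        have vv: "v \<in> {u..v}" using uv by auto
        have "(\<lambda>k. R * (3 / 4 :: real) ^ k) \<longlonglongrightarrow> R * 0"
          by (intro tendsto_mult_left LIMSEQ_realpow_zero) auto
        then have "norm (e v) \<le> R * 0" using dec[OF vv] by (intro LIMSEQ_le_const) auto
        then have "inv (d v) \<otimes> c v = \<one>" using e[OF vv] by (simp add: pt_0)
        moreover have "c v \<in> carrier G" "d v \<in> carrier G" using cd sub vv by auto
        ultimately show "c v = d v" using inv_solve_left'[of \<one> "d v" "c v"] by simp
      qed
    qed (use \<delta> in auto)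
  qed
  then show ?thesis using eq by (simp add: P_def)
qed

section \<open>Solving the equation for a given logarithmic derivative\<close>

lemma F_bounds:
  assumes "norm q < R"
  shows "norm (F q v) \<le> 2 * norm v" "norm v \<le> 2 * norm (F q v)"
proof -
  have "norm (F q v - F 0 v) \<le> C * norm (q - 0) * norm v"
    using assms R_pos by (intro F_lipschitz) auto
  also have "C * norm (q - 0) \<le> C * R" using assms C_pos by (intro mult_left_mono) auto
  then have "C * norm (q - 0) * norm v \<le> (1 / 8) * norm v" using CR by (intro mult_right_mono) auto
  finally have "norm (F q v - v) \<le> norm v / 8" by (simp add: F_0)
  then show "norm (F q v) \<le> 2 * norm v" "norm v \<le> 2 * norm (F q v)"
    using norm_triangle_ineq2[of "F q v" v] norm_triangle_ineq3[of "F q v" v] by auto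
qed

lemma continuous_on_F:
  assumes x: "continuous_on S x" "\<And>t. t \<in> S \<Longrightarrow> norm (x t) < R" and \<xi>: "continuous_on S \<xi>"
  shows "continuous_on S (\<lambda>t. F (x t) (\<xi> t))"
  unfolding continuous_on_def
proof
  fix t assume t: "t \<in> S"
  have xt: "(x \<longlongrightarrow> x t) (at t within S)" and xit: "(\<xi> \<longlongrightarrow> \<xi> t) (at t within S)"
    using x \<xi> t by (auto simp: continuous_on_def)
  have "((\<lambda>s. F (x s) (\<xi> s) - F (x t) (\<xi> t)) \<longlongrightarrow> 0) (at t within S)"
  proof (rule Lim_null_comparison)
    have "((\<lambda>s. C * norm (x s - x t) * norm (\<xi> s) + 2 * norm (\<xi> s - \<xi> t)) \<longlongrightarrow>
       C * norm (x t - x t) * norm (\<xi> t) + 2 * norm (\<xi> t - \<xi> t)) (at t within S)"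
      by (intro tendsto_intros xt xit)
    then show "((\<lambda>s. C * norm (x s - x t) * norm (\<xi> s) + 2 * norm (\<xi> s - \<xi> t)) \<longlongrightarrow> 0) (at t within S)" by simp
    show "\<forall>\<^sub>F s in at t within S. norm (F (x s) (\<xi> s) - F (x t) (\<xi> t)) \<le> C * norm (x s - x t) * norm (\<xi> s) + 2 * norm (\<xi> s - \<xi> t)"
      unfolding eventually_at_filter
    proof (intro always_eventually allI impI)
      fix s assume s: "s \<in> S"
      have e: "F (x s) (\<xi> s) - F (x t) (\<xi> t) = (F (x s) (\<xi> s) - F (x t) (\<xi> s)) + F (x t) (\<xi> s - \<xi> t)"
        using F_linear[OF x(2)[OF t]] by (simp add: linear_diff)
      show "norm (F (x s) (\<xi> s) - F (x t) (\<xi> t)) \<le> C * norm (x s - x t) * norm (\<xi> s) + 2 * norm (\<xi> s - \<xi> t)"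
        unfolding e using F_lipschitz[OF x(2)[OF s] x(2)[OF t], of "\<xi> s"] F_bounds(1)[OF x(2)[OF t], of "\<xi> s - \<xi> t"]
        by (intro norm_triangle_le add_mono)
    qed
  qed
  then show "((\<lambda>s. F (x s) (\<xi> s)) \<longlongrightarrow> F (x t) (\<xi> t)) (at t within S)" by (simp add: LIM_zero_iff)
qed

text \<open>In the chart the equation reads x' = F(x) v. Writing pt(x s) = pt(x t) pt w,
  \<open>mult_F\<close> gives x s - x t = F(x t) w + O(|w|^2), and the lower bound for F(x t) in
  \<open>F_bounds\<close> recovers w = (s - t) v + o(|s - t|) without inverting an operator.\<close>

lemma has_ld_of_coords:
  assumes x: "\<And>s. s \<in> S \<Longrightarrow> norm (x s) < R" and t: "t \<in> S"
    and d: "(x has_vector_derivative F (x t) v) (at t within S)"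
  shows "has_ld G pt (\<lambda>s. pt (x s)) v t S"
  unfolding has_ld_def
proof (intro allI impI)
  fix \<epsilon> :: real assume "\<epsilon> > 0"
  define A where "A = norm (F (x t) v) + 1"
  define \<epsilon>1 where "\<epsilon>1 = min 1 (\<epsilon> / 4)"
  have \<epsilon>1: "\<epsilon>1 > 0" "\<epsilon>1 \<le> 1" "\<epsilon>1 \<le> \<epsilon> / 4" using \<open>\<epsilon> > 0\<close> by (auto simp: \<epsilon>1_def)
  have A: "A \<ge> 1" by (simp add: A_def)
  obtain \<delta>1 where \<delta>1: "\<delta>1 > 0" "\<And>s. s \<in> S \<Longrightarrow> \<bar>s - t\<bar> < \<delta>1 \<Longrightarrow>
      norm (x s - x t - (s - t) *\<^sub>R F (x t) v) \<le> \<epsilon>1 * \<bar>s - t\<bar>"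
    using d[unfolded has_vector_derivative_def has_derivative_within_alt, THEN conjunct2, rule_format, OF \<epsilon>1(1)] by auto
  \<comment> \<open>The entry R / (C A) keeps w in the chart ball, and the last one bounds the
    quadratic term C |w|^2 by \<epsilon> / 4 times |s - t|.\<close>
  define \<delta> where "\<delta> = min \<delta>1 (min (R / (C * A)) (\<epsilon> / (4 * C ^ 3 * A\<^sup>2)))"
  have CA: "C * A > 0" "C ^ 3 * A\<^sup>2 > 0" using C_pos A by auto
  show "\<exists>\<delta>>0. \<forall>s\<in>S. \<bar>s - t\<bar> < \<delta> \<longrightarrow>
      (\<exists>z. pt (x s) = pt (x t) \<otimes> pt z \<and> norm (z - (s - t) *\<^sub>R v) \<le> \<epsilon> * \<bar>s - t\<bar>)"
  proof (intro exI[of _ \<delta>] conjI ballI impI)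
    show "\<delta> > 0" using \<delta>1 CA R_pos \<open>\<epsilon> > 0\<close> C_pos A by (auto simp: \<delta>_def)
    fix s assume s: "s \<in> S" "\<bar>s - t\<bar> < \<delta>"
    define D where "D = \<bar>s - t\<bar>"
    have D: "0 \<le> D" "D < \<delta>1" "C * A * D < R" "4 * C ^ 3 * A\<^sup>2 * D \<le> \<epsilon>"
      using s CA by (auto simp: D_def \<delta>_def field_simps)
    have r: "norm (x s - x t - (s - t) *\<^sub>R F (x t) v) \<le> \<epsilon>1 * D" using \<delta>1(2) s D by (auto simp: D_def)
    have "norm (x s - x t) \<le> norm (x s - x t - (s - t) *\<^sub>R F (x t) v) + D * norm (F (x t) v)"
      using norm_triangle_ineq[of "x s - x t - (s - t) *\<^sub>R F (x t) v" "(s - t) *\<^sub>R F (x t) v"] by (simp add: D_def)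
    also have "\<dots> \<le> 1 * D + D * norm (F (x t) v)"
      using order_trans[OF r mult_right_mono[OF \<epsilon>1(2) D(1)]] by simp
    finally have xs: "norm (x s - x t) \<le> A * D" by (simp add: A_def algebra_simps)
    obtain w where w: "norm w < R0" "pt (x s) = pt (x t) \<otimes> pt w" "norm w \<le> C * norm (x s - x t)"
      using diff_ex[OF x[OF t] x[OF s(1)]] by blast
    have wA: "norm w \<le> C * A * D" using order_trans[OF w(3) mult_left_mono[OF xs, of C]] C_pos by (simp add: mult.assoc)
    then have wR: "norm w < R" using D by simp
    obtain z where z: "norm z < R0" "pt (x t) \<otimes> pt w = pt z" "norm (z - x t - F (x t) w) \<le> C * (norm w)\<^sup>2"
      using mult_ex[OF x[OF t] wR] by blast
    have "z = x s" using pt_inj'[OF z(1) x[OF s(1)]] z w by simp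
    have "C * (norm w)\<^sup>2 \<le> C * (C * A * D)\<^sup>2" using wA C_pos by (intro mult_left_mono power_mono) auto
    also have "\<dots> = (C ^ 3 * A\<^sup>2 * D) * D" by (simp add: power2_eq_square power3_eq_cube mult_ac)
    also have "\<dots> \<le> (\<epsilon> / 4) * D" using D by (intro mult_right_mono) auto
    finally have 1: "norm (x s - x t - F (x t) w) \<le> \<epsilon> / 4 * D" using z \<open>z = x s\<close> by simp
    have 2: "norm (x s - x t - (s - t) *\<^sub>R F (x t) v) \<le> \<epsilon> / 4 * D"
      using order_trans[OF r mult_right_mono[OF \<epsilon>1(3) D(1)]] .
    have "F (x t) (w - (s - t) *\<^sub>R v) = F (x t) w - (s - t) *\<^sub>R F (x t) v"
      using F_linear[OF x[OF t]] by (simp add: linear_diff linear_cmul)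
    also have "\<dots> = (x s - x t - (s - t) *\<^sub>R F (x t) v) - (x s - x t - F (x t) w)" by simp
    finally have "norm (F (x t) (w - (s - t) *\<^sub>R v)) \<le> \<epsilon> / 4 * D + \<epsilon> / 4 * D"
      using norm_triangle_le_diff[OF add_mono[OF 2 1]] by (simp only:)
    then have "norm (w - (s - t) *\<^sub>R v) \<le> \<epsilon> * D"
      using F_bounds(2)[OF x[OF t], of "w - (s - t) *\<^sub>R v"] by linarith
    then show "\<exists>z. pt (x s) = pt (x t) \<otimes> pt z \<and> norm (z - (s - t) *\<^sub>R v) \<le> \<epsilon> * \<bar>s - t\<bar>"
      using w by (auto simp: D_def)
  qed
qed

text \<open>Continuity of \<xi> is what strong continuity of L provides, where \<xi> is t -> L (c t)
  x. The Lipschitz condition of \<open>picard_local\<close> concerns the coordinate alone and holds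
  with C times a bound for \<xi>.\<close>

lemma ld_exists:
  assumes "0 < a" and \<xi>: "continuous_on {0..a} \<xi>"
  shows "\<exists>\<delta> c. 0 < \<delta> \<and> \<delta> \<le> a \<and> c 0 = \<one> \<and> (\<forall>t\<in>{0..\<delta>}. c t \<in> carrier G \<and> has_ld G pt c (\<xi> t) t {0..\<delta>})"
proof -
  have "bounded (\<xi> ` {0..a})"
    using compact_imp_bounded[OF compact_continuous_image[OF \<xi> compact_Icc]] .
  then obtain A where A: "\<And>t. t \<in> {0..a} \<Longrightarrow> norm (\<xi> t) \<le> A"
    unfolding bounded_iff by blast
  have A0: "A \<ge> 0" using order_trans[OF norm_ge_zero A[of 0]] \<open>0 < a\<close> by simp
  have "\<exists>\<delta> x. 0 < \<delta> \<and> \<delta> \<le> a \<and> x 0 = 0 \<and>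
    (\<forall>t\<in>{0..\<delta>}. norm (x t) \<le> R / 2 \<and> (x has_vector_derivative F (x t) (\<xi> t)) (at t within {0..\<delta>}))"
  proof (rule picard_local[where B = "2 * A" and K = "C * A"])
    show "continuous_on {0..a} (\<lambda>t. F (x t) (\<xi> t))"
      if "continuous_on {0..a} x" "\<And>t. t \<in> {0..a} \<Longrightarrow> norm (x t) \<le> R / 2" for x
      using that \<xi> R_pos by (intro continuous_on_F) force+
    show "norm (F x (\<xi> t)) \<le> 2 * A" if "t \<in> {0..a}" "norm x \<le> R / 2" for t x
      using F_bounds(1)[of x "\<xi> t"] A[OF that(1)] that R_pos by auto
    show "norm (F x (\<xi> t) - F y (\<xi> t)) \<le> C * A * norm (x - y)"
      if "t \<in> {0..a}" "norm x \<le> R / 2" "norm y \<le> R / 2" for t x y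
    proof -
      have "norm (F x (\<xi> t) - F y (\<xi> t)) \<le> C * norm (x - y) * norm (\<xi> t)"
        using that R_pos by (intro F_lipschitz) auto
      also have "\<dots> \<le> C * norm (x - y) * A" using A[OF that(1)] C_pos by (intro mult_left_mono) auto
      finally show ?thesis by (simp add: mult_ac)
    qed
  qed (use assms R_pos C_pos A0 in auto)
  then obtain \<delta> x where x: "0 < \<delta>" "\<delta> \<le> a" "x 0 = 0"
    and d: "\<And>t. t \<in> {0..\<delta>} \<Longrightarrow> norm (x t) \<le> R / 2 \<and> (x has_vector_derivative F (x t) (\<xi> t)) (at t within {0..\<delta>})"
    by blast
  have xR: "norm (x t) < R" if "t \<in> {0..\<delta>}" for t using d[OF that] R_pos by simp
  show ?thesis
  proof (rule exI[of _ \<delta>], rule exI[of _ "\<lambda>t. pt (x t)"], intro conjI ballI)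
    fix t assume t: "t \<in> {0..\<delta>}"
    show "pt (x t) \<in> carrier G" using pt_closed'[OF xR[OF t]] .
    show "has_ld G pt (\<lambda>t. pt (x t)) (\<xi> t) t {0..\<delta>}"
      using d[OF t] by (intro has_ld_of_coords xR t) auto
  qed (use x in \<open>auto simp: pt_0\<close>)
qed

text \<open>The left logarithmic derivative does not see a constant left factor or a shift of time.
  The curves are compared only within distance r of t, since c is later pieced together from
  translates of a local solution.\<close>

lemma has_ld_transfer:
  assumes f: "has_ld G pt f v s0 S0" and "f s0 \<in> carrier G" "g \<in> carrier G" "r > 0"
    and c: "c t = g \<otimes> f s0"
      "\<And>\<tau>. \<tau> \<in> S \<Longrightarrow> \<bar>\<tau> - t\<bar> < r \<Longrightarrow> \<tau> - t + s0 \<in> S0 \<and> c \<tau> = g \<otimes> f (\<tau> - t + s0)"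
  shows "has_ld G pt c v t S"
  unfolding has_ld_def
proof (intro allI impI)
  fix \<epsilon> :: real assume "\<epsilon> > 0"
  obtain \<delta> where \<delta>: "\<delta> > 0" "\<And>s. s \<in> S0 \<Longrightarrow> \<bar>s - s0\<bar> < \<delta> \<Longrightarrow>
     \<exists>z. f s = f s0 \<otimes> pt z \<and> norm (z - (s - s0) *\<^sub>R v) \<le> \<epsilon> * \<bar>s - s0\<bar> \<and> norm z < R"
    using has_ld_ex[OF f order_refl \<open>\<epsilon> > 0\<close> R_pos] by blast
  show "\<exists>\<delta>>0. \<forall>s\<in>S. \<bar>s - t\<bar> < \<delta> \<longrightarrow>
      (\<exists>z. c s = c t \<otimes> pt z \<and> norm (z - (s - t) *\<^sub>R v) \<le> \<epsilon> * \<bar>s - t\<bar>)"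
  proof (intro exI[of _ "min \<delta> r"] conjI ballI impI)
    fix s assume s: "s \<in> S" "\<bar>s - t\<bar> < min \<delta> r"
    have cs: "s - t + s0 \<in> S0" "c s = g \<otimes> f (s - t + s0)" using c(2)[OF s(1)] s by auto
    then obtain z where z: "f (s - t + s0) = f s0 \<otimes> pt z" "norm (z - (s - t) *\<^sub>R v) \<le> \<epsilon> * \<bar>s - t\<bar>" "norm z < R"
      using \<delta>(2)[OF cs(1)] s by auto
    moreover have "c s = c t \<otimes> pt z"
      using z cs c(1) assms(2,3) pt_closed' by (simp add: m_assoc)
    ultimately show "\<exists>z. c s = c t \<otimes> pt z \<and> norm (z - (s - t) *\<^sub>R v) \<le> \<epsilon> * \<bar>s - t\<bar>"
      by blast
  qed (use \<delta> \<open>r > 0\<close> in auto)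
qed

lemma has_ld_scale:
  assumes f: "has_ld G pt c v (a * t) S0" and "0 \<le> a" "c (a * t) \<in> carrier G" "\<And>\<tau>. \<tau> \<in> S \<Longrightarrow> a * \<tau> \<in> S0"
  shows "has_ld G pt (\<lambda>\<tau>. c (a * \<tau>)) (a *\<^sub>R v) t S"
  unfolding has_ld_def
proof (intro allI impI)
  fix \<epsilon> :: real assume "\<epsilon> > 0"
  \<comment> \<open>The case a = 0 must be covered, since the exponential is also taken at t = 0;
    hence the divisor a + 1.\<close>
  then have "\<epsilon> / (a + 1) > 0" using \<open>0 \<le> a\<close> by simp
  then obtain \<delta> where \<delta>: "\<delta> > 0" "\<And>s. s \<in> S0 \<Longrightarrow> \<bar>s - a * t\<bar> < \<delta> \<Longrightarrow>
     \<exists>z. c s = c (a * t) \<otimes> pt z \<and> norm (z - (s - a * t) *\<^sub>R v) \<le> \<epsilon> / (a + 1) * \<bar>s - a * t\<bar>"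
    using f unfolding has_ld_def by blast
  show "\<exists>\<delta>>0. \<forall>s\<in>S. \<bar>s - t\<bar> < \<delta> \<longrightarrow>
      (\<exists>z. c (a * s) = c (a * t) \<otimes> pt z \<and> norm (z - (s - t) *\<^sub>R a *\<^sub>R v) \<le> \<epsilon> * \<bar>s - t\<bar>)"
  proof (intro exI[of _ "\<delta> / (a + 1)"] conjI ballI impI)
    fix s assume s: "s \<in> S" "\<bar>s - t\<bar> < \<delta> / (a + 1)"
    have e: "\<bar>a * s - a * t\<bar> = a * \<bar>s - t\<bar>" using \<open>0 \<le> a\<close> by (simp add: right_diff_distrib[symmetric] abs_mult)
    have "(a + 1) * \<bar>s - t\<bar> < \<delta>" using s \<open>0 \<le> a\<close> by (simp add: field_simps)
    then have "\<bar>a * s - a * t\<bar> < \<delta>" using e by (simp add: distrib_right)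
    then obtain z where z: "c (a * s) = c (a * t) \<otimes> pt z" "norm (z - (a * s - a * t) *\<^sub>R v) \<le> \<epsilon> / (a + 1) * (a * \<bar>s - t\<bar>)"
      using \<delta>(2)[of "a * s"] assms(4)[OF s(1)] e by auto
    have "\<epsilon> / (a + 1) * (a * \<bar>s - t\<bar>) = (\<epsilon> * \<bar>s - t\<bar>) * (a / (a + 1))" by simp
    also have "\<dots> \<le> (\<epsilon> * \<bar>s - t\<bar>) * 1"
      using \<open>0 \<le> a\<close> \<open>\<epsilon> > 0\<close> by (intro mult_left_mono) auto
    finally have "norm (z - (a * s - a * t) *\<^sub>R v) \<le> \<epsilon> * \<bar>s - t\<bar>" using z(2) by simp
    moreover have "(a * s - a * t) *\<^sub>R v = (s - t) *\<^sub>R a *\<^sub>R v" by (simp add: algebra_simps)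
    ultimately show "\<exists>z. c (a * s) = c (a * t) \<otimes> pt z \<and> norm (z - (s - t) *\<^sub>R a *\<^sub>R v) \<le> \<epsilon> * \<bar>s - t\<bar>"
      using z(1) by auto
  qed (use \<delta> \<open>0 \<le> a\<close> in auto)
qed

text \<open>Compactness of the curve, for properties P \<delta> in which \<delta> may be both the
  radius of a neighbourhood and a constant in an estimate. Monotonicity in \<delta> lets two
  adjacent intervals share the minimum.\<close>

lemma ld_compact:
  assumes "a \<le> b" and cc: "\<And>t. t \<in> {a..b} \<Longrightarrow> c t \<in> carrier G"
    and ld: "\<And>t. t \<in> {a..b} \<Longrightarrow> has_ld G pt c (\<xi> t) t {a..b}"
    and loc: "\<And>g. g \<in> carrier G \<Longrightarrow> \<exists>\<delta>>0. \<forall>w. norm w < \<delta> \<longrightarrow> P \<delta> (g \<otimes> pt w)"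
    and mono: "\<And>\<delta> \<delta>' g. 0 < \<delta>' \<Longrightarrow> \<delta>' \<le> \<delta> \<Longrightarrow> P \<delta> g \<Longrightarrow> P \<delta>' g"
  shows "\<exists>\<delta>>0. \<forall>t\<in>{a..b}. \<forall>w. norm w < \<delta> \<longrightarrow> P \<delta> (c t \<otimes> pt w)"
proof -
  define Q where "Q x y \<longleftrightarrow> (a \<le> x \<and> y \<le> b \<longrightarrow> (\<exists>\<delta>>0. \<forall>t\<in>{x..y}. \<forall>w. norm w < \<delta> \<longrightarrow> P \<delta> (c t \<otimes> pt w)))" for x y
  have "Q a b"
  proof (rule Bolzano[OF \<open>a \<le> b\<close>])
    fix x y z assume Q: "Q x y" "Q y z" and xyz: "x \<le> y" "y \<le> z"
    show "Q x z" unfolding Q_def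
    proof
      assume *: "a \<le> x \<and> z \<le> b"
      obtain \<delta>1 where 1: "\<delta>1 > 0" "\<And>t w. t \<in> {x..y} \<Longrightarrow> norm w < \<delta>1 \<Longrightarrow> P \<delta>1 (c t \<otimes> pt w)"
        using Q(1) * xyz unfolding Q_def by (meson order_trans)
      obtain \<delta>2 where 2: "\<delta>2 > 0" "\<And>t w. t \<in> {y..z} \<Longrightarrow> norm w < \<delta>2 \<Longrightarrow> P \<delta>2 (c t \<otimes> pt w)"
        using Q(2) * xyz unfolding Q_def by (meson order_trans)
      have "P (min \<delta>1 \<delta>2) (c t \<otimes> pt w)" if t: "t \<in> {x..z}" and w: "norm w < min \<delta>1 \<delta>2" for t w
      proof (cases "t \<le> y")
        case True
        then have "P \<delta>1 (c t \<otimes> pt w)" using 1(2)[of t w] t w by auto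
        then show ?thesis using mono[of "min \<delta>1 \<delta>2" \<delta>1] 1(1) 2(1) by auto
      next
        case False
        then have "P \<delta>2 (c t \<otimes> pt w)" using 2(2)[of t w] t w by auto
        then show ?thesis using mono[of "min \<delta>1 \<delta>2" \<delta>2] 1(1) 2(1) by auto
      qed
      then show "\<exists>\<delta>>0. \<forall>t\<in>{x..z}. \<forall>w. norm w < \<delta> \<longrightarrow> P \<delta> (c t \<otimes> pt w)"
        using 1(1) 2(1) by (intro exI[of _ "min \<delta>1 \<delta>2"]) auto
    qed
  next
    fix x assume "a \<le> x" "x \<le> b"
    then have x: "x \<in> {a..b}" by simp
    obtain \<delta> where \<delta>: "\<delta> > 0" "\<And>w. norm w < \<delta> \<Longrightarrow> P \<delta> (c x \<otimes> pt w)" using loc[OF cc[OF x]] by blast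
    \<comment> \<open>Both c t and its neighbours are seen from c x: a product of two points of norm
      less than r has norm less than r + C r.\<close>
    define r where "r = min R (\<delta> / (1 + C))"
    have r: "r > 0" "r \<le> R" "r \<le> \<delta>" "r + C * r \<le> \<delta>"
    proof -
      have "r \<le> \<delta> / (1 + C)" by (simp add: r_def)
      then show *: "r + C * r \<le> \<delta>" using C_pos by (simp add: le_divide_eq algebra_simps)
      show "r > 0" using \<delta> C_pos R_pos by (simp add: r_def)
      then have "C * r > 0" using C_pos by simp
      then show "r \<le> \<delta>" using * by linarith
    qed (simp add: r_def)
    obtain \<eta> where \<eta>: "\<eta> > 0" "\<And>s. s \<in> {a..b} \<Longrightarrow> \<bar>s - x\<bar> < \<eta> \<Longrightarrow> \<exists>z. c s = c x \<otimes> pt z \<and> norm z < r"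
      using has_ld_ex[OF ld[OF x] order_refl zero_less_one r(1)] by blast
    show "\<exists>d>0. \<forall>u v. u \<le> x \<and> x \<le> v \<and> v - u < d \<longrightarrow> Q u v"
    proof (intro exI[of _ \<eta>] conjI allI impI)
      fix u v assume uv: "u \<le> x \<and> x \<le> v \<and> v - u < \<eta>"
      show "Q u v" unfolding Q_def
      proof (intro impI exI[of _ r] conjI ballI allI r(1))
        fix t and w :: 'e assume *: "a \<le> u \<and> v \<le> b" and t: "t \<in> {u..v}" and w: "norm w < r"
        have "t \<in> {a..b}" "\<bar>t - x\<bar> < \<eta>" using t * uv by auto
        then obtain p where p: "c t = c x \<otimes> pt p" "norm p < r" using \<eta>(2)[of t] by blast
        have pR: "norm p < R" and wR: "norm w < R" using p w r by auto
        obtain z where z: "norm z < R0" "pt p \<otimes> pt w = pt z" "norm (z - p) \<le> C * norm w"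
          using mult_ex[OF pR wR] by blast
        have "C * norm w \<le> C * r" using w C_pos by simp
        then have "norm z < \<delta>" using z p r norm_triangle_ineq[of p "z - p"] by simp
        moreover have "c t \<otimes> pt w = c x \<otimes> pt z"
          using p z(2)[symmetric] cc[OF x] pt_closed' pR wR by (simp add: m_assoc)
        ultimately show "P r (c t \<otimes> pt w)" using \<delta>(2) mono[OF r(1) r(3)] by simp
      qed
    qed (use \<eta> in auto)
  qed
  then show ?thesis by (simp add: Q_def)
qed

section \<open>First-order calculus at the identity and coordinate curves\<close>

lemma curve0_mult:
  assumes f: "curve0 pt f v" and g: "curve0 pt g w"
  shows "curve0 pt (\<lambda>s. f s \<otimes> g s) (v + w)"
  unfolding curve0_def
proof (intro allI impI)
  fix \<epsilon> :: real assume "\<epsilon> > 0"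
  then have e3: "\<epsilon> / 3 > 0" by simp
  define A where "A = norm v + norm w + \<epsilon>"
  have A: "A > 0" using \<open>\<epsilon> > 0\<close> by (auto simp: A_def intro: add_nonneg_pos)
  obtain \<delta>1 where 1: "\<delta>1 > 0" "\<And>s. 0 \<le> s \<and> s < \<delta>1 \<Longrightarrow>
    (\<exists>z. f s = pt z \<and> norm (z - s *\<^sub>R v) \<le> \<epsilon> / 3 * s \<and> norm z \<le> (norm v + \<epsilon> / 3) * s \<and> norm z < R)"
    using curve0_ex[OF f e3 R_pos] by blast
  obtain \<delta>2 where 2: "\<delta>2 > 0" "\<And>s. 0 \<le> s \<and> s < \<delta>2 \<Longrightarrow>
    (\<exists>z. g s = pt z \<and> norm (z - s *\<^sub>R w) \<le> \<epsilon> / 3 * s \<and> norm z \<le> (norm w + \<epsilon> / 3) * s \<and> norm z < R)"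
    using curve0_ex[OF g e3 R_pos] by blast
  define \<delta> where "\<delta> = min (min \<delta>1 \<delta>2) (\<epsilon> / (6 * C * A\<^sup>2))"
  show "\<exists>\<delta>>0. \<forall>s. 0 \<le> s \<and> s < \<delta> \<longrightarrow> (\<exists>z. f s \<otimes> g s = pt z \<and> norm (z - s *\<^sub>R (v + w)) \<le> \<epsilon> * s)"
  proof (intro exI[of _ \<delta>] conjI allI impI)
    fix s assume "0 \<le> s \<and> s < \<delta>"
    then have s: "0 \<le> s" "s < \<delta>1" "s < \<delta>2" "s < \<epsilon> / (6 * C * A\<^sup>2)" by (auto simp: \<delta>_def)
    then obtain p q where p: "f s = pt p" "norm (p - s *\<^sub>R v) \<le> \<epsilon> / 3 * s" "norm p \<le> (norm v + \<epsilon> / 3) * s" "norm p < R"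
      and q: "g s = pt q" "norm (q - s *\<^sub>R w) \<le> \<epsilon> / 3 * s" "norm q \<le> (norm w + \<epsilon> / 3) * s" "norm q < R"
      using 1(2)[of s] 2(2)[of s] by auto
    have pA: "norm p \<le> A * s" "norm q \<le> A * s"
      using s \<open>\<epsilon> > 0\<close> by (auto simp: A_def intro!: order_trans[OF p(3)] order_trans[OF q(3)] mult_right_mono)
    obtain z where z: "pt p \<otimes> pt q = pt z" "norm (z - p - q) \<le> C * (norm p + norm q) * norm q"
      using mult_ex[OF p(4) q(4)] by blast
    have "C * (norm p + norm q) * norm q \<le> C * (A * s + A * s) * (A * s)"
      using pA C_pos A s by (intro mult_mono add_mono) auto
    also have "\<dots> = (2 * C * A\<^sup>2 * s) * s" by (simp add: power2_eq_square algebra_simps)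
    also have "\<dots> \<le> (\<epsilon> / 3) * s"
    proof (rule mult_right_mono)
      have "6 * C * A\<^sup>2 > 0" using C_pos A by simp
      then have "6 * C * A\<^sup>2 * s \<le> \<epsilon>" using s(4) by (simp add: field_simps)
      then show "2 * C * A\<^sup>2 * s \<le> \<epsilon> / 3" by simp
    qed (use s in auto)
    finally have z3: "norm (z - p - q) \<le> \<epsilon> / 3 * s" using z by linarith
    have "z - s *\<^sub>R (v + w) = (z - p - q) + ((p - s *\<^sub>R v) + (q - s *\<^sub>R w))" by (simp add: algebra_simps)
    moreover have "norm \<dots> \<le> \<epsilon> / 3 * s + (\<epsilon> / 3 * s + \<epsilon> / 3 * s)"
      by (intro norm_triangle_mono z3 p q)
    ultimately have "norm (z - s *\<^sub>R (v + w)) \<le> \<epsilon> * s" by (simp add: algebra_simps)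
    then show "\<exists>z. f s \<otimes> g s = pt z \<and> norm (z - s *\<^sub>R (v + w)) \<le> \<epsilon> * s" using p q z by auto
  qed (use 1 2 \<open>\<epsilon> > 0\<close> C_pos A in \<open>simp add: \<delta>_def\<close>)
qed

text \<open>\<open>has_ld\<close> provides a coordinate separately for each \<epsilon>; uniqueness
  of coordinates of norm less than R shows that they are values of one function p, which can then be
  differentiated.\<close>

lemma has_ld_coord:
  assumes ld: "has_ld G pt c v t S" and "c t \<in> carrier G" "t \<in> S"
  shows "\<exists>p. p t = 0 \<and> (p has_vector_derivative v) (at t within S) \<and>
    (\<exists>\<delta>>0. \<forall>s\<in>S. \<bar>s - t\<bar> < \<delta> \<longrightarrow> c s = c t \<otimes> pt (p s))"
proof -
  obtain \<delta> where \<delta>: "\<delta> > 0" "\<forall>s\<in>S. \<bar>s - t\<bar> < \<delta> \<longrightarrow> (\<exists>z. c s = c t \<otimes> pt z \<and> norm z < R)"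
    using has_ld_ex[OF ld order_refl zero_less_one R_pos] by blast
  define S' where "S' = {s \<in> S. \<bar>s - t\<bar> < \<delta>}"
  have "\<forall>s\<in>S'. \<exists>z. c s = c t \<otimes> pt z \<and> norm z < R" using \<delta>(2) by (simp add: S'_def)
  then obtain p where p: "\<And>s. s \<in> S' \<Longrightarrow> c s = c t \<otimes> pt (p s) \<and> norm (p s) < R"
    using bchoice[of S' "\<lambda>s z. c s = c t \<otimes> pt z \<and> norm z < R"] by blast
  have uniq: "z = p s" if "s \<in> S'" "c s = c t \<otimes> pt z" "norm z < R" for s z
  proof -
    have "c t \<otimes> pt z = c t \<otimes> pt (p s)" using p[OF that(1)] that(2) by simp
    then have "pt z = pt (p s)" using assms(2) that(3) p[OF that(1)] pt_closed' by simp
    then show ?thesis using pt_inj'[of z "p s"] that(3) p[OF that(1)] R_le by simp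
  qed
  have "t \<in> S'" using \<delta> assms(3) by (simp add: S'_def)
  then have pt0: "p t = 0" using uniq[of t 0] assms(2) R_pos by (simp add: pt_0)
  have "(p has_vector_derivative v) (at t within S)"
    unfolding has_vector_derivative_def has_derivative_within_alt
  proof (intro conjI bounded_linear_scaleR_left allI impI)
    fix e :: real assume "e > 0"
    obtain \<eta> where \<eta>: "\<eta> > 0" "\<forall>s\<in>S. \<bar>s - t\<bar> < \<eta> \<longrightarrow>
      (\<exists>z. c s = c t \<otimes> pt z \<and> norm (z - (s - t) *\<^sub>R v) \<le> e * \<bar>s - t\<bar> \<and> norm z < R)"
      using has_ld_ex[OF ld order_refl \<open>e > 0\<close> R_pos] by blast
    show "\<exists>d>0. \<forall>y\<in>S. norm (y - t) < d \<longrightarrow> norm (p y - p t - (y - t) *\<^sub>R v) \<le> e * norm (y - t)"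
    proof (intro exI[of _ "min \<delta> \<eta>"] conjI ballI impI)
      fix s assume s: "s \<in> S" "norm (s - t) < min \<delta> \<eta>"
      then have "s \<in> S'" "\<bar>s - t\<bar> < \<eta>" by (auto simp: S'_def)
      then obtain z where "c s = c t \<otimes> pt z" "norm (z - (s - t) *\<^sub>R v) \<le> e * \<bar>s - t\<bar>" "norm z < R"
        using \<eta>(2) s by blast
      then show "norm (p s - p t - (s - t) *\<^sub>R v) \<le> e * norm (s - t)"
        using uniq[OF \<open>s \<in> S'\<close>, of z] pt0 by simp
    qed (use \<delta> \<eta> in auto)
  qed
  then show ?thesis using pt0 p \<delta>(1) by (intro exI[of _ p] conjI exI[of _ \<delta>]) (auto simp: S'_def)
qed

lemma has_ldI_coord:
  assumes p: "p t = 0" "(p has_vector_derivative v) (at t within S)" and "\<delta> > 0"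
    and c: "\<And>s. s \<in> S \<Longrightarrow> \<bar>s - t\<bar> < \<delta> \<Longrightarrow> c s = c t \<otimes> pt (p s)"
  shows "has_ld G pt c v t S"
  unfolding has_ld_def
proof (intro allI impI)
  fix \<epsilon> :: real assume "\<epsilon> > 0"
  obtain d where d: "d > 0" "\<forall>y\<in>S. norm (y - t) < d \<longrightarrow> norm (p y - p t - (y - t) *\<^sub>R v) \<le> \<epsilon> * norm (y - t)"
    using p(2)[unfolded has_vector_derivative_def has_derivative_within_alt, THEN conjunct2, rule_format, OF \<open>\<epsilon> > 0\<close>] by blast
  show "\<exists>\<delta>>0. \<forall>s\<in>S. \<bar>s - t\<bar> < \<delta> \<longrightarrow> (\<exists>z. c s = c t \<otimes> pt z \<and> norm (z - (s - t) *\<^sub>R v) \<le> \<epsilon> * \<bar>s - t\<bar>)"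
  proof (intro exI[of _ "min \<delta> d"] conjI ballI impI)
    fix s assume s: "s \<in> S" "\<bar>s - t\<bar> < min \<delta> d"
    then show "\<exists>z. c s = c t \<otimes> pt z \<and> norm (z - (s - t) *\<^sub>R v) \<le> \<epsilon> * \<bar>s - t\<bar>"
      using c[of s] d(2) p(1) by (intro exI[of _ "p s"]) auto
  qed (use d \<open>\<delta> > 0\<close> in auto)
qed

lemma curve0_of_ld:
  assumes "has_ld G pt c v 0 {0..1}" "c 0 = \<one>"
  shows "curve0 pt c v"
  unfolding curve0_def
proof (intro allI impI)
  fix \<epsilon> :: real assume "\<epsilon> > 0"
  obtain \<delta> where \<delta>: "\<delta> > 0" "\<And>s. s \<in> {0..1} \<Longrightarrow> \<bar>s - 0\<bar> < \<delta> \<Longrightarrow>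
     \<exists>z. c s = c 0 \<otimes> pt z \<and> norm (z - (s - 0) *\<^sub>R v) \<le> \<epsilon> * \<bar>s - 0\<bar> \<and> norm z < R"
    using has_ld_ex[OF assms(1) order_refl \<open>\<epsilon> > 0\<close> R_pos] by blast
  show "\<exists>\<delta>>0. \<forall>s. 0 \<le> s \<and> s < \<delta> \<longrightarrow> (\<exists>z. c s = pt z \<and> norm (z - s *\<^sub>R v) \<le> \<epsilon> * s)"
  proof (intro exI[of _ "min \<delta> 1"] conjI allI impI)
    fix s assume "0 \<le> s \<and> s < min \<delta> 1"
    then obtain z where "c s = \<one> \<otimes> pt z" "norm (z - s *\<^sub>R v) \<le> \<epsilon> * s" "norm z < R"
      using \<delta>(2)[of s] assms(2) by auto
    then show "\<exists>z. c s = pt z \<and> norm (z - s *\<^sub>R v) \<le> \<epsilon> * s" using pt_closed' by auto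
  qed (use \<delta> in auto)
qed

end

section \<open>Semidirect products\<close>

text \<open>\<open>L g\<close> is the derivative of \<open>\<pi> g\<close> at the identity. In \<open>act_quadratic\<close> the same \<open>\<delta>\<close> serves as radius and
  as inverse of the constants, so that the condition becomes weaker when \<open>\<delta>\<close> decreases and \<open>ld_compact\<close>
  applies.\<close>

locale lie_action = N: lie_ball N ptN FN RN0 RN CN + G: lie_ball G ptG FG RG0 RG CG
  for N :: "('a, 'm) monoid_scheme" and ptN :: "'e::banach \<Rightarrow> 'a" and FN RN0 RN CN
    and G :: "('b, 'k) monoid_scheme" and ptG :: "'f::banach \<Rightarrow> 'b" and FG RG0 RG CG +
  fixes \<pi> :: "'b \<Rightarrow> 'a \<Rightarrow> 'a" and L :: "'b \<Rightarrow> 'e \<Rightarrow> 'e"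
  assumes act_hom: "\<And>g. g \<in> carrier G \<Longrightarrow> \<pi> g \<in> hom N N"
    and act_mult: "\<And>g h n. g \<in> carrier G \<Longrightarrow> h \<in> carrier G \<Longrightarrow> n \<in> carrier N \<Longrightarrow>
        \<pi> (g \<otimes>\<^bsub>G\<^esub> h) n = \<pi> g (\<pi> h n)"
    and act_one: "\<And>n. n \<in> carrier N \<Longrightarrow> \<pi> \<one>\<^bsub>G\<^esub> n = n"
    and L_linear: "\<And>g. g \<in> carrier G \<Longrightarrow> linear (L g)"
    and L_mult: "\<And>g h v. g \<in> carrier G \<Longrightarrow> h \<in> carrier G \<Longrightarrow> L (g \<otimes>\<^bsub>G\<^esub> h) v = L g (L h v)"
    and L_one: "\<And>v. L \<one>\<^bsub>G\<^esub> v = v"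
    and act_quadratic: "\<And>g. g \<in> carrier G \<Longrightarrow> \<exists>\<delta>>0. \<forall>w. norm w < \<delta> \<longrightarrow> (\<forall>y. norm y < \<delta> \<longrightarrow>
        (\<exists>z. norm z < RN \<and> \<pi> (g \<otimes>\<^bsub>G\<^esub> ptG w) (ptN y) = ptN z \<and>
          \<delta> * norm (z - L (g \<otimes>\<^bsub>G\<^esub> ptG w) y) \<le> (norm y)\<^sup>2 \<and> \<delta> * norm (L (g \<otimes>\<^bsub>G\<^esub> ptG w) y) \<le> norm y))"
    and L_continuous: "\<And>g x \<epsilon>. g \<in> carrier G \<Longrightarrow> 0 < \<epsilon> \<Longrightarrow>
        \<exists>\<delta>>0. \<forall>w. norm w < \<delta> \<longrightarrow> norm (L (g \<otimes>\<^bsub>G\<^esub> ptG w) x - L g x) < \<epsilon>"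
    and act_inv: "\<And>g \<epsilon>. g \<in> carrier G \<Longrightarrow> 0 < \<epsilon> \<Longrightarrow>
        \<exists>\<delta>>0. \<forall>w. norm w < \<delta> \<longrightarrow> (\<forall>y. norm y < \<delta> \<longrightarrow>
          (\<exists>z. norm z < \<epsilon> \<and> \<pi> (inv\<^bsub>G\<^esub> (g \<otimes>\<^bsub>G\<^esub> ptG w)) (ptN y) = ptN z))"
begin

section \<open>First-order behaviour of the action\<close>

definition quad :: "real \<Rightarrow> 'b \<Rightarrow> bool" where
  "quad \<delta> g \<longleftrightarrow> (\<forall>y. norm y < \<delta> \<longrightarrow>
     (\<exists>z. norm z < RN \<and> \<pi> g (ptN y) = ptN z \<and> \<delta> * norm (z - L g y) \<le> (norm y)\<^sup>2 \<and> \<delta> * norm (L g y) \<le> norm y))"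

lemma quad_ex: "g \<in> carrier G \<Longrightarrow> \<exists>\<delta>>0. \<forall>w. norm w < \<delta> \<longrightarrow> quad \<delta> (g \<otimes>\<^bsub>G\<^esub> ptG w)"
  unfolding quad_def by (rule act_quadratic)

lemma quad_mono:
  assumes "0 < \<delta>'" "\<delta>' \<le> \<delta>" "quad \<delta> g"
  shows "quad \<delta>' g"
  unfolding quad_def
proof (intro allI impI)
  fix y :: 'e assume "norm y < \<delta>'"
  then obtain z where z: "norm z < RN" "\<pi> g (ptN y) = ptN z" "\<delta> * norm (z - L g y) \<le> (norm y)\<^sup>2" "\<delta> * norm (L g y) \<le> norm y"
    using assms unfolding quad_def by (meson less_le_trans)
  have "\<delta>' * norm (z - L g y) \<le> \<delta> * norm (z - L g y)" "\<delta>' * norm (L g y) \<le> \<delta> * norm (L g y)"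
    using assms by (auto intro!: mult_right_mono)
  then show "\<exists>z. norm z < RN \<and> \<pi> g (ptN y) = ptN z \<and> \<delta>' * norm (z - L g y) \<le> (norm y)\<^sup>2 \<and> \<delta>' * norm (L g y) \<le> norm y"
    using z by (intro exI[of _ z]) linarith
qed

lemma quad_at:
  assumes "g \<in> carrier G"
  shows "\<exists>\<delta>>0. quad \<delta> g"
proof -
  obtain \<delta> where "\<delta> > 0" "quad \<delta> (g \<otimes>\<^bsub>G\<^esub> ptG 0)" using quad_ex[OF assms] by auto
  then show ?thesis using assms by (auto simp: G.pt_0)
qed

text \<open>A linear map is controlled by its values on small vectors, and \<open>quad\<close>
  speaks of |y| < \<delta> only; hence the rescaling.\<close>

lemma quad_L:
  assumes "quad \<delta> g" "g \<in> carrier G" "\<delta> > 0"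
  shows "\<delta> * norm (L g y) \<le> norm y"
proof (cases "y = 0")
  case True
  then show ?thesis using L_linear[OF assms(2)] by (simp add: linear_0)
next
  case False
  define r where "r = \<delta> / (2 * norm y)"
  have r: "r > 0" "norm (r *\<^sub>R y) < \<delta>" using False assms by (auto simp: r_def)
  then have "\<delta> * norm (L g (r *\<^sub>R y)) \<le> norm (r *\<^sub>R y)" using assms(1) unfolding quad_def by blast
  moreover have "L g (r *\<^sub>R y) = r *\<^sub>R L g y" using L_linear[OF assms(2)] by (simp add: linear_cmul)
  ultimately have "r * (\<delta> * norm (L g y)) \<le> r * norm y" using r by (simp add: mult_ac)
  then show ?thesis using r by simp
qed

lemma act_closed: "g \<in> carrier G \<Longrightarrow> n \<in> carrier N \<Longrightarrow> \<pi> g n \<in> carrier N"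
  using act_hom[of g] by (auto simp: hom_def)

lemma act_distrib: "g \<in> carrier G \<Longrightarrow> n \<in> carrier N \<Longrightarrow> m \<in> carrier N \<Longrightarrow>
    \<pi> g (n \<otimes>\<^bsub>N\<^esub> m) = \<pi> g n \<otimes>\<^bsub>N\<^esub> \<pi> g m"
  using act_hom hom_mult by metis

text \<open>The record type is left open because the lemma serves twice: for the bare monoid built
  in \<open>ld_semigroup_exists\<close> and for the manifold group of the theorem.\<close>

lemma semidirect_group:
  fixes H :: "('a \<times> 'b, 'j) monoid_scheme"
  assumes H: "carrier H = carrier N \<times> carrier G" "\<one>\<^bsub>H\<^esub> = (\<one>\<^bsub>N\<^esub>, \<one>\<^bsub>G\<^esub>)"
    "\<And>n g m h. (n, g) \<otimes>\<^bsub>H\<^esub> (m, h) = (n \<otimes>\<^bsub>N\<^esub> \<pi> g m, g \<otimes>\<^bsub>G\<^esub> h)"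
  shows "group H"
    and "n \<in> carrier N \<Longrightarrow> g \<in> carrier G \<Longrightarrow> inv\<^bsub>H\<^esub> (n, g) = (\<pi> (inv\<^bsub>G\<^esub> g) (inv\<^bsub>N\<^esub> n), inv\<^bsub>G\<^esub> g)"
proof -
  have act1: "\<pi> g \<one>\<^bsub>N\<^esub> = \<one>\<^bsub>N\<^esub>" if "g \<in> carrier G" for g
    using hom_one[OF act_hom[OF that]] N.is_group by blast
  have inv: "(\<pi> (inv\<^bsub>G\<^esub> g) (inv\<^bsub>N\<^esub> n), inv\<^bsub>G\<^esub> g) \<otimes>\<^bsub>H\<^esub> (n, g) = \<one>\<^bsub>H\<^esub>" if "n \<in> carrier N" "g \<in> carrier G" for n g
    using that act_distrib[of "inv\<^bsub>G\<^esub> g" "inv\<^bsub>N\<^esub> n" n] by (simp add: H act1)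
  show g: "group H"
  proof (rule groupI)
    show "x \<otimes>\<^bsub>H\<^esub> y \<in> carrier H" if "x \<in> carrier H" "y \<in> carrier H" for x y
      using that by (cases x; cases y) (auto simp: H act_closed)
    show "\<one>\<^bsub>H\<^esub> \<in> carrier H" by (simp add: H)
    show "x \<otimes>\<^bsub>H\<^esub> y \<otimes>\<^bsub>H\<^esub> z = x \<otimes>\<^bsub>H\<^esub> (y \<otimes>\<^bsub>H\<^esub> z)" if "x \<in> carrier H" "y \<in> carrier H" "z \<in> carrier H" for x y z
      using that by (cases x; cases y; cases z) (auto simp: H act_closed act_distrib act_mult N.m_assoc G.m_assoc)
    show "\<one>\<^bsub>H\<^esub> \<otimes>\<^bsub>H\<^esub> x = x" if "x \<in> carrier H" for x
      using that by (cases x) (auto simp: H act_one)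
    show "\<exists>y\<in>carrier H. y \<otimes>\<^bsub>H\<^esub> x = \<one>\<^bsub>H\<^esub>" if "x \<in> carrier H" for x
    proof (cases x)
      case (Pair n g)
      then show ?thesis using that inv[of n g]
        by (intro bexI[of _ "(\<pi> (inv\<^bsub>G\<^esub> g) (inv\<^bsub>N\<^esub> n), inv\<^bsub>G\<^esub> g)"]) (auto simp: H act_closed)
    qed
  qed
  show "inv\<^bsub>H\<^esub> (n, g) = (\<pi> (inv\<^bsub>G\<^esub> g) (inv\<^bsub>N\<^esub> n), inv\<^bsub>G\<^esub> g)" if "n \<in> carrier N" "g \<in> carrier G"
    using group.inv_equality[OF g inv[OF that]] that by (simp add: H act_closed)
qed

text \<open>A first-order expansion of p along x is carried to one along L g x: the quadratic
  remainder costs A^2 |s|^2, and the linear map L g acts on the error of p. The factor \<delta>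
  stays on the left as the inverse of the constants.\<close>

lemma quad_step:
  assumes q: "quad \<delta> g" "g \<in> carrier G" "\<delta> > 0" and "norm p < \<delta>"
    and p: "norm (p - s *\<^sub>R x) \<le> \<epsilon> * \<bar>s\<bar>" "norm p \<le> A * \<bar>s\<bar>"
  shows "\<exists>z. norm z < RN \<and> \<pi> g (ptN p) = ptN z \<and>
    \<delta> * norm (z - s *\<^sub>R L g x) \<le> (A\<^sup>2 * \<bar>s\<bar> + \<epsilon>) * \<bar>s\<bar>"
proof -
  obtain z where z: "norm z < RN" "\<pi> g (ptN p) = ptN z" "\<delta> * norm (z - L g p) \<le> (norm p)\<^sup>2"
    using q assms(4) unfolding quad_def by blast
  have "(norm p)\<^sup>2 \<le> (A * \<bar>s\<bar>)\<^sup>2" using p by (intro power_mono) auto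
  then have 1: "\<delta> * norm (z - L g p) \<le> A\<^sup>2 * \<bar>s\<bar> * \<bar>s\<bar>" using z(3) by (simp add: power2_eq_square mult_ac)
  have 2: "\<delta> * norm (L g (p - s *\<^sub>R x)) \<le> \<epsilon> * \<bar>s\<bar>" using quad_L[OF q, of "p - s *\<^sub>R x"] p by linarith
  have e: "z - s *\<^sub>R L g x = (z - L g p) + L g (p - s *\<^sub>R x)"
    using L_linear[OF q(2)] by (simp add: linear_diff linear_cmul)
  have "norm (z - s *\<^sub>R L g x) \<le> norm (z - L g p) + norm (L g (p - s *\<^sub>R x))"
    unfolding e by (rule norm_triangle_ineq)
  then have "\<delta> * norm (z - s *\<^sub>R L g x) \<le> \<delta> * (norm (z - L g p) + norm (L g (p - s *\<^sub>R x)))"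
    using q(3) by (intro mult_left_mono) auto
  also have "\<dots> \<le> (A\<^sup>2 * \<bar>s\<bar> + \<epsilon>) * \<bar>s\<bar>" using 1 2 by (simp add: distrib_left distrib_right)
  finally show ?thesis using z by blast
qed

text \<open>The homomorphism \<pi> g carries d t pt(z) to \<pi> g (d t) times \<pi> g (pt z), so
  that the chain rule at any point reduces to the estimate of \<open>quad_step\<close> at the
  identity.\<close>

lemma has_ld_act:
  assumes d: "has_ld N ptN d v t S" and "g \<in> carrier G" "d t \<in> carrier N"
  shows "has_ld N ptN (\<lambda>s. \<pi> g (d s)) (L g v) t S"
  unfolding has_ld_def
proof (intro allI impI)
  fix \<epsilon> :: real assume "\<epsilon> > 0"
  obtain \<kappa> where \<kappa>: "\<kappa> > 0" "quad \<kappa> g" using quad_at[OF assms(2)] by blast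
  define A where "A = norm v + 1"
  have A: "A > 0" by (simp add: A_def add_nonneg_pos)
  define \<epsilon>' where "\<epsilon>' = min 1 (\<kappa> * \<epsilon> / 2)"
  have \<epsilon>': "\<epsilon>' > 0" "\<epsilon>' \<le> 1" "\<epsilon>' \<le> \<kappa> * \<epsilon> / 2" using \<kappa> \<open>\<epsilon> > 0\<close> by (auto simp: \<epsilon>'_def)
  have m: "min RN \<kappa> > 0" using \<kappa> N.R_pos by simp
  obtain \<delta> where \<delta>: "\<delta> > 0" "\<And>s. s \<in> S \<Longrightarrow> \<bar>s - t\<bar> < \<delta> \<Longrightarrow>
     \<exists>z. d s = d t \<otimes>\<^bsub>N\<^esub> ptN z \<and> norm (z - (s - t) *\<^sub>R v) \<le> \<epsilon>' * \<bar>s - t\<bar> \<and>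
         norm z \<le> (norm v + \<epsilon>') * \<bar>s - t\<bar> \<and> norm z < min RN \<kappa>"
    using N.has_ld_ex[OF d order_refl \<epsilon>'(1) m] by blast
  show "\<exists>\<delta>>0. \<forall>s\<in>S. \<bar>s - t\<bar> < \<delta> \<longrightarrow>
      (\<exists>z. \<pi> g (d s) = \<pi> g (d t) \<otimes>\<^bsub>N\<^esub> ptN z \<and> norm (z - (s - t) *\<^sub>R L g v) \<le> \<epsilon> * \<bar>s - t\<bar>)"
  proof (intro exI[of _ "min \<delta> (\<kappa> * \<epsilon> / (2 * A\<^sup>2))"] conjI ballI impI)
    fix s assume s: "s \<in> S" "\<bar>s - t\<bar> < min \<delta> (\<kappa> * \<epsilon> / (2 * A\<^sup>2))"
    define D where "D = \<bar>s - t\<bar>"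
    have D: "D \<ge> 0" "2 * (A\<^sup>2 * D) \<le> \<kappa> * \<epsilon>" using s A by (auto simp: D_def field_simps)
    obtain z where z: "d s = d t \<otimes>\<^bsub>N\<^esub> ptN z" "norm (z - (s - t) *\<^sub>R v) \<le> \<epsilon>' * D"
         "norm z \<le> (norm v + \<epsilon>') * D" "norm z < RN" "norm z < \<kappa>"
      using \<delta>(2)[OF s(1)] s by (auto simp: D_def)
    have "norm z \<le> A * D" using z(3) mult_right_mono[of "norm v + \<epsilon>'" A D] \<epsilon>' D by (auto simp: A_def)
    then obtain z' where z': "norm z' < RN" "\<pi> g (ptN z) = ptN z'"
        "\<kappa> * norm (z' - (s - t) *\<^sub>R L g v) \<le> (A\<^sup>2 * D + \<epsilon>') * D"
      using quad_step[OF \<kappa>(2) assms(2) \<kappa>(1) z(5), of "s - t" v \<epsilon>' A] z(2) by (auto simp: D_def)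
    have "(A\<^sup>2 * D + \<epsilon>') * D \<le> \<kappa> * \<epsilon> * D" using D \<epsilon>' by (intro mult_right_mono) auto
    then have "\<kappa> * norm (z' - (s - t) *\<^sub>R L g v) \<le> \<kappa> * (\<epsilon> * D)" using z'(3) by simp
    then have "norm (z' - (s - t) *\<^sub>R L g v) \<le> \<epsilon> * D" using \<kappa> by simp
    moreover have "\<pi> g (d s) = \<pi> g (d t) \<otimes>\<^bsub>N\<^esub> ptN z'"
      using z z' assms act_distrib N.pt_closed' by simp
    ultimately show "\<exists>z. \<pi> g (d s) = \<pi> g (d t) \<otimes>\<^bsub>N\<^esub> ptN z \<and> norm (z - (s - t) *\<^sub>R L g v) \<le> \<epsilon> * \<bar>s - t\<bar>"
      by (auto simp: D_def)
  qed (use \<delta> \<kappa> A \<open>\<epsilon> > 0\<close> in simp)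
qed

lemma continuous_L:
  assumes "\<And>t. t \<in> S \<Longrightarrow> c t \<in> carrier G \<and> has_ld G ptG c (\<xi> t) t S"
  shows "continuous_on S (\<lambda>t. L (c t) x)"
  unfolding continuous_on_iff
proof (intro ballI allI impI)
  fix t and e :: real assume t: "t \<in> S" and "e > 0"
  obtain \<delta> where \<delta>: "\<delta> > 0" "\<And>w. norm w < \<delta> \<Longrightarrow> norm (L (c t \<otimes>\<^bsub>G\<^esub> ptG w) x - L (c t) x) < e"
    using L_continuous[of "c t" e x] assms[OF t] \<open>e > 0\<close> by blast
  obtain \<eta> where \<eta>: "\<eta> > 0" "\<And>s. s \<in> S \<Longrightarrow> \<bar>s - t\<bar> < \<eta> \<Longrightarrow> \<exists>z. c s = c t \<otimes>\<^bsub>G\<^esub> ptG z \<and> norm z < \<delta>"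
    using G.has_ld_ex[OF assms[OF t, THEN conjunct2] order_refl zero_less_one \<delta>(1)] by blast
  show "\<exists>d>0. \<forall>s\<in>S. dist s t < d \<longrightarrow> dist (L (c s) x) (L (c t) x) < e"
  proof (intro exI[of _ \<eta>] conjI ballI impI \<eta>(1))
    fix s assume "s \<in> S" "dist s t < \<eta>"
    then obtain z where "c s = c t \<otimes>\<^bsub>G\<^esub> ptG z" "norm z < \<delta>" using \<eta>(2)[of s] by (auto simp: dist_real_def)
    then show "dist (L (c s) x) (L (c t) x) < e" using \<delta>(2)[of z] by (simp add: dist_norm)
  qed
qed

section \<open>One-parameter semigroups of the semidirect product\<close>

lemma L_bounded_on_curve:
  assumes "\<And>t. t \<in> {a..b} \<Longrightarrow> c t \<in> carrier G \<and> has_ld G ptG c (\<xi> t) t {a..b::real}"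
  shows "\<exists>A. \<forall>t\<in>{a..b}. norm (L (c t) x) \<le> A"
  using compact_imp_bounded[OF compact_continuous_image[OF continuous_L[OF assms] compact_Icc]]
  unfolding bounded_iff by blast

text \<open>Both sides of each addition law, as functions of the second time, start at the same
  point and have the same logarithmic derivative, so \<open>ld_unique\<close> applies. The law for d
  is twisted by \<pi> because it is the first component of multiplicativity of t -> (d t, c t) in
  H.\<close>

lemma ld_semigroup_local:
  "\<exists>\<delta> c d. 0 < \<delta> \<and> c 0 = \<one>\<^bsub>G\<^esub> \<and> d 0 = \<one>\<^bsub>N\<^esub> \<and>
    (\<forall>t\<in>{0..\<delta>}. c t \<in> carrier G \<and> d t \<in> carrier N \<and> has_ld G ptG c y t {0..\<delta>} \<and> has_ld N ptN d (L (c t) x) t {0..\<delta>}) \<and>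
    (\<forall>s t. 0 \<le> s \<longrightarrow> 0 \<le> t \<longrightarrow> s + t \<le> \<delta> \<longrightarrow> c (s + t) = c s \<otimes>\<^bsub>G\<^esub> c t \<and> d (s + t) = d s \<otimes>\<^bsub>N\<^esub> \<pi> (c s) (d t))"
proof -
  obtain \<delta>1 c where "0 < \<delta>1" and c0: "c 0 = \<one>\<^bsub>G\<^esub>"
    and c: "\<And>t. t \<in> {0..\<delta>1} \<Longrightarrow> c t \<in> carrier G \<and> has_ld G ptG c y t {0..\<delta>1}"
    using G.ld_exists[of 1 "\<lambda>_. y"] by auto
  obtain \<delta> d where \<delta>: "0 < \<delta>" "\<delta> \<le> \<delta>1" and d0: "d 0 = \<one>\<^bsub>N\<^esub>"
    and d: "\<And>t. t \<in> {0..\<delta>} \<Longrightarrow> d t \<in> carrier N \<and> has_ld N ptN d (L (c t) x) t {0..\<delta>}"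
    using N.ld_exists[OF \<open>0 < \<delta>1\<close> continuous_L[OF c]] by blast
  have sub: "{0..\<delta>} \<subseteq> {0..\<delta>1}" using \<delta> by auto
  have c': "c t \<in> carrier G \<and> has_ld G ptG c y t {0..\<delta>}" if "t \<in> {0..\<delta>}" for t
    using c[of t] that sub has_ld_subset[OF _ sub] by blast
  obtain A where A: "\<And>t. t \<in> {0..\<delta>} \<Longrightarrow> norm (L (c t) x) \<le> A" using L_bounded_on_curve[OF c'] by blast
  have cadd: "c (s + t) = c s \<otimes>\<^bsub>G\<^esub> c t" if st: "0 \<le> s" "0 \<le> t" "s + t \<le> \<delta>" for s t
  proof (rule G.ld_unique[where a = 0 and b = t and c = "\<lambda>\<tau>. c (s + \<tau>)" and d = "\<lambda>\<tau>. c s \<otimes>\<^bsub>G\<^esub> c \<tau>" and \<xi> = "\<lambda>_. y"])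
    fix \<tau> assume "\<tau> \<in> {0..t}"
    then have m: "\<tau> \<in> {0..\<delta>}" "s + \<tau> \<in> {0..\<delta>}" "s \<in> {0..\<delta>}" using st by auto
    show "c (s + \<tau>) \<in> carrier G \<and> c s \<otimes>\<^bsub>G\<^esub> c \<tau> \<in> carrier G" using m c' by auto
    show "has_ld G ptG (\<lambda>\<tau>. c (s + \<tau>)) y \<tau> {0..t}"
      by (rule G.has_ld_transfer[where ?s0.0 = "s + \<tau>" and ?S0.0 = "{0..\<delta>}" and f = c and g = "\<one>\<^bsub>G\<^esub>" and r = 1])
         (use c' m st in \<open>auto simp: algebra_simps\<close>)
    show "has_ld G ptG (\<lambda>\<tau>. c s \<otimes>\<^bsub>G\<^esub> c \<tau>) y \<tau> {0..t}"
      by (rule G.has_ld_transfer[where ?s0.0 = "\<tau>" and ?S0.0 = "{0..\<delta>}" and f = c and g = "c s" and r = 1])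
         (use c' m st in auto)
  qed (use st c0 c' in auto)
  have dadd: "d (s + t) = d s \<otimes>\<^bsub>N\<^esub> \<pi> (c s) (d t)" if st: "0 \<le> s" "0 \<le> t" "s + t \<le> \<delta>" for s t
  proof (rule N.ld_unique[where a = 0 and b = t and c = "\<lambda>\<tau>. d (s + \<tau>)" and d = "\<lambda>\<tau>. d s \<otimes>\<^bsub>N\<^esub> \<pi> (c s) (d \<tau>)"
        and \<xi> = "\<lambda>\<tau>. L (c (s + \<tau>)) x" and A = A])
    fix \<tau> assume "\<tau> \<in> {0..t}"
    then have m: "\<tau> \<in> {0..\<delta>}" "s + \<tau> \<in> {0..\<delta>}" "s \<in> {0..\<delta>}" "0 \<le> \<tau>" "s + \<tau> \<le> \<delta>" using st by auto
    show "d (s + \<tau>) \<in> carrier N \<and> d s \<otimes>\<^bsub>N\<^esub> \<pi> (c s) (d \<tau>) \<in> carrier N"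
      using m c' d act_closed by auto
    show "norm (L (c (s + \<tau>)) x) \<le> A" using A m by blast
    show "has_ld N ptN (\<lambda>\<tau>. d (s + \<tau>)) (L (c (s + \<tau>)) x) \<tau> {0..t}"
      by (rule N.has_ld_transfer[where ?s0.0 = "s + \<tau>" and ?S0.0 = "{0..\<delta>}" and f = d and g = "\<one>\<^bsub>N\<^esub>" and r = 1])
         (use d m st in \<open>auto simp: algebra_simps\<close>)
    \<comment> \<open>Multiplicativity of L turns the derivative of the translated curve into the
      one prescribed for d at time s + \<tau>.\<close>
    have "L (c (s + \<tau>)) x = L (c s) (L (c \<tau>) x)" using cadd[OF st(1) m(4,5)] L_mult c' m by simp
    then have "has_ld N ptN (\<lambda>\<tau>. \<pi> (c s) (d \<tau>)) (L (c (s + \<tau>)) x) \<tau> {0..\<delta>}"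
      using has_ld_act[of d "L (c \<tau>) x" \<tau> "{0..\<delta>}" "c s"] d[OF m(1)] c'[OF m(3)] by simp
    then show "has_ld N ptN (\<lambda>\<tau>. d s \<otimes>\<^bsub>N\<^esub> \<pi> (c s) (d \<tau>)) (L (c (s + \<tau>)) x) \<tau> {0..t}"
      by (rule N.has_ld_transfer[where ?s0.0 = "\<tau>" and ?S0.0 = "{0..\<delta>}" and g = "d s" and r = 1])
         (use d c' m st act_closed in auto)
  next
    have "\<pi> (c s) \<one>\<^bsub>N\<^esub> = \<one>\<^bsub>N\<^esub>"
      using hom_one[OF act_hom[of "c s"]] c'[of s] st N.is_group by auto
    then show "d (s + 0) = d s \<otimes>\<^bsub>N\<^esub> \<pi> (c s) (d 0)" using d0 d[of s] st by simp
  qed (use st in auto)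
  show ?thesis
    by (rule exI[of _ \<delta>], rule exI[of _ c], rule exI[of _ d]) (use \<delta> c0 d0 c' d cadd dadd in auto)
qed

text \<open>In components, t -> (d t, c t) is the one-parameter semigroup of H with velocity (x, y)
  at 0. The factor L (c t) is the one in the differential of left translation by (d t, c t), see
  \<open>left_translation_derivative\<close>.\<close>

definition ld_semigroup :: "'f \<Rightarrow> 'e \<Rightarrow> (real \<Rightarrow> 'b) \<Rightarrow> (real \<Rightarrow> 'a) \<Rightarrow> bool" where
  "ld_semigroup y x c d \<longleftrightarrow> c 0 = \<one>\<^bsub>G\<^esub> \<and> d 0 = \<one>\<^bsub>N\<^esub> \<and>
    (\<forall>t\<ge>0. c t \<in> carrier G \<and> d t \<in> carrier N \<and> has_ld G ptG c y t {0..} \<and> has_ld N ptN d (L (c t) x) t {0..}) \<and>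
    (\<forall>s\<ge>0. \<forall>t\<ge>0. c (s + t) = c s \<otimes>\<^bsub>G\<^esub> c t \<and> d (s + t) = d s \<otimes>\<^bsub>N\<^esub> \<pi> (c s) (d t))"

text \<open>The local solution is a local semigroup in H and is extended to all times algebraically.
  Derivatives at later times are inherited by left translation, instead of solving the equations
  again.\<close>

lemma ld_semigroup_exists: "\<exists>c d. ld_semigroup y x c d"
proof -
  obtain \<delta> c0 d0 where "0 < \<delta>" and init: "c0 0 = \<one>\<^bsub>G\<^esub>" "d0 0 = \<one>\<^bsub>N\<^esub>"
    and cl: "\<And>t. t \<in> {0..\<delta>} \<Longrightarrow> c0 t \<in> carrier G \<and> d0 t \<in> carrier N"
    and ld: "\<And>t. t \<in> {0..\<delta>} \<Longrightarrow> has_ld G ptG c0 y t {0..\<delta>} \<and> has_ld N ptN d0 (L (c0 t) x) t {0..\<delta>}"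
    and add: "\<And>s t. 0 \<le> s \<Longrightarrow> 0 \<le> t \<Longrightarrow> s + t \<le> \<delta> \<Longrightarrow> c0 (s + t) = c0 s \<otimes>\<^bsub>G\<^esub> c0 t \<and> d0 (s + t) = d0 s \<otimes>\<^bsub>N\<^esub> \<pi> (c0 s) (d0 t)"
    using ld_semigroup_local[of y x] by blast
  define H where "H = \<lparr>carrier = carrier N \<times> carrier G,
      mult = (\<lambda>(n1, g1) (n2, g2). (n1 \<otimes>\<^bsub>N\<^esub> \<pi> g1 n2, g1 \<otimes>\<^bsub>G\<^esub> g2)), one = (\<one>\<^bsub>N\<^esub>, \<one>\<^bsub>G\<^esub>)\<rparr>"
  have H: "carrier H = carrier N \<times> carrier G" "\<one>\<^bsub>H\<^esub> = (\<one>\<^bsub>N\<^esub>, \<one>\<^bsub>G\<^esub>)"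
    "\<And>n g m h. (n, g) \<otimes>\<^bsub>H\<^esub> (m, h) = (n \<otimes>\<^bsub>N\<^esub> \<pi> g m, g \<otimes>\<^bsub>G\<^esub> h)" by (auto simp: H_def)
  have "\<exists>h. (\<forall>t\<ge>0. h t \<in> carrier H) \<and> (\<forall>t. 0 \<le> t \<and> t \<le> \<delta> \<longrightarrow> h t = (d0 t, c0 t)) \<and>
    (\<forall>s\<ge>0. \<forall>t\<ge>0. h (s + t) = h s \<otimes>\<^bsub>H\<^esub> h t)"
    using cl add \<open>0 < \<delta>\<close> by (intro group.semigroup_extend[OF semidirect_group(1)[OF H]]) (auto simp: H)
  then obtain h where h: "\<And>t. 0 \<le> t \<Longrightarrow> h t \<in> carrier H" "\<And>t. 0 \<le> t \<Longrightarrow> t \<le> \<delta> \<Longrightarrow> h t = (d0 t, c0 t)"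
    "\<And>s t. 0 \<le> s \<Longrightarrow> 0 \<le> t \<Longrightarrow> h (s + t) = h s \<otimes>\<^bsub>H\<^esub> h t" by blast
  define c where "c t = snd (h t)" for t
  define d where "d t = fst (h t)" for t
  have hcd: "h t = (d t, c t)" for t by (simp add: c_def d_def)
  have ccl: "c t \<in> carrier G" "d t \<in> carrier N" if "0 \<le> t" for t using h(1)[OF that] by (auto simp: hcd H)
  have loc: "c t = c0 t" "d t = d0 t" if "0 \<le> t" "t \<le> \<delta>" for t using h(2)[OF that] by (auto simp: hcd)
  have cadd: "c (s + t) = c s \<otimes>\<^bsub>G\<^esub> c t" "d (s + t) = d s \<otimes>\<^bsub>N\<^esub> \<pi> (c s) (d t)" if "0 \<le> s" "0 \<le> t" for s t
    using h(3)[OF that] by (auto simp: hcd H)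
  have "has_ld G ptG c y t {0..} \<and> has_ld N ptN d (L (c t) x) t {0..}" if t: "0 \<le> t" for t
  proof -
    \<comment> \<open>Every \<tau> \<ge> 0 within \<delta> / 2 of t lies in [t0, t0 + \<delta>], and
      there the curve is the left translate by (d t0, c t0) of the local solution.\<close>
    define t0 where "t0 = max 0 (t - \<delta> / 2)"
    define s0 where "s0 = t - t0"
    have b: "0 \<le> t0" "0 \<le> s0" "s0 \<le> \<delta> / 2" "t = t0 + s0" using t \<open>0 < \<delta>\<close> by (auto simp: t0_def s0_def max_def)
    have near: "\<tau> - t + s0 \<in> {0..\<delta>} \<and> \<tau> = t0 + (\<tau> - t + s0)" if "0 \<le> \<tau>" "\<bar>\<tau> - t\<bar> < \<delta> / 2" for \<tau>
    proof -
      have "\<tau> < t + \<delta> / 2" "t - \<delta> / 2 < \<tau>" using that(2) by linarith+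
      then have "t0 \<le> \<tau>" "\<tau> - t0 \<le> \<delta>" using that(1) unfolding t0_def by linarith+
      then show ?thesis by (simp add: s0_def)
    qed
    have s0m: "s0 \<in> {0..\<delta>}" using b \<open>0 < \<delta>\<close> by auto
    have ct: "c t = c t0 \<otimes>\<^bsub>G\<^esub> c0 s0" "d t = d t0 \<otimes>\<^bsub>N\<^esub> \<pi> (c t0) (d0 s0)"
      using cadd[OF b(1,2)] b(4) loc[of s0] s0m by auto
    have n2: "c \<tau> = c t0 \<otimes>\<^bsub>G\<^esub> c0 (\<tau> - t + s0) \<and> d \<tau> = d t0 \<otimes>\<^bsub>N\<^esub> \<pi> (c t0) (d0 (\<tau> - t + s0))"
      if "0 \<le> \<tau>" "\<bar>\<tau> - t\<bar> < \<delta> / 2" for \<tau>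
      using cadd[OF b(1), of "\<tau> - t + s0"] near[OF that] loc[of "\<tau> - t + s0"] by simp
    have "has_ld G ptG c y t {0..}"
      by (rule G.has_ld_transfer[where ?s0.0 = s0 and ?S0.0 = "{0..\<delta>}" and f = c0 and g = "c t0" and r = "\<delta> / 2"])
         (use ld[OF s0m] cl[OF s0m] ccl[OF b(1)] ct near n2 \<open>0 < \<delta>\<close> in auto)
    moreover have "L (c t) x = L (c t0) (L (c0 s0) x)" using ct L_mult ccl[OF b(1)] cl[OF s0m] by simp
    then have "has_ld N ptN (\<lambda>\<tau>. \<pi> (c t0) (d0 \<tau>)) (L (c t) x) s0 {0..\<delta>}"
      using has_ld_act[of d0 "L (c0 s0) x" s0 "{0..\<delta>}" "c t0"] ld[OF s0m] cl[OF s0m] ccl[OF b(1)] by simp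
    then have "has_ld N ptN d (L (c t) x) t {0..}"
      by (rule N.has_ld_transfer[where ?s0.0 = s0 and ?S0.0 = "{0..\<delta>}" and g = "d t0" and r = "\<delta> / 2"])
         (use cl[OF s0m] ccl[OF b(1)] ct near n2 \<open>0 < \<delta>\<close> act_closed in auto)
    ultimately show ?thesis by blast
  qed
  then have "ld_semigroup y x c d" unfolding ld_semigroup_def
    using loc[of 0] \<open>0 < \<delta>\<close> init ccl cadd by auto
  then show ?thesis by blast
qed

text \<open>The deviation from s x has two parts: the remainder of \<open>quad_step\<close>, kept
  below two thirds of \<epsilon> s, and s (L (b s) x - x), kept below one third by strong continuity
  of L at the identity, to which b s tends.\<close>

lemma curve0_act:
  assumes b: "curve0 ptG b y" and a: "curve0 ptN a x"
  shows "curve0 ptN (\<lambda>s. \<pi> (b s) (a s)) x"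
  unfolding curve0_def
proof (intro allI impI)
  fix \<epsilon> :: real assume "\<epsilon> > 0"
  obtain \<kappa> where \<kappa>: "\<kappa> > 0" "\<And>w. norm w < \<kappa> \<Longrightarrow> quad \<kappa> (\<one>\<^bsub>G\<^esub> \<otimes>\<^bsub>G\<^esub> ptG w)" using quad_ex[OF G.one_closed] by blast
  have e3: "\<epsilon> / 3 > 0" using \<open>\<epsilon> > 0\<close> by simp
  obtain \<delta>L where \<delta>L: "\<delta>L > 0" "\<And>w. norm w < \<delta>L \<Longrightarrow> norm (L (\<one>\<^bsub>G\<^esub> \<otimes>\<^bsub>G\<^esub> ptG w) x - L \<one>\<^bsub>G\<^esub> x) < \<epsilon> / 3"
    using L_continuous[OF G.one_closed e3, of x] by blast
  have m1: "min RG (min \<kappa> \<delta>L) > 0" using \<kappa> \<delta>L G.R_pos by simp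
  obtain \<delta>1 where 1: "\<delta>1 > 0" "\<And>s. 0 \<le> s \<and> s < \<delta>1 \<Longrightarrow> \<exists>z. b s = ptG z \<and> norm z < min RG (min \<kappa> \<delta>L)"
    using curve0_ex[OF b zero_less_one m1] by blast
  define \<epsilon>' where "\<epsilon>' = min 1 (\<kappa> * \<epsilon> / 3)"
  have \<epsilon>': "\<epsilon>' > 0" "\<epsilon>' \<le> 1" "\<epsilon>' \<le> \<kappa> * \<epsilon> / 3" using \<kappa> \<open>\<epsilon> > 0\<close> by (auto simp: \<epsilon>'_def)
  obtain \<delta>2 where 2: "\<delta>2 > 0" "\<And>s. 0 \<le> s \<and> s < \<delta>2 \<Longrightarrow>
     \<exists>z. a s = ptN z \<and> norm (z - s *\<^sub>R x) \<le> \<epsilon>' * s \<and> norm z \<le> (norm x + \<epsilon>') * s \<and> norm z < \<kappa>"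
    using curve0_ex[OF a \<epsilon>'(1) \<kappa>(1)] by blast
  define A where "A = norm x + 1"
  have A: "A > 0" by (simp add: A_def add_nonneg_pos)
  define \<delta> where "\<delta> = min (min \<delta>1 \<delta>2) (\<kappa> * \<epsilon> / (3 * A\<^sup>2))"
  show "\<exists>\<delta>>0. \<forall>s. 0 \<le> s \<and> s < \<delta> \<longrightarrow> (\<exists>z. \<pi> (b s) (a s) = ptN z \<and> norm (z - s *\<^sub>R x) \<le> \<epsilon> * s)"
  proof (intro exI[of _ \<delta>] conjI allI impI)
    fix s assume "0 \<le> s \<and> s < \<delta>"
    then have s: "0 \<le> s" "s < \<delta>1" "s < \<delta>2" "s < \<kappa> * \<epsilon> / (3 * A\<^sup>2)" by (auto simp: \<delta>_def)
    obtain w where w: "b s = ptG w" "norm w < RG" "norm w < \<kappa>" "norm w < \<delta>L" using 1(2)[of s] s by auto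
    have bs: "b s = \<one>\<^bsub>G\<^esub> \<otimes>\<^bsub>G\<^esub> ptG w" "b s \<in> carrier G" using w G.pt_closed' by auto
    obtain z where z: "a s = ptN z" "norm (z - s *\<^sub>R x) \<le> \<epsilon>' * s" "norm z \<le> (norm x + \<epsilon>') * s" "norm z < \<kappa>"
      using 2(2)[of s] s by auto
    have q: "quad \<kappa> (b s)" using \<kappa>(2)[OF w(3)] bs by simp
    have "norm z \<le> A * s" using z(3) mult_right_mono[of "norm x + \<epsilon>'" A s] \<epsilon>' s by (auto simp: A_def)
    then obtain z' where z': "\<pi> (b s) (ptN z) = ptN z'" "\<kappa> * norm (z' - s *\<^sub>R L (b s) x) \<le> (A\<^sup>2 * s + \<epsilon>') * s"
      using quad_step[OF q bs(2) \<kappa>(1) z(4), of s x \<epsilon>' A] z(2) s by auto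
    have "3 * (A\<^sup>2 * s) \<le> \<kappa> * \<epsilon>" using s A by (simp add: field_simps)
    then have "(A\<^sup>2 * s + \<epsilon>') * s \<le> (2 * (\<kappa> * \<epsilon> / 3)) * s" using s \<epsilon>' by (intro mult_right_mono) auto
    then have "\<kappa> * norm (z' - s *\<^sub>R L (b s) x) \<le> \<kappa> * (2 * \<epsilon> / 3 * s)" using z'(2) by simp
    then have r1: "norm (z' - s *\<^sub>R L (b s) x) \<le> 2 * \<epsilon> / 3 * s" using mult_le_cancel_left_pos[OF \<kappa>(1)] by blast
    have "norm (L (b s) x - x) \<le> \<epsilon> / 3" using \<delta>L(2)[OF w(4)] bs(1) L_one by simp
    then have "s * norm (L (b s) x - x) \<le> s * (\<epsilon> / 3)" using s by (intro mult_left_mono)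
    then have r2: "norm (s *\<^sub>R L (b s) x - s *\<^sub>R x) \<le> \<epsilon> / 3 * s"
      using s by (simp add: scaleR_diff_right[symmetric] mult.commute)
    have "norm (z' - s *\<^sub>R x) \<le> \<epsilon> * s"
      using norm_triangle_mono[OF r1 r2] by simp
    then show "\<exists>z. \<pi> (b s) (a s) = ptN z \<and> norm (z - s *\<^sub>R x) \<le> \<epsilon> * s" using z z' by auto
  qed (use 1 2 \<kappa> A \<open>\<epsilon> > 0\<close> in \<open>simp add: \<delta>_def\<close>)
qed

text \<open>Continuity of L at g is used at the two points g w v and g w, both near g. The two-point
  form is a condition on all points near g, as \<open>ld_compact\<close> requires, and so becomes
  uniform along a curve.\<close>

lemma L_uniform:
  assumes "0 < \<epsilon>" "g \<in> carrier G"
  shows "\<exists>\<delta>>0. \<forall>w. norm w < \<delta> \<longrightarrow> (\<forall>v. norm v < \<delta> \<longrightarrow>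
    norm (L (g \<otimes>\<^bsub>G\<^esub> ptG w \<otimes>\<^bsub>G\<^esub> ptG v) x - L (g \<otimes>\<^bsub>G\<^esub> ptG w) x) \<le> \<epsilon>)"
proof -
  have "\<epsilon> / 2 > 0" using assms by simp
  then obtain \<delta> where \<delta>: "\<delta> > 0" "\<And>w. norm w < \<delta> \<Longrightarrow> norm (L (g \<otimes>\<^bsub>G\<^esub> ptG w) x - L g x) < \<epsilon> / 2"
    using L_continuous[OF assms(2), of "\<epsilon> / 2" x] by blast
  define r where "r = min RG (\<delta> / (1 + CG))"
  have r: "r > 0" "r \<le> RG" using \<delta> G.C_pos G.R_pos by (auto simp: r_def)
  have "r \<le> \<delta> / (1 + CG)" by (simp add: r_def)
  then have r\<delta>: "r + CG * r \<le> \<delta>" using G.C_pos by (simp add: le_divide_eq algebra_simps)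
  then have r\<delta>': "r \<le> \<delta>" using r G.C_pos mult_pos_pos[of CG r] by linarith
  show ?thesis
  proof (intro exI[of _ r] conjI allI impI r(1))
    fix w v :: 'f assume w: "norm w < r" and v: "norm v < r"
    then have wR: "norm w < RG" and vR: "norm v < RG" using r by auto
    obtain z where z: "ptG w \<otimes>\<^bsub>G\<^esub> ptG v = ptG z" "norm (z - w) \<le> CG * norm v"
      using G.mult_ex[OF wR vR] by blast
    have "CG * norm v \<le> CG * r" using v G.C_pos by simp
    then have "norm z < \<delta>" using z w r\<delta> norm_triangle_ineq[of w "z - w"] by simp
    moreover have "g \<otimes>\<^bsub>G\<^esub> ptG w \<otimes>\<^bsub>G\<^esub> ptG v = g \<otimes>\<^bsub>G\<^esub> ptG z"
      using z(1)[symmetric] assms wR vR G.pt_closed' by (simp add: G.m_assoc)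
    ultimately have "norm (L (g \<otimes>\<^bsub>G\<^esub> ptG w \<otimes>\<^bsub>G\<^esub> ptG v) x - L g x) < \<epsilon> / 2"
      "norm (L (g \<otimes>\<^bsub>G\<^esub> ptG w) x - L g x) < \<epsilon> / 2"
      using \<delta>(2)[of z] \<delta>(2)[of w] w r\<delta>' by auto
    then show "norm (L (g \<otimes>\<^bsub>G\<^esub> ptG w \<otimes>\<^bsub>G\<^esub> ptG v) x - L (g \<otimes>\<^bsub>G\<^esub> ptG w) x) \<le> \<epsilon>"
      using norm_triangle_ineq4[of "L (g \<otimes>\<^bsub>G\<^esub> ptG w \<otimes>\<^bsub>G\<^esub> ptG v) x - L g x" "L (g \<otimes>\<^bsub>G\<^esub> ptG w) x - L g x"]
      by simp
  qed
qed

section \<open>Convergence of the products\<close>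

lemma gronwall_const_bound:
  fixes n :: nat
  assumes "0 \<le> s" "real n * s \<le> T" "0 \<le> a" "0 \<le> e" "0 < C"
  shows "C * (e * s) * n * exp (C * (a * s) * n) \<le> e * (C * T * exp (C * a * T) + 1)"
proof -
  have T: "0 \<le> T" using assms(1,2) mult_nonneg_nonneg[of "real n" s] by linarith
  have "C * (e * s) * n * exp (C * (a * s) * n) = C * e * (n * s) * exp (C * a * (n * s))"
    by (simp add: mult_ac)
  also have "\<dots> \<le> C * e * T * exp (C * a * T)"
    using assms T by (intro mult_mono mult_left_mono) (auto intro!: mult_left_mono)
  \<comment> \<open>The summand 1 makes the constant positive, so that an error budget may be
    divided by it.\<close>
  also have "\<dots> \<le> e * (C * T * exp (C * a * T) + 1)" using assms by (simp add: algebra_simps)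
  finally show ?thesis .
qed

lemma ld_semigroupD:
  assumes "ld_semigroup y x c d"
  shows "c 0 = \<one>\<^bsub>G\<^esub>" "d 0 = \<one>\<^bsub>N\<^esub>" "0 \<le> t \<Longrightarrow> c t \<in> carrier G" "0 \<le> t \<Longrightarrow> d t \<in> carrier N"
    "0 \<le> t \<Longrightarrow> has_ld G ptG c y t {0..}" "0 \<le> t \<Longrightarrow> has_ld N ptN d (L (c t) x) t {0..}"
    "0 \<le> s \<Longrightarrow> 0 \<le> t \<Longrightarrow> c (s + t) = c s \<otimes>\<^bsub>G\<^esub> c t" "0 \<le> s \<Longrightarrow> 0 \<le> t \<Longrightarrow> d (s + t) = d s \<otimes>\<^bsub>N\<^esub> \<pi> (c s) (d t)"
  using assms unfolding ld_semigroup_def by blast+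

text \<open>Here u k stands for the N-component of the k-th power of (a s, b s) in H, and the
  conclusion displays the two components of the inverse of (d, c) at time n s times the n-th power.
  All radii are chosen in terms of c on [0, T], before s, n and u; this gives uniformity in t = n
  s.\<close>

theorem trotter_convergence:
  assumes sg: "ld_semigroup y x c d" and a: "curve0 ptN a x" and b: "curve0 ptG b y"
    and "0 \<le> T" "0 < \<epsilon>"
  shows "\<exists>s1>0. \<forall>s n u. 0 \<le> s \<longrightarrow> s < s1 \<longrightarrow> real n * s \<le> T \<longrightarrow> u 0 = \<one>\<^bsub>N\<^esub> \<longrightarrow>
    (\<forall>k. u (Suc k) = u k \<otimes>\<^bsub>N\<^esub> \<pi> (b s [^]\<^bsub>G\<^esub> k) (a s)) \<longrightarrow>
    u n \<in> carrier N \<and> b s \<in> carrier G \<and>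
    (\<exists>z w. norm z < \<epsilon> \<and> norm w < \<epsilon> \<and> inv\<^bsub>G\<^esub> (c (n * s)) \<otimes>\<^bsub>G\<^esub> (b s [^]\<^bsub>G\<^esub> n) = ptG w \<and>
      \<pi> (inv\<^bsub>G\<^esub> (c (n * s))) (inv\<^bsub>N\<^esub> (d (n * s)) \<otimes>\<^bsub>N\<^esub> u n) = ptN z)"
proof -
  note sg' = ld_semigroupD[OF sg]
  have cc: "t \<in> {0..T} \<Longrightarrow> c t \<in> carrier G" for t using sg' by auto
  have cld: "t \<in> {0..T} \<Longrightarrow> has_ld G ptG c y t {0..T}" for t
    using sg'(5)[of t] by (auto intro: has_ld_subset)
  have comp: "\<exists>\<delta>>0. \<forall>t\<in>{0..T}. \<forall>w. norm w < \<delta> \<longrightarrow> P \<delta> (c t \<otimes>\<^bsub>G\<^esub> ptG w)"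
    if "\<And>g. g \<in> carrier G \<Longrightarrow> \<exists>\<delta>>0. \<forall>w. norm w < \<delta> \<longrightarrow> P \<delta> (g \<otimes>\<^bsub>G\<^esub> ptG w)"
      "\<And>\<delta> \<delta>' g. 0 < \<delta>' \<Longrightarrow> \<delta>' \<le> \<delta> \<Longrightarrow> P \<delta> g \<Longrightarrow> P \<delta>' g" for P :: "real \<Rightarrow> 'b \<Rightarrow> bool"
    by (rule G.ld_compact[OF \<open>0 \<le> T\<close> cc cld that])
  obtain \<delta>A where \<delta>A: "\<delta>A > 0" "\<And>t w. t \<in> {0..T} \<Longrightarrow> norm w < \<delta>A \<Longrightarrow> quad \<delta>A (c t \<otimes>\<^bsub>G\<^esub> ptG w)"
    using comp[of quad] quad_ex quad_mono by blast
  have "\<exists>\<delta>>0. \<forall>t\<in>{0..T}. \<forall>w. norm w < \<delta> \<longrightarrow> (\<forall>y. norm y < \<delta> \<longrightarrow>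
      (\<exists>z. norm z < \<epsilon> \<and> \<pi> (inv\<^bsub>G\<^esub> (c t \<otimes>\<^bsub>G\<^esub> ptG w)) (ptN y) = ptN z))"
    by (rule comp[where P = "\<lambda>\<delta> g. \<forall>y. norm y < \<delta> \<longrightarrow> (\<exists>z. norm z < \<epsilon> \<and> \<pi> (inv\<^bsub>G\<^esub> g) (ptN y) = ptN z)"])
      (use act_inv[OF _ \<open>0 < \<epsilon>\<close>] in auto)
  then obtain \<delta>I where \<delta>I: "\<delta>I > 0" "\<And>t w v. t \<in> {0..T} \<Longrightarrow> norm w < \<delta>I \<Longrightarrow> norm v < \<delta>I \<Longrightarrow>
      \<exists>z. norm z < \<epsilon> \<and> \<pi> (inv\<^bsub>G\<^esub> (c t \<otimes>\<^bsub>G\<^esub> ptG w)) (ptN v) = ptN z"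
    by blast
  \<comment> \<open>aN s and aG s bound one increment in N and in G. The 2 in aN absorbs the error
    terms A^2 s \<le> 1 and \<epsilon>N \<le> 1, and the divisor \<delta>A is the inverse of the
    constant that bounds L.\<close>
  define aN where "aN = (2 + norm x) / \<delta>A"
  define A where "A = norm x + 1"
  define aG where "aG = norm y + 1"
  have pos: "aN \<ge> 0" "A \<ge> 1" "aG \<ge> 0" using \<delta>A by (auto simp: aN_def A_def aG_def)
  define MN where "MN = CN * T * exp (CN * aN * T) + 1"
  define MG where "MG = CG * T * exp (CG * aG * T) + 1"
  have M: "MN > 0" "MG > 0"
    unfolding MN_def MG_def using \<open>0 \<le> T\<close> N.C_pos G.C_pos by (auto intro!: add_nonneg_pos)
  \<comment> \<open>E s is the mismatch of increments in N that each step may have: after Gronwall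
    it amounts to less than RN, which keeps the deviation in the chart, and less than \<delta>I,
    which prepares the application of \<pi> at the inverse of c.\<close>
  define E where "E = min \<delta>I RN / 2 / MN"
  have E: "E > 0" "E * MN < min \<delta>I RN" using \<delta>I N.R_pos M by (auto simp: E_def)
  have E3: "E / 3 > 0" using E by simp
  have "\<exists>\<delta>>0. \<forall>t\<in>{0..T}. \<forall>w. norm w < \<delta> \<longrightarrow> (\<forall>v. norm v < \<delta> \<longrightarrow>
      norm (L (c t \<otimes>\<^bsub>G\<^esub> ptG w \<otimes>\<^bsub>G\<^esub> ptG v) x - L (c t \<otimes>\<^bsub>G\<^esub> ptG w) x) \<le> E / 3)"
    by (rule comp[where P = "\<lambda>\<delta> g. \<forall>v. norm v < \<delta> \<longrightarrow> norm (L (g \<otimes>\<^bsub>G\<^esub> ptG v) x - L g x) \<le> E / 3"])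
      (use L_uniform[OF E3] in auto)
  then obtain \<delta>L where \<delta>L: "\<delta>L > 0" "\<And>t w v. t \<in> {0..T} \<Longrightarrow> norm w < \<delta>L \<Longrightarrow> norm v < \<delta>L \<Longrightarrow>
      norm (L (c t \<otimes>\<^bsub>G\<^esub> ptG w \<otimes>\<^bsub>G\<^esub> ptG v) x - L (c t \<otimes>\<^bsub>G\<^esub> ptG w) x) \<le> E / 3"
    by blast
  \<comment> \<open>The deviation in G has four duties: to stay in the chart, to be below the
    required \<epsilon>, and to be small enough for \<open>quad\<close> at the k-th power of b s and
    for the closeness of L there and at c (k s).\<close>
  define \<rho> where "\<rho> = min (min RG \<epsilon>) (min \<delta>A \<delta>L)"
  have \<rho>: "\<rho> > 0" "\<rho> \<le> RG" "\<rho> \<le> \<epsilon>" "\<rho> \<le> \<delta>A" "\<rho> \<le> \<delta>L" using \<open>0 < \<epsilon>\<close> \<delta>A \<delta>L G.R_pos by (auto simp: \<rho>_def)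
  define EG where "EG = \<rho> / 2 / MG"
  have EG: "EG > 0" "EG * MG < \<rho>" using \<rho> M by (auto simp: EG_def)
  define \<epsilon>G where "\<epsilon>G = min 1 (EG / 2)"
  have \<epsilon>G: "\<epsilon>G > 0" "\<epsilon>G \<le> 1" "2 * \<epsilon>G \<le> EG" using EG by (auto simp: \<epsilon>G_def)
  \<comment> \<open>The 6 distributes E: A^2 s and \<epsilon>N contribute \<delta>A E / 6 each, so
    each of the two increments in N is within E s / 3 of its linear part. The remaining third is the
    change of L.\<close>
  define \<epsilon>N where "\<epsilon>N = min 1 (\<delta>A * E / 6)"
  have \<epsilon>N: "\<epsilon>N > 0" "\<epsilon>N \<le> 1" "\<epsilon>N \<le> \<delta>A * E / 6" using E \<delta>A by (auto simp: \<epsilon>N_def)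
  obtain r1 where r1: "r1 > 0" "\<And>s. 0 \<le> s \<and> s < r1 \<Longrightarrow>
      \<exists>z. b s = ptG z \<and> norm (z - s *\<^sub>R y) \<le> \<epsilon>G * s \<and> norm z \<le> (norm y + \<epsilon>G) * s \<and> norm z < RG"
    using curve0_ex[OF b \<epsilon>G(1) G.R_pos] by blast
  have cy: "has_ld G ptG c y 0 {0..1}"
    using has_ld_subset[OF sg'(5)[OF order_refl], of "{0..1}"] by simp
  obtain r2 where r2: "r2 > 0" "\<And>s. 0 \<le> s \<and> s < r2 \<Longrightarrow>
      \<exists>z. c s = ptG z \<and> norm (z - s *\<^sub>R y) \<le> \<epsilon>G * s \<and> norm z \<le> (norm y + \<epsilon>G) * s \<and> norm z < RG"
    using curve0_ex[OF G.curve0_of_ld[OF cy sg'(1)] \<epsilon>G(1) G.R_pos] by blast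
  obtain r3 where r3: "r3 > 0" "\<And>s. 0 \<le> s \<and> s < r3 \<Longrightarrow>
      \<exists>z. a s = ptN z \<and> norm (z - s *\<^sub>R x) \<le> \<epsilon>N * s \<and> norm z \<le> (norm x + \<epsilon>N) * s \<and> norm z < \<delta>A"
    using curve0_ex[OF a \<epsilon>N(1) \<delta>A(1)] by blast
  have dx: "has_ld N ptN d x 0 {0..1}"
    using has_ld_subset[OF sg'(6)[OF order_refl], of "{0..1}"] sg'(1) L_one by simp
  obtain r4 where r4: "r4 > 0" "\<And>s. 0 \<le> s \<and> s < r4 \<Longrightarrow>
      \<exists>z. d s = ptN z \<and> norm (z - s *\<^sub>R x) \<le> \<epsilon>N * s \<and> norm z \<le> (norm x + \<epsilon>N) * s \<and> norm z < \<delta>A"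
    using curve0_ex[OF N.curve0_of_ld[OF dx sg'(2)] \<epsilon>N(1) \<delta>A(1)] by blast
  define s1 where "s1 = Min {r1, r2, r3, r4, \<delta>A * E / (6 * A\<^sup>2), 1 / A\<^sup>2}"
  have s1: "s1 > 0" using r1 r2 r3 r4 \<delta>A E pos by (auto simp: s1_def)
  show ?thesis
  proof (intro exI[of _ s1] conjI s1 allI impI)
    fix s and n :: nat and u assume "0 \<le> s" "s < s1" and ns: "real n * s \<le> T" and u0: "u 0 = \<one>\<^bsub>N\<^esub>"
      and u: "\<forall>k. u (Suc k) = u k \<otimes>\<^bsub>N\<^esub> \<pi> (b s [^]\<^bsub>G\<^esub> k) (a s)"
    then have s: "0 \<le> s" "s < r1" "s < r2" "s < r3" "s < r4" "s < \<delta>A * E / (6 * A\<^sup>2)" "s < 1 / A\<^sup>2"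
      by (auto simp: s1_def)
    have As: "A\<^sup>2 * s \<le> 1" "A\<^sup>2 * s \<le> \<delta>A * E / 6" using s pos by (auto simp: field_simps)
    have ks: "real k * s \<in> {0..T}" if "k \<le> n" for k
      using s(1) ns mult_right_mono[of "real k" "real n" s] that by auto
    obtain B where B: "b s = ptG B" "norm (B - s *\<^sub>R y) \<le> \<epsilon>G * s" "norm B < RG" using r1(2)[of s] s by auto
    obtain Y where Y: "c s = ptG Y" "norm (Y - s *\<^sub>R y) \<le> \<epsilon>G * s" "norm Y < RG" "norm Y \<le> (norm y + \<epsilon>G) * s"
      using r2(2)[of s] s by auto
    have bG: "b s \<in> carrier G" using B G.pt_closed' by simp
    have Ya: "norm Y \<le> aG * s" using Y(4) mult_right_mono[of "norm y + \<epsilon>G" aG s] \<epsilon>G s by (auto simp: aG_def)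
    have "norm (B - Y) \<le> \<epsilon>G * s + \<epsilon>G * s"
      using norm_triangle_ineq4[of "B - s *\<^sub>R y" "Y - s *\<^sub>R y"] B Y by simp
    also have "\<dots> \<le> EG * s" using mult_right_mono[OF \<epsilon>G(3) s(1)] by simp
    finally have BY: "norm (B - Y) \<le> EG * s" .
    have csuc: "c (real (Suc k) * s) = c (real k * s) \<otimes>\<^bsub>G\<^esub> c s" "d (real (Suc k) * s) = d (real k * s) \<otimes>\<^bsub>N\<^esub> \<pi> (c (real k * s)) (d s)" for k
      using sg'(7,8)[of "real k * s" s] s by (simp_all add: algebra_simps)
    \<comment> \<open>The G-components advance by right factors that are the same for all k, so
      Gronwall in G can be carried out before anything is known about N.\<close>
    have Gk: "\<exists>w. norm w < \<rho> \<and> inv\<^bsub>G\<^esub> (c (k * s)) \<otimes>\<^bsub>G\<^esub> (b s [^]\<^bsub>G\<^esub> k) = ptG w" if k: "k \<le> n" for k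
    proof -
      have bd: "CG * (EG * s) * k * exp (CG * (aG * s) * k) \<le> EG * MG"
        unfolding MG_def using s ks[OF k] pos EG G.C_pos by (intro gronwall_const_bound) auto
      have "\<exists>z. norm z \<le> CG * (EG * s) * k * exp (CG * (aG * s) * k) \<and> inv\<^bsub>G\<^esub> (c (k * s)) \<otimes>\<^bsub>G\<^esub> (b s [^]\<^bsub>G\<^esub> k) = ptG z"
        using G.discrete_gronwall[where c = "\<lambda>k. c (real k * s)" and d = "\<lambda>k. b s [^]\<^bsub>G\<^esub> k" and q = "\<lambda>_. Y" and p = "\<lambda>_. B" and n = k
            and a = "aG * s" and b = "EG * s"]
          csuc Y B Ya BY sg'(1) s pos EG bd \<rho> by simp
      then show ?thesis using bd EG by (meson le_less_trans)
    qed
    \<comment> \<open>The increments in N depend on k through the action of c (k s) and of the k-th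
      power of b s. They are close because these two elements differ by a right factor pt w, which
      \<open>Gk\<close> makes small.\<close>
    have step: "\<exists>q p. norm q < RN \<and> norm p < RN \<and> norm q \<le> aN * s \<and> norm (p - q) \<le> E * s \<and>
        \<pi> (c (k * s)) (d s) = ptN q \<and> \<pi> (b s [^]\<^bsub>G\<^esub> k) (a s) = ptN p" if k: "k < n" for k
    proof -
      define g where "g = c (real k * s)"
      define h where "h = b s [^]\<^bsub>G\<^esub> k"
      have km: "real k * s \<in> {0..T}" using ks k by simp
      have gG: "g \<in> carrier G" "h \<in> carrier G" using cc[OF km] bG by (auto simp: g_def h_def)
      obtain w where w: "norm w < \<rho>" "inv\<^bsub>G\<^esub> g \<otimes>\<^bsub>G\<^esub> h = ptG w" using Gk[of k] k by (auto simp: g_def h_def)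
      have hw: "h = g \<otimes>\<^bsub>G\<^esub> ptG w" using w gG G.inv_solve_left'[of "ptG w" g h] G.pt_closed'[of w] \<rho> by auto
      have g0: "g = g \<otimes>\<^bsub>G\<^esub> ptG 0" using gG by (simp add: G.pt_0)
      have qg: "quad \<delta>A g" using \<delta>A(2)[OF km, of 0] \<delta>A(1) g0 by (simp add: g_def)
      have qh: "quad \<delta>A h" using \<delta>A(2)[OF km, of w] w \<rho> hw by (simp add: g_def)
      have "norm (L (g \<otimes>\<^bsub>G\<^esub> ptG 0 \<otimes>\<^bsub>G\<^esub> ptG w) x - L (g \<otimes>\<^bsub>G\<^esub> ptG 0) x) \<le> E / 3"
        using \<delta>L(2)[OF km, of 0 w] \<delta>L(1) w \<rho> by (simp add: g_def)
      then have Lgh: "norm (L h x - L g x) \<le> E / 3" using g0 hw by simp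
      obtain X where X: "d s = ptN X" "norm (X - s *\<^sub>R x) \<le> \<epsilon>N * s" "norm X \<le> (norm x + \<epsilon>N) * s" "norm X < \<delta>A"
        using r4(2)[of s] s by auto
      obtain X' where X': "a s = ptN X'" "norm (X' - s *\<^sub>R x) \<le> \<epsilon>N * s" "norm X' \<le> (norm x + \<epsilon>N) * s" "norm X' < \<delta>A"
        using r3(2)[of s] s by auto
      have XA: "norm X \<le> A * s" "norm X' \<le> A * s"
        using X(3) X'(3) mult_right_mono[of "norm x + \<epsilon>N" A s] \<epsilon>N s by (auto simp: A_def)
      obtain q where q: "norm q < RN" "\<pi> g (ptN X) = ptN q" "\<delta>A * norm (q - s *\<^sub>R L g x) \<le> (A\<^sup>2 * s + \<epsilon>N) * s"
        using quad_step[OF qg gG(1) \<delta>A(1) X(4), of s x \<epsilon>N A] X(2) XA(1) s(1) by auto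
      obtain p where p: "norm p < RN" "\<pi> h (ptN X') = ptN p" "\<delta>A * norm (p - s *\<^sub>R L h x) \<le> (A\<^sup>2 * s + \<epsilon>N) * s"
        using quad_step[OF qh gG(2) \<delta>A(1) X'(4), of s x \<epsilon>N A] X'(2) XA(2) s(1) by auto
      have "\<delta>A * norm q \<le> \<delta>A * (norm (q - s *\<^sub>R L g x) + s * norm (L g x))"
        using norm_triangle_ineq[of "q - s *\<^sub>R L g x" "s *\<^sub>R L g x"] s \<delta>A(1) by (intro mult_left_mono) auto
      also have "\<dots> \<le> (A\<^sup>2 * s + \<epsilon>N) * s + s * norm x"
        using q(3) mult_left_mono[OF quad_L[OF qg gG(1) \<delta>A(1), of x] s(1)] by (simp add: distrib_left mult_ac)
      also have "(A\<^sup>2 * s + \<epsilon>N) * s \<le> 2 * s" using As \<epsilon>N s by (intro mult_right_mono) auto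
      finally have "\<delta>A * norm q \<le> (2 + norm x) * s" by (simp add: algebra_simps)
      then have qa: "norm q \<le> aN * s" using \<delta>A(1) by (simp add: aN_def field_simps)
      have "(A\<^sup>2 * s + \<epsilon>N) * s \<le> (\<delta>A * E / 3) * s" using As \<epsilon>N s by (intro mult_right_mono) auto
      also have "\<dots> = \<delta>A * (E / 3 * s)" by simp
      finally have K: "(A\<^sup>2 * s + \<epsilon>N) * s \<le> \<delta>A * (E / 3 * s)" .
      have 1: "norm (q - s *\<^sub>R L g x) \<le> E / 3 * s" "norm (p - s *\<^sub>R L h x) \<le> E / 3 * s"
        using order_trans[OF q(3) K] order_trans[OF p(3) K] mult_le_cancel_left_pos[OF \<delta>A(1)] by blast+
      have 2: "norm (s *\<^sub>R (L h x - L g x)) \<le> E / 3 * s" using mult_left_mono[OF Lgh s(1)] s by (simp add: mult_ac)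
      have e: "p - q = (p - s *\<^sub>R L h x) + (s *\<^sub>R (L h x - L g x) - (q - s *\<^sub>R L g x))" by (simp add: algebra_simps)
      have "norm (p - q) \<le> E / 3 * s + (E / 3 * s + E / 3 * s)"
        unfolding e by (rule norm_triangle_mono[OF 1(2) norm_triangle_le_diff[OF add_mono[OF 2 1(1)]]])
      then have "norm (p - q) \<le> E * s" by (simp add: algebra_simps)
      then show ?thesis using q p qa X X' by (auto simp: g_def h_def)
    qed
    define Q where "Q k q p \<longleftrightarrow> norm q < RN \<and> norm p < RN \<and> norm q \<le> aN * s \<and> norm (p - q) \<le> E * s \<and>
        \<pi> (c (k * s)) (d s) = ptN q \<and> \<pi> (b s [^]\<^bsub>G\<^esub> k) (a s) = ptN p" for k :: nat and q p
    have "\<forall>k. \<exists>q p. k < n \<longrightarrow> Q k q p" using step unfolding Q_def by blast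
    then obtain q p where qp: "\<And>k. k < n \<Longrightarrow> Q k (q k) (p k)" by metis
    have bd: "CN * (E * s) * n * exp (CN * (aN * s) * n) \<le> E * MN"
      unfolding MN_def using s ns pos E N.C_pos by (intro gronwall_const_bound) auto
    have "d (n * s) \<in> carrier N \<and> u n \<in> carrier N \<and>
       (\<exists>z. norm z \<le> CN * (E * s) * n * exp (CN * (aN * s) * n) \<and> inv\<^bsub>N\<^esub> (d (n * s)) \<otimes>\<^bsub>N\<^esub> u n = ptN z)"
    proof (rule N.discrete_gronwall[where c = "\<lambda>k. d (real k * s)" and q = q and p = p])
      show "d (real (Suc k) * s) = d (real k * s) \<otimes>\<^bsub>N\<^esub> ptN (q k) \<and> norm (q k) < RN \<and> norm (q k) \<le> aN * s"
        if "k < n" for k using csuc(2)[of k] qp[OF that] by (simp add: Q_def)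
      show "u (Suc k) = u k \<otimes>\<^bsub>N\<^esub> ptN (p k) \<and> norm (p k) < RN \<and> norm (p k - q k) \<le> E * s"
        if "k < n" for k using u qp[OF that] by (simp add: Q_def)
      show "CN * (E * s) * n * exp (CN * (aN * s) * n) < RN" using bd E(2) by linarith
    qed (use u0 sg'(2) s pos E(1) in auto)
    then obtain z where uN: "u n \<in> carrier N" and z: "norm z \<le> E * MN" "inv\<^bsub>N\<^esub> (d (n * s)) \<otimes>\<^bsub>N\<^esub> u n = ptN z"
      using bd by (meson order_trans)
    \<comment> \<open>Inverting in H applies \<pi> of the inverse of c to the quotient in N. These
      maps are equicontinuous at the identity along c([0, T]), which is what \<delta>I
      records.\<close>
    have zI: "norm z < \<delta>I" using z E by linarith
    have nm: "real n * s \<in> {0..T}" using ks by simp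
    have "c (n * s) \<otimes>\<^bsub>G\<^esub> ptG 0 = c (n * s)" using cc[OF nm] by (simp add: G.pt_0)
    then obtain z' where z': "norm z' < \<epsilon>" "\<pi> (inv\<^bsub>G\<^esub> (c (n * s))) (ptN z) = ptN z'"
      using \<delta>I(2)[OF nm, of 0 z] \<delta>I(1) zI by auto
    obtain w where w: "norm w < \<rho>" "inv\<^bsub>G\<^esub> (c (n * s)) \<otimes>\<^bsub>G\<^esub> (b s [^]\<^bsub>G\<^esub> n) = ptG w" using Gk[of n] by auto
    show "u n \<in> carrier N" by (rule uN)
    show "b s \<in> carrier G" by (rule bG)
    show "\<exists>z w. norm z < \<epsilon> \<and> norm w < \<epsilon> \<and> inv\<^bsub>G\<^esub> (c (n * s)) \<otimes>\<^bsub>G\<^esub> (b s [^]\<^bsub>G\<^esub> n) = ptG w \<and>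
      \<pi> (inv\<^bsub>G\<^esub> (c (n * s))) (inv\<^bsub>N\<^esub> (d (n * s)) \<otimes>\<^bsub>N\<^esub> u n) = ptN z"
      using z z' w \<rho>(3) by (intro exI[of _ z'] exI[of _ w]) auto
  qed
qed

lemma ld_semigroup_scale:
  assumes sg: "ld_semigroup y x c d" and "0 \<le> t" "0 \<le> s" "S \<subseteq> {0..}"
  shows "has_ld G ptG (\<lambda>s. c (t * s)) (t *\<^sub>R y) s S" "has_ld N ptN (\<lambda>s. d (t * s)) (L (c (t * s)) (t *\<^sub>R x)) s S"
proof -
  note sg' = ld_semigroupD[OF sg]
  have ts: "0 \<le> t * s" using assms by simp
  show "has_ld G ptG (\<lambda>s. c (t * s)) (t *\<^sub>R y) s S"
    using assms sg'(3,5)[OF ts] by (intro G.has_ld_scale) auto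
  have "L (c (t * s)) (t *\<^sub>R x) = t *\<^sub>R L (c (t * s)) x"
    using L_linear[OF sg'(3)[OF ts]] by (simp add: linear_cmul)
  moreover have "has_ld N ptN (\<lambda>s. d (t * s)) (t *\<^sub>R L (c (t * s)) x) s S"
    using assms sg'(4,6)[OF ts] by (intro N.has_ld_scale) auto
  ultimately show "has_ld N ptN (\<lambda>s. d (t * s)) (L (c (t * s)) (t *\<^sub>R x)) s S" by simp
qed

text \<open>This makes the exponential well defined at t (x, y): a solution on [0, 1] must be s ->
  (d (t s), c (t s)). The G-component is identified first, because the equation for d' contains
  c'.\<close>

lemma ld_semigroup_unique:
  assumes sg: "ld_semigroup y x c d" and "0 \<le> t" and init: "c' 0 = \<one>\<^bsub>G\<^esub>" "d' 0 = \<one>\<^bsub>N\<^esub>"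
    and cl: "\<And>s. s \<in> {0..1} \<Longrightarrow> c' s \<in> carrier G \<and> d' s \<in> carrier N"
    and c': "\<And>s. s \<in> {0..1} \<Longrightarrow> has_ld G ptG c' (t *\<^sub>R y) s {0..1}"
    and d': "\<And>s. s \<in> {0..1} \<Longrightarrow> has_ld N ptN d' (L (c' s) (t *\<^sub>R x)) s {0..1}"
  shows "c' 1 = c t" "d' 1 = d t"
proof -
  note sg' = ld_semigroupD[OF sg]
  have ceq: "c' r = c (t * r)" if r: "r \<in> {0..1}" for r
  proof (rule G.ld_unique[where a = 0 and b = r and \<xi> = "\<lambda>_. t *\<^sub>R y" and d = "\<lambda>s. c (t * s)"])
    fix s assume "s \<in> {0..r}"
    then have s: "s \<in> {0..1}" "0 \<le> s" and sub: "{0..r} \<subseteq> {0..1}" using r by auto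
    show "c' s \<in> carrier G \<and> c (t * s) \<in> carrier G" using cl[OF s(1)] sg'(3) s \<open>0 \<le> t\<close> by simp
    show "has_ld G ptG c' (t *\<^sub>R y) s {0..r}" using c'[OF s(1)] sub by (rule has_ld_subset)
    show "has_ld G ptG (\<lambda>s. c (t * s)) (t *\<^sub>R y) s {0..r}"
      using ld_semigroup_scale(1)[OF sg \<open>0 \<le> t\<close> s(2)] by simp
  qed (use r init sg' in auto)
  show "c' 1 = c t" using ceq[of 1] by simp
  obtain A where A: "\<And>s. s \<in> {0..1} \<Longrightarrow> norm (L (c' s) (t *\<^sub>R x)) \<le> A"
    using L_bounded_on_curve[of 0 1 c' "\<lambda>_. t *\<^sub>R y"] cl c' by blast
  have "d' 1 = d (t * 1)"
  proof (rule N.ld_unique[where a = 0 and b = 1 and A = A and \<xi> = "\<lambda>s. L (c' s) (t *\<^sub>R x)" and d = "\<lambda>s. d (t * s)"])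
    fix s :: real assume s: "s \<in> {0..1}"
    show "d' s \<in> carrier N \<and> d (t * s) \<in> carrier N" using cl[OF s] sg'(4) s \<open>0 \<le> t\<close> by simp
    show "has_ld N ptN (\<lambda>s. d (t * s)) (L (c' s) (t *\<^sub>R x)) s {0..1}"
      using ld_semigroup_scale(2)[OF sg \<open>0 \<le> t\<close>, of s "{0..1}"] s ceq[OF s] by simp
  qed (use init sg' d' A in auto)
  then show "d' 1 = d t" by simp
qed

end

section \<open>Maps with Lipschitz derivative\<close>

text \<open>Local C^{1,1} regularity. The operator norm of a difference of derivatives is expressed
  by a bound for every vector v, which keeps derivatives as plain functions. The Lipschitz bound
  yields quadratic remainders with explicit constants, and the class is stable under
  composition.\<close>

definition c11_at :: "('a::real_normed_vector \<Rightarrow> 'b::real_normed_vector) \<Rightarrow> 'a \<Rightarrow> bool" where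
  "c11_at f x \<longleftrightarrow> (\<exists>r>0. \<exists>C\<ge>0. \<exists>D. (\<forall>y. norm (y - x) < r \<longrightarrow> (f has_derivative D y) (at y)) \<and>
     (\<forall>y z v. norm (y - x) < r \<longrightarrow> norm (z - x) < r \<longrightarrow> norm (D y v - D z v) \<le> C * norm (y - z) * norm v))"

lemma c11_atE:
  assumes "c11_at f x" "0 < \<rho>"
  obtains r C D where "0 < r" "r \<le> \<rho>" "0 \<le> C"
    "\<And>y. norm (y - x) < r \<Longrightarrow> (f has_derivative D y) (at y)"
    "\<And>y z v. norm (y - x) < r \<Longrightarrow> norm (z - x) < r \<Longrightarrow> norm (D y v - D z v) \<le> C * norm (y - z) * norm v"
    "\<And>y v. norm (y - x) < r \<Longrightarrow> norm (D y v) \<le> C * norm v"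
    "\<And>y z. norm (y - x) < r \<Longrightarrow> norm (z - x) < r \<Longrightarrow> norm (f y - f z) \<le> C * norm (y - z)"
proof -
  obtain r0 C0 D where r0: "0 < r0" "0 \<le> C0"
    and D: "\<And>y. norm (y - x) < r0 \<Longrightarrow> (f has_derivative D y) (at y)"
    and lip: "\<And>y z v. norm (y - x) < r0 \<Longrightarrow> norm (z - x) < r0 \<Longrightarrow> norm (D y v - D z v) \<le> C0 * norm (y - z) * norm v"
    using assms(1) unfolding c11_at_def by blast
  obtain K where K: "0 < K" "\<And>v. norm (D x v) \<le> norm v * K"
    using bounded_linear.pos_bounded[OF has_derivative_bounded_linear[OF D[of x]]] r0 by auto
  define r where "r = min r0 \<rho>"
  \<comment> \<open>One constant for all bounds: C0 is the Lipschitz constant of D, K bounds D at x,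
    and C0 r bounds the variation of D from its value at x.\<close>
  define C where "C = C0 + K + C0 * r"
  have r: "0 < r" "r \<le> r0" "r \<le> \<rho>" using r0 assms by (auto simp: r_def)
  have C: "0 \<le> C" "C0 \<le> C" using r0 r K by (auto simp: C_def)
  have Db: "norm (D y v) \<le> C * norm v" if y: "norm (y - x) < r" for y v
  proof -
    have "norm (D y v - D x v) \<le> C0 * norm (y - x) * norm v" using y r by (intro lip) auto
    also have "\<dots> \<le> C0 * r * norm v" using y r0 by (intro mult_right_mono mult_left_mono) auto
    finally have "norm (D y v) \<le> norm v * K + C0 * r * norm v"
      using K(2)[of v] norm_triangle_ineq[of "D y v - D x v" "D x v"] by simp
    also have "\<dots> \<le> C * norm v" using r0 by (simp add: C_def algebra_simps)
    finally show ?thesis .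
  qed
  have fl: "norm (f y - f z) \<le> C * norm (y - z)" if "norm (y - x) < r" "norm (z - x) < r" for y z
  proof (rule differentiable_bound[where S = "ball x r"])
    show "(f has_derivative D w) (at w within ball x r)" if "w \<in> ball x r" for w
      using D[of w] that r by (auto simp: dist_norm norm_minus_commute intro: has_derivative_at_withinI)
    show "onorm (D w) \<le> C" if "w \<in> ball x r" for w
      using Db[of w] that C by (intro onorm_bound) (auto simp: dist_norm norm_minus_commute)
  qed (use that in \<open>auto simp: dist_norm norm_minus_commute\<close>)
  show thesis
  proof (rule that[OF r(1,3) C(1)])
    fix y z v assume "norm (y - x) < r" "norm (z - x) < r"
    then have "norm (D y v - D z v) \<le> C0 * norm (y - z) * norm v" using r by (intro lip) auto
    also have "\<dots> \<le> C * norm (y - z) * norm v" using C by (intro mult_right_mono) auto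
    finally show "norm (D y v - D z v) \<le> C * norm (y - z) * norm v" .
  qed (use D Db fl r in auto)
qed

lemma c11_at_differentiable: "c11_at f x \<Longrightarrow> (f has_derivative frechet_derivative f (at x)) (at x)"
proof (erule c11_atE[OF _ zero_less_one])
  fix r :: real and D
  assume "0 < r" and D: "\<And>y. norm (y - x) < r \<Longrightarrow> (f has_derivative D y) (at y)"
  then have "f differentiable (at x)" using D[of x] by (intro differentiableI[of f "D x"]) simp
  then show ?thesis by (simp add: frechet_derivative_works)
qed

lemma c11_at_cong:
  assumes f: "c11_at f x" and S: "open S" "x \<in> S" "\<And>y. y \<in> S \<Longrightarrow> g y = f y"
  shows "c11_at g x"
proof -
  obtain \<rho> where \<rho>: "\<rho> > 0" "ball x \<rho> \<subseteq> S" using S(1,2) open_contains_ball by blast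
  obtain r C D where r: "0 < r" "r \<le> \<rho>" "0 \<le> C"
    and D: "\<And>y. norm (y - x) < r \<Longrightarrow> (f has_derivative D y) (at y)"
    and lip: "\<And>y z v. norm (y - x) < r \<Longrightarrow> norm (z - x) < r \<Longrightarrow> norm (D y v - D z v) \<le> C * norm (y - z) * norm v"
    by (rule c11_atE[OF f \<rho>(1)]) blast
  have "(g has_derivative D y) (at y)" if "norm (y - x) < r" for y
  proof (rule has_derivative_transform_within_open[OF D[OF that] S(1)])
    show "y \<in> S" using that r \<rho> by (auto simp: dist_norm norm_minus_commute subset_iff)
  qed (use S in auto)
  then show ?thesis unfolding c11_at_def using r lip by blast
qed

lemma c11_at_bounded_linear:
  assumes "bounded_linear f"
  shows "c11_at f x"
  unfolding c11_at_def
  by (rule exI[of _ 1], rule conjI[OF zero_less_one], rule exI[of _ 0], rule conjI, simp, rule exI[of _ "\<lambda>_. f"])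
     (use bounded_linear.has_derivative[OF assms has_derivative_ident] in auto)

lemma c11_at_add_const:
  assumes "c11_at f x"
  shows "c11_at (\<lambda>y. f y + c) x"
proof -
  obtain r C D where "0 < r" "0 \<le> C"
    and D: "\<And>y. norm (y - x) < r \<Longrightarrow> (f has_derivative D y) (at y)"
    and lip: "\<And>y z v. norm (y - x) < r \<Longrightarrow> norm (z - x) < r \<Longrightarrow> norm (D y v - D z v) \<le> C * norm (y - z) * norm v"
    using assms unfolding c11_at_def by blast
  moreover have "((\<lambda>y. f y + c) has_derivative D y) (at y)" if "norm (y - x) < r" for y
    using D[OF that] by (auto intro!: derivative_eq_intros)
  ultimately show ?thesis unfolding c11_at_def by blast
qed

lemma c11_at_Pair:
  assumes "c11_at f x" "c11_at g x"
  shows "c11_at (\<lambda>y. (f y, g y)) x"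
proof -
  obtain r C D where f: "0 < r" "0 \<le> C" "\<And>y. norm (y - x) < r \<Longrightarrow> (f has_derivative D y) (at y)"
    "\<And>y z v. norm (y - x) < r \<Longrightarrow> norm (z - x) < r \<Longrightarrow> norm (D y v - D z v) \<le> C * norm (y - z) * norm v"
    using assms(1) unfolding c11_at_def by blast
  obtain r' C' D' where g: "0 < r'" "0 \<le> C'" "\<And>y. norm (y - x) < r' \<Longrightarrow> (g has_derivative D' y) (at y)"
    "\<And>y z v. norm (y - x) < r' \<Longrightarrow> norm (z - x) < r' \<Longrightarrow> norm (D' y v - D' z v) \<le> C' * norm (y - z) * norm v"
    using assms(2) unfolding c11_at_def by blast
  show ?thesis unfolding c11_at_def
  proof (rule exI[of _ "min r r'"], rule conjI, use f g in simp, rule exI[of _ "C + C'"], rule conjI, use f g in simp,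
      rule exI[of _ "\<lambda>y v. (D y v, D' y v)"], intro conjI allI impI)
    show "((\<lambda>y. (f y, g y)) has_derivative (\<lambda>v. (D y v, D' y v))) (at y)" if "norm (y - x) < min r r'" for y
      using f(3)[of y] g(3)[of y] that by (auto intro: has_derivative_Pair)
    fix y z v assume yz: "norm (y - x) < min r r'" "norm (z - x) < min r r'"
    have "norm ((D y v, D' y v) - (D z v, D' z v)) \<le> norm (D y v - D z v) + norm (D' y v - D' z v)"
      using norm_Pair_le[of "D y v - D z v" "D' y v - D' z v"] by simp
    also have "\<dots> \<le> C * norm (y - z) * norm v + C' * norm (y - z) * norm v"
      using yz by (intro add_mono f g) auto
    finally show "norm ((D y v, D' y v) - (D z v, D' z v)) \<le> (C + C') * norm (y - z) * norm v"
      by (simp add: algebra_simps)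
  qed
qed

lemma c11_at_compose:
  assumes f: "c11_at f x" and g: "c11_at g w" and w: "f x = w"
  shows "c11_at (\<lambda>y. g (f y)) x"
proof -
  have "c11_at g (f x)" using g w by simp
  note g = this
  obtain r' C' D' where g: "0 < r'" "0 \<le> C'" "\<And>y. norm (y - f x) < r' \<Longrightarrow> (g has_derivative D' y) (at y)"
    "\<And>y z v. norm (y - f x) < r' \<Longrightarrow> norm (z - f x) < r' \<Longrightarrow> norm (D' y v - D' z v) \<le> C' * norm (y - z) * norm v"
    "\<And>y v. norm (y - f x) < r' \<Longrightarrow> norm (D' y v) \<le> C' * norm v"
    by (rule c11_atE[OF g zero_less_one]) blast
  obtain r0 C D where r0: "0 < r0" and f: "0 \<le> C" "\<And>y. norm (y - x) < r0 \<Longrightarrow> (f has_derivative D y) (at y)"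
    "\<And>y z v. norm (y - x) < r0 \<Longrightarrow> norm (z - x) < r0 \<Longrightarrow> norm (D y v - D z v) \<le> C * norm (y - z) * norm v"
    "\<And>y v. norm (y - x) < r0 \<Longrightarrow> norm (D y v) \<le> C * norm v"
    "\<And>y z. norm (y - x) < r0 \<Longrightarrow> norm (z - x) < r0 \<Longrightarrow> norm (f y - f z) \<le> C * norm (y - z)"
    by (rule c11_atE[OF f zero_less_one]) blast
  define r where "r = min r0 (r' / (C + 1))"
  have r: "0 < r" "r \<le> r0" using r0 g f by (auto simp: r_def)
  have fx: "norm (f y - f x) < r'" if "norm (y - x) < r" for y
  proof -
    have "norm (f y - f x) \<le> C * norm (y - x)" using that r by (intro f) auto
    also have "\<dots> \<le> (C + 1) * norm (y - x)" by (intro mult_right_mono) auto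
    also have "\<dots> < r'" using that f(1) by (simp add: r_def field_simps)
    finally show ?thesis .
  qed
  show ?thesis unfolding c11_at_def
  \<comment> \<open>The constant has two summands because the difference of the composed derivatives
    is split into a change of the base point of D' and a change of its argument.\<close>
  proof (rule exI[of _ r], rule conjI[OF r(1)], rule exI[of _ "C' * C * C + C' * C"], rule conjI, use f g in simp,
      rule exI[of _ "\<lambda>y v. D' (f y) (D y v)"], intro conjI allI impI)
    show "((\<lambda>y. g (f y)) has_derivative (\<lambda>v. D' (f y) (D y v))) (at y)" if "norm (y - x) < r" for y
      using has_derivative_compose[OF f(2) g(3)[OF fx[OF that]]] that r by auto
    fix y z v assume yz: "norm (y - x) < r" "norm (z - x) < r"
    then have yz0: "norm (y - x) < r0" "norm (z - x) < r0" using r by auto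
    have lin: "D' (f z) (D y v) - D' (f z) (D z v) = D' (f z) (D y v - D z v)"
      using has_derivative_linear[OF g(3)[OF fx[OF yz(2)]]] by (simp add: linear_diff)
    have "norm (D' (f y) (D y v) - D' (f z) (D y v)) \<le> C' * norm (f y - f z) * norm (D y v)"
      by (intro g fx yz)
    also have "\<dots> \<le> C' * (C * norm (y - z)) * (C * norm v)"
      using f(4)[OF yz0(1), of v] f(5)[OF yz0] g(2) f(1) by (intro mult_mono mult_left_mono) auto
    finally have 1: "norm (D' (f y) (D y v) - D' (f z) (D y v)) \<le> C' * C * C * norm (y - z) * norm v"
      by (simp add: mult_ac)
    have "norm (D' (f z) (D y v - D z v)) \<le> C' * norm (D y v - D z v)" by (intro g fx yz)
    also have "\<dots> \<le> C' * (C * norm (y - z) * norm v)" using f(3)[OF yz0, of v] g(2) by (intro mult_left_mono) auto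
    finally have 2: "norm (D' (f z) (D y v) - D' (f z) (D z v)) \<le> C' * C * norm (y - z) * norm v"
      unfolding lin by (simp add: mult_ac)
    have "D' (f y) (D y v) - D' (f z) (D z v) = (D' (f y) (D y v) - D' (f z) (D y v)) + (D' (f z) (D y v) - D' (f z) (D z v))"
      by simp
    also have "norm \<dots> \<le> C' * C * C * norm (y - z) * norm v + C' * C * norm (y - z) * norm v"
      by (rule norm_triangle_mono[OF 1 2])
    finally show "norm (D' (f y) (D y v) - D' (f z) (D z v)) \<le> (C' * C * C + C' * C) * norm (y - z) * norm v"
      by (simp add: algebra_simps)
  qed
qed

text \<open>A local bound for D 2 makes D 1 Lipschitz, by the mean value inequality. That bound
  comes from differentiability of D 2 at the single point x, with \<epsilon> = 1: near x, D 2 y is D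
  2 x plus D 3 x applied to y - x, up to |y - x|.\<close>

lemma smooth_on_c11:
  assumes "smooth_on U f" "x \<in> U"
  shows "c11_at f x"
proof -
  obtain D :: "nat \<Rightarrow> 'a \<Rightarrow> 'a list \<Rightarrow> 'b" where "open U" and
    D: "(\<forall>x\<in>U. D 0 x [] = f x) \<and> (\<forall>k. \<forall>x\<in>U. bounded_multilinear k (D k x)) \<and>
        (\<forall>k. \<forall>x\<in>U. \<forall>\<epsilon>>0. \<exists>\<delta>>0. \<forall>y\<in>U. norm (y - x) < \<delta> \<longrightarrow>
           (\<forall>vs. length vs = k \<longrightarrow> norm (D k y vs - D k x vs - D (Suc k) x ((y - x) # vs))
                \<le> \<epsilon> * norm (y - x) * (\<Prod>v\<leftarrow>vs. norm v)))"
    using assms(1) unfolding smooth_on_def by (elim conjE exE) (rule that, assumption, intro conjI, assumption+)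
  note D0 = D[THEN conjunct1, rule_format]
  note ml = D[THEN conjunct2, THEN conjunct1, rule_format]
  note dd = D[THEN conjunct2, THEN conjunct2, rule_format]
  have bnd: "\<exists>C\<ge>0. \<forall>vs. length vs = k \<longrightarrow> norm (D k x vs) \<le> C * (\<Prod>v\<leftarrow>vs. norm v)" if x: "x \<in> U" for k x
  proof -
    obtain C where C: "\<And>vs. length vs = k \<Longrightarrow> norm (D k x vs) \<le> C * (\<Prod>v\<leftarrow>vs. norm v)"
      using ml[OF x, of k] unfolding bounded_multilinear_def by blast
    have p: "0 \<le> (\<Prod>v\<leftarrow>vs. norm v)" for vs :: "'a list" by (induction vs) auto
    have "norm (D k x vs) \<le> \<bar>C\<bar> * (\<Prod>v\<leftarrow>vs. norm v)" if "length vs = k" for vs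
      using C[OF that] mult_right_mono[OF abs_ge_self p, of C vs] by linarith
    then show ?thesis by (intro exI[of _ "\<bar>C\<bar>"]) auto
  qed
  have linear1: "bounded_linear (\<lambda>h. D (Suc k) x (h # vs))" if x: "x \<in> U" and "length vs = k" for x k vs
  proof -
    have "\<forall>vs i. length vs = Suc k \<longrightarrow> i < Suc k \<longrightarrow> linear (\<lambda>v. D (Suc k) x (vs[i := v]))"
      using ml[OF x, of "Suc k"] unfolding bounded_multilinear_def by (rule conjunct1)
    from this[rule_format, of "0 # vs" 0] have l: "linear (\<lambda>h. D (Suc k) x (h # vs))" using that(2) by simp
    obtain C where C: "\<And>us. length us = Suc k \<Longrightarrow> norm (D (Suc k) x us) \<le> C * (\<Prod>v\<leftarrow>us. norm v)"
      using bnd[OF x, of "Suc k"] by blast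
    have "norm (D (Suc k) x (h # vs)) \<le> norm h * (C * (\<Prod>v\<leftarrow>vs. norm v))" for h
      using that(2) C[of "h # vs"] by (simp add: mult_ac)
    then show ?thesis
      by (intro bounded_linear_intro[where K = "C * (\<Prod>v\<leftarrow>vs. norm v)"] linear_add[OF l] linear_cmul[OF l])
  qed
  have deriv: "((\<lambda>y. D k y vs) has_derivative (\<lambda>h. D (Suc k) x (h # vs))) (at x)" if x: "x \<in> U" and vs: "length vs = k" for x k vs
    unfolding has_derivative_at_alt
  proof (intro conjI linear1[OF x vs] allI impI)
    fix e :: real assume "e > 0"
    define P where "P = (\<Prod>v\<leftarrow>vs. norm v)"
    have P: "0 \<le> P" unfolding P_def by (induction vs) auto
    have "e / (P + 1) > 0" using P \<open>e > 0\<close> by simp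
    then obtain \<delta> where \<delta>: "\<delta> > 0" "\<And>y. y \<in> U \<Longrightarrow> norm (y - x) < \<delta> \<Longrightarrow>
        norm (D k y vs - D k x vs - D (Suc k) x ((y - x) # vs)) \<le> e / (P + 1) * norm (y - x) * P"
      using dd[OF x, of "e / (P + 1)" k] vs unfolding P_def by blast
    obtain r where r: "r > 0" "ball x r \<subseteq> U" using \<open>open U\<close> x open_contains_ball by blast
    show "\<exists>d>0. \<forall>y. norm (y - x) < d \<longrightarrow> norm (D k y vs - D k x vs - D (Suc k) x ((y - x) # vs)) \<le> e * norm (y - x)"
    proof (intro exI[of _ "min \<delta> r"] conjI allI impI)
      fix y assume y: "norm (y - x) < min \<delta> r"
      then have "y \<in> U" using r by (auto simp: dist_norm norm_minus_commute subset_iff)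
      then have "norm (D k y vs - D k x vs - D (Suc k) x ((y - x) # vs)) \<le> e / (P + 1) * norm (y - x) * P"
        using \<delta>(2) y by auto
      also have "\<dots> = (e * norm (y - x)) * (P / (P + 1))" by simp
      also have "\<dots> \<le> (e * norm (y - x)) * 1" using P \<open>e > 0\<close> by (intro mult_left_mono) auto
      finally show "norm (D k y vs - D k x vs - D (Suc k) x ((y - x) # vs)) \<le> e * norm (y - x)" by simp
    qed (use \<delta> r in auto)
  qed
  obtain r0 where r0: "r0 > 0" "ball x r0 \<subseteq> U" using \<open>open U\<close> assms(2) open_contains_ball by blast
  obtain \<delta> where \<delta>: "\<delta> > 0" "\<And>y vs. y \<in> U \<Longrightarrow> norm (y - x) < \<delta> \<Longrightarrow> length vs = 2 \<Longrightarrow>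
      norm (D 2 y vs - D 2 x vs - D (Suc 2) x ((y - x) # vs)) \<le> 1 * norm (y - x) * (\<Prod>v\<leftarrow>vs. norm v)"
    using dd[OF assms(2) zero_less_one, of 2] by blast
  obtain C2 where C2: "C2 \<ge> 0" "\<And>vs. length vs = 2 \<Longrightarrow> norm (D 2 x vs) \<le> C2 * (\<Prod>v\<leftarrow>vs. norm v)"
    using bnd[OF assms(2), of 2] by blast
  obtain C3 where C3: "C3 \<ge> 0" "\<And>vs. length vs = 3 \<Longrightarrow> norm (D 3 x vs) \<le> C3 * (\<Prod>v\<leftarrow>vs. norm v)"
    using bnd[OF assms(2), of 3] by blast
  define r where "r = min r0 \<delta>"
  define K where "K = r + C2 + C3 * r"
  have r: "r > 0" "r \<le> r0" "r \<le> \<delta>" using r0 \<delta> by (auto simp: r_def)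
  have K: "K \<ge> 0" using r C2 C3 by (simp add: K_def)
  have inU: "y \<in> U" if "norm (y - x) < r" for y using that r r0 by (auto simp: dist_norm norm_minus_commute subset_iff)
  have D2: "norm (D 2 y [h, v]) \<le> K * norm v * norm h" if y: "norm (y - x) < r" for y h v
  proof -
    have yr: "norm (y - x) \<le> r" using y by simp
    have "norm (D 2 y [h, v] - D 2 x [h, v] - D 3 x [y - x, h, v]) \<le> norm (y - x) * (norm h * norm v)"
      using \<delta>(2)[OF inU[OF y], of "[h, v]"] y r by (simp add: eval_nat_numeral)
    also have "\<dots> \<le> r * (norm h * norm v)" using yr by (intro mult_right_mono) auto
    finally have 1: "norm (D 2 y [h, v] - D 2 x [h, v] - D 3 x [y - x, h, v]) \<le> r * (norm h * norm v)" .
    have 2: "norm (D 2 x [h, v]) \<le> C2 * (norm h * norm v)" using C2(2)[of "[h, v]"] by simp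
    have "norm (D 3 x [y - x, h, v]) \<le> C3 * (norm (y - x) * (norm h * norm v))" using C3(2)[of "[y - x, h, v]"] by simp
    also have "\<dots> \<le> C3 * (r * (norm h * norm v))" using yr C3 by (intro mult_left_mono mult_right_mono) auto
    finally have 3: "norm (D 3 x [y - x, h, v]) \<le> C3 * (r * (norm h * norm v))" .
    have "D 2 y [h, v] = (D 2 y [h, v] - D 2 x [h, v] - D 3 x [y - x, h, v]) + (D 2 x [h, v] + D 3 x [y - x, h, v])" by simp
    also have "norm \<dots> \<le> r * (norm h * norm v) + (C2 * (norm h * norm v) + C3 * (r * (norm h * norm v)))"
      by (intro norm_triangle_mono 1 2 3)
    also have "\<dots> = K * norm v * norm h" by (simp add: K_def algebra_simps)
    finally show ?thesis .
  qed
  show ?thesis unfolding c11_at_def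
  proof (rule exI[of _ r], rule conjI[OF r(1)], rule exI[of _ K], rule conjI[OF K], rule exI[of _ "\<lambda>y v. D 1 y [v]"],
      intro conjI allI impI)
    fix y assume y: "norm (y - x) < r"
    have "((\<lambda>y. D 0 y []) has_derivative (\<lambda>h. D 1 y [h])) (at y)" using deriv[OF inU[OF y], of "[]" 0] by simp
    then show "(f has_derivative (\<lambda>v. D 1 y [v])) (at y)"
      by (rule has_derivative_transform_within_open[OF _ \<open>open U\<close> inU[OF y]]) (simp add: D0)
  next
    fix y z v assume yz: "norm (y - x) < r" "norm (z - x) < r"
    have "norm (D 1 y [v] - D 1 z [v]) \<le> (K * norm v) * norm (y - z)"
    proof (rule differentiable_bound[where S = "ball x r"])
      fix w assume "w \<in> ball x r"
      then have w: "norm (w - x) < r" by (simp add: dist_norm norm_minus_commute)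
      show "((\<lambda>y. D 1 y [v]) has_derivative (\<lambda>h. D 2 w [h, v])) (at w within ball x r)"
        using deriv[OF inU[OF w], of "[v]" 1] by (auto simp: eval_nat_numeral intro: has_derivative_at_withinI)
      show "onorm (\<lambda>h. D 2 w [h, v]) \<le> K * norm v"
        using D2[OF w] K by (intro onorm_bound) auto
    qed (use yz in \<open>auto simp: dist_norm norm_minus_commute\<close>)
    then show "norm (D 1 y [v] - D 1 z [v]) \<le> K * norm (y - z) * norm v" by (simp add: mult_ac)
  qed
qed

lemma c11_at_const: "c11_at (\<lambda>_. a) x"
  using c11_at_add_const[OF c11_at_bounded_linear[OF bounded_linear_zero], of a x] by simp

section \<open>Charts of a Banach--Lie group\<close>

lemma chart_facts:
  assumes "banach_manifold M" "(U, \<phi>) \<in> atlas M"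
  shows "openin (topol M) U" "open (\<phi> ` U)" "U \<subseteq> topspace (topol M)" "inj_on \<phi> U"
    "homeomorphic_map (subtopology (topol M) U) (top_of_set (\<phi> ` U)) \<phi>"
proof -
  have "\<forall>(U, \<phi>)\<in>atlas M. openin (topol M) U \<and> open (\<phi> ` U) \<and>
        homeomorphic_map (subtopology (topol M) U) (top_of_set (\<phi> ` U)) \<phi>"
    using assms(1) unfolding banach_manifold_def by blast
  then show *: "openin (topol M) U" "open (\<phi> ` U)"
    "homeomorphic_map (subtopology (topol M) U) (top_of_set (\<phi> ` U)) \<phi>" using assms(2) by auto
  show "U \<subseteq> topspace (topol M)" using *(1) openin_subset by blast
  then show "inj_on \<phi> U" using homeomorphic_imp_injective_map[OF *(3)] by (simp add: Int_absorb1)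
qed

lemma chart_at:
  assumes "banach_manifold M" "p \<in> topspace (topol M)"
  shows "\<exists>U \<phi>. (U, \<phi>) \<in> atlas M \<and> p \<in> U"
  using assms unfolding banach_manifold_def by auto

lemma chart_image_open:
  assumes M: "banach_manifold M" "(U, \<phi>) \<in> atlas M" and W: "openin (topol M) W" "W \<subseteq> U"
  shows "open (\<phi> ` W)"
proof -
  have "openin (subtopology (topol M) U) W" using W by (auto simp: openin_subtopology)
  then have "openin (top_of_set (\<phi> ` U)) (\<phi> ` W)"
    using homeomorphic_imp_open_map[OF chart_facts(5)[OF M]] unfolding open_map_def by blast
  then show ?thesis using chart_facts(2)[OF M] openin_open_trans by blast
qed

lemma chart_vimage_open:
  assumes M: "banach_manifold M" "(U, \<phi>) \<in> atlas M" and "open B"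
  shows "openin (topol M) {x \<in> U. \<phi> x \<in> B}"
proof -
  have "openin (subtopology (topol M) U) {x \<in> topspace (subtopology (topol M) U). \<phi> x \<in> \<phi> ` U \<inter> B}"
    using homeomorphic_imp_continuous_map[OF chart_facts(5)[OF M]] \<open>open B\<close>
    by (intro openin_continuous_map_preimage) (auto simp: openin_open)
  moreover have "{x \<in> topspace (subtopology (topol M) U). \<phi> x \<in> \<phi> ` U \<inter> B} = {x \<in> U. \<phi> x \<in> B}"
    using chart_facts(3)[OF M] by auto
  ultimately show ?thesis using chart_facts(1)[OF M] openin_trans_full by metis
qed

lemma smooth_map_c11:
  assumes "smooth_map M M' f" "(U, \<phi>) \<in> atlas M" "(V, \<psi>) \<in> atlas M'" "a \<in> U" "f a \<in> V"
  shows "c11_at (\<lambda>x. \<psi> (f (inv_into U \<phi> x))) (\<phi> a)"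
proof -
  have "\<forall>(U, \<phi>)\<in>atlas M. \<forall>(V, \<psi>)\<in>atlas M'. smooth_on (\<phi> ` (U \<inter> f -` V)) (\<psi> \<circ> f \<circ> inv_into U \<phi>)"
    using assms(1) unfolding smooth_map_def by blast
  then have "smooth_on (\<phi> ` (U \<inter> f -` V)) (\<psi> \<circ> f \<circ> inv_into U \<phi>)" using assms(2,3) by auto
  from smooth_on_c11[OF this, of "\<phi> a"] show ?thesis using assms(4,5) by (simp add: o_def)
qed

lemma inv_into_map_prod:
  assumes "inj_on \<phi> U" "inj_on \<psi> V" "x \<in> \<phi> ` U" "y \<in> \<psi> ` V"
  shows "inv_into (U \<times> V) (map_prod \<phi> \<psi>) (x, y) = (inv_into U \<phi> x, inv_into V \<psi> y)"
  using assms by (intro inv_into_f_eq map_prod_inj_on) (auto simp: f_inv_into_f inv_into_into)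

lemma prod_chart: "(U, \<phi>) \<in> atlas M \<Longrightarrow> (V, \<psi>) \<in> atlas M' \<Longrightarrow>
    (U \<times> V, map_prod \<phi> \<psi>) \<in> atlas (prod_manifold M M')"
  unfolding prod_manifold_def by auto

text \<open>The inverse of a product chart is known to split into the two inverses on the image of
  the chart; that image is open, so \<open>c11_at_cong\<close> may restrict to it.\<close>

lemma smooth_map2_c11:
  assumes M: "banach_manifold M" "(U, \<phi>) \<in> atlas M" and M': "banach_manifold M'" "(V, \<psi>) \<in> atlas M'"
    and f: "smooth_map (prod_manifold M M') M2 (\<lambda>(x, y). f x y)" "(W, \<omega>) \<in> atlas M2"
    and ab: "a \<in> U" "b \<in> V" "f a b \<in> W"
  shows "c11_at (\<lambda>p. \<omega> (f (inv_into U \<phi> (fst p)) (inv_into V \<psi> (snd p)))) (\<phi> a, \<psi> b)"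
proof -
  have "c11_at (\<lambda>x. \<omega> ((\<lambda>(x, y). f x y) (inv_into (U \<times> V) (map_prod \<phi> \<psi>) x))) (map_prod \<phi> \<psi> (a, b))"
    by (rule smooth_map_c11[OF f(1) prod_chart[OF M(2) M'(2)] f(2)]) (use ab in auto)
  then have c: "c11_at (\<lambda>x. \<omega> ((\<lambda>(x, y). f x y) (inv_into (U \<times> V) (map_prod \<phi> \<psi>) x))) (\<phi> a, \<psi> b)"
    by simp
  show ?thesis
  proof (rule c11_at_cong[OF c, where S = "(\<phi> ` U) \<times> (\<psi> ` V)"])
    show "open (\<phi> ` U \<times> \<psi> ` V)" using chart_facts(2)[OF M] chart_facts(2)[OF M'] by (rule open_Times)
    fix y assume "y \<in> \<phi> ` U \<times> \<psi> ` V"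
    then show "\<omega> (f (inv_into U \<phi> (fst y)) (inv_into V \<psi> (snd y))) =
         \<omega> ((\<lambda>(x, y). f x y) (inv_into (U \<times> V) (map_prod \<phi> \<psi>) y))"
      using inv_into_map_prod[OF chart_facts(4)[OF M] chart_facts(4)[OF M'], of "fst y" "snd y"]
      by (simp add: mem_Times_iff)
  qed (use ab in auto)
qed

lemma continuous_map_prod_nbhd:
  assumes "continuous_map (prod_topology X Y) Z (\<lambda>(x, y). f x y)" "a \<in> topspace X" "b \<in> topspace Y"
    "openin Z W" "f a b \<in> W"
  shows "\<exists>A B. openin X A \<and> openin Y B \<and> a \<in> A \<and> b \<in> B \<and> (\<forall>x\<in>A. \<forall>y\<in>B. f x y \<in> W)"
proof -
  define S where "S = {p \<in> topspace (prod_topology X Y). (\<lambda>(x, y). f x y) p \<in> W}"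
  have o: "openin (prod_topology X Y) S"
    unfolding S_def by (rule openin_continuous_map_preimage[OF assms(1,4)])
  have i: "(a, b) \<in> S" using assms by (simp add: S_def)
  from openin_prod_topology_alt[THEN iffD1, rule_format, OF o i]
  obtain A B where AB: "openin X A" "openin Y B" "a \<in> A" "b \<in> B" "A \<times> B \<subseteq> S"
    by (elim exE conjE) (rule that)
  have "f x y \<in> W" if "x \<in> A" "y \<in> B" for x y using subsetD[OF AB(5), of "(x, y)"] that by (simp add: S_def)
  then show ?thesis using AB by blast
qed

section \<open>A chart at the identity\<close>

locale lie_chart =
  fixes G :: "('a, 'e::banach) manifold_group" (structure) and U :: "'a set" and \<phi> :: "'a \<Rightarrow> 'e"
  assumes lie: "banach_lie_group G" and chart: "(U, \<phi>) \<in> atlas (mfd G)" and one_U: "\<one> \<in> U"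
begin

sublocale group G
  using lie by (simp add: banach_lie_group_def)

lemma lie_facts:
  "banach_manifold (mfd G)" "topspace (topol (mfd G)) = carrier G"
  "smooth_map (prod_manifold (mfd G) (mfd G)) (mfd G) (\<lambda>(x, y). x \<otimes> y)"
  "smooth_map (mfd G) (mfd G) (\<lambda>x. inv x)"
  using lie by (auto simp: banach_lie_group_def)

lemma continuous_mult: "continuous_map (prod_topology (topol (mfd G)) (topol (mfd G))) (topol (mfd G)) (\<lambda>(x, y). x \<otimes> y)"
  using lie_facts(3) by (simp add: smooth_map_def prod_manifold_def)

lemma continuous_inv: "continuous_map (topol (mfd G)) (topol (mfd G)) (\<lambda>x. inv x)"
  using lie_facts(4) by (simp add: smooth_map_def)

lemmas chart_U = chart_facts[OF lie_facts(1) chart]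

definition pt :: "'e \<Rightarrow> 'a" where "pt v = inv_into U \<phi> (v + \<phi> \<one>)"

definition co :: "'a \<Rightarrow> 'e" where "co x = \<phi> x - \<phi> \<one>"

definition dom :: "'e set" where "dom = {v. v + \<phi> \<one> \<in> \<phi> ` U}"

lemma co_pt: "v \<in> dom \<Longrightarrow> co (pt v) = v"
  by (simp add: dom_def co_def pt_def f_inv_into_f)

lemma pt_in_U: "v \<in> dom \<Longrightarrow> pt v \<in> U"
  by (simp add: dom_def pt_def inv_into_into)

lemma pt_co: "x \<in> U \<Longrightarrow> pt (co x) = x"
  using chart_U(4) by (simp add: co_def pt_def)

lemma pt_zero: "pt 0 = \<one>"
  using chart_U(4) one_U by (simp add: pt_def)

lemma U_carrier: "x \<in> U \<Longrightarrow> x \<in> carrier G"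
  using chart_U(3) lie_facts(2) by auto

lemma pt_nbhd:
  assumes "openin (topol (mfd G)) W" "\<one> \<in> W"
  shows "\<exists>r>0. \<forall>v. norm v < r \<longrightarrow> v \<in> dom \<and> pt v \<in> W"
proof -
  have "open (\<phi> ` (W \<inter> U))"
    using assms chart_U(1) by (intro chart_image_open[OF lie_facts(1) chart]) auto
  moreover have "\<phi> \<one> \<in> \<phi> ` (W \<inter> U)" using assms one_U by auto
  ultimately obtain r where r: "r > 0" "ball (\<phi> \<one>) r \<subseteq> \<phi> ` (W \<inter> U)" using open_contains_ball by blast
  have "v \<in> dom \<and> pt v \<in> W" if "norm v < r" for v
  proof -
    have "v + \<phi> \<one> \<in> ball (\<phi> \<one>) r" using that by (simp add: dist_norm)
    then obtain x where "x \<in> W \<inter> U" "v + \<phi> \<one> = \<phi> x" using r by blast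
    then show ?thesis using chart_U(4) by (auto simp: dom_def pt_def)
  qed
  then show ?thesis using r by blast
qed

lemma pt_nbhd_at:
  assumes g: "g \<in> carrier G" and W: "openin (topol (mfd G)) W" "g \<in> W"
  shows "\<exists>r>0. \<forall>v. norm v < r \<longrightarrow> v \<in> dom \<and> g \<otimes> pt v \<in> W"
proof -
  obtain A B where "openin (topol (mfd G)) B" "g \<in> A" "\<one> \<in> B" "\<forall>x\<in>A. \<forall>y\<in>B. x \<otimes> y \<in> W"
    using continuous_map_prod_nbhd[OF continuous_mult, of g \<one> W] g W lie_facts(2) by auto
  moreover obtain r where "r > 0" "\<forall>v. norm v < r \<longrightarrow> v \<in> dom \<and> pt v \<in> B"
    using pt_nbhd calculation by blast
  ultimately show ?thesis by blast
qed

lemma openin_pt_ball: "openin (topol (mfd G)) {x \<in> U. norm (co x) < r}" (is ?open)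
  and one_pt_ball: "0 < r \<Longrightarrow> \<one> \<in> {x \<in> U. norm (co x) < r}"
proof -
  have "{x \<in> U. norm (co x) < r} = {x \<in> U. \<phi> x \<in> ball (\<phi> \<one>) r}"
    by (auto simp: co_def dist_norm norm_minus_commute)
  then show ?open using chart_vimage_open[OF lie_facts(1) chart open_ball] by simp
qed (use one_U in \<open>simp add: co_def\<close>)

lemma mult_c11:
  assumes "(V1, \<psi>1) \<in> atlas (mfd G)" "(V2, \<psi>2) \<in> atlas (mfd G)" "(V3, \<psi>3) \<in> atlas (mfd G)"
    "a \<in> V1" "b \<in> V2" "a \<otimes> b \<in> V3"
  shows "c11_at (\<lambda>p. \<psi>3 (inv_into V1 \<psi>1 (fst p) \<otimes> inv_into V2 \<psi>2 (snd p))) (\<psi>1 a, \<psi>2 b)"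
  by (rule smooth_map2_c11[OF lie_facts(1) assms(1) lie_facts(1) assms(2) lie_facts(3) assms(3-6)])

text \<open>The left factor is taken in an arbitrary chart, because the lemma also yields the
  derivative of left translation at points far from the identity.\<close>

lemma mult_pt_c11:
  assumes "(V1, \<psi>1) \<in> atlas (mfd G)" "(V3, \<psi>3) \<in> atlas (mfd G)" "a \<in> V1" "a \<in> V3"
  shows "c11_at (\<lambda>p. \<psi>3 (inv_into V1 \<psi>1 (fst p) \<otimes> pt (snd p))) (\<psi>1 a, 0)"
proof -
  have "a \<in> carrier G" using chart_facts(3)[OF lie_facts(1) assms(1)] lie_facts(2) assms(3) by auto
  then have "a \<otimes> \<one> \<in> V3" using assms by simp
  from mult_c11[OF assms(1) chart assms(2,3) one_U this]
  have 1: "c11_at (\<lambda>p. \<psi>3 (inv_into V1 \<psi>1 (fst p) \<otimes> inv_into U \<phi> (snd p))) (\<psi>1 a, \<phi> \<one>)" .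
  have 2: "c11_at (\<lambda>p::'e \<times> 'e. (fst p, snd p + \<phi> \<one>)) (\<psi>1 a, 0)"
    by (intro c11_at_Pair c11_at_add_const c11_at_bounded_linear bounded_linear_fst bounded_linear_snd)
  show ?thesis using c11_at_compose[OF 2 1] by (simp add: pt_def)
qed

lemma M_c11: "c11_at (\<lambda>p. co (pt (fst p) \<otimes> pt (snd p))) 0"
proof -
  have 1: "c11_at (\<lambda>p. \<phi> (inv_into U \<phi> (fst p) \<otimes> pt (snd p)) + (- \<phi> \<one>)) (\<phi> \<one>, 0)"
    by (rule c11_at_add_const[OF mult_pt_c11[OF chart chart one_U one_U]])
  have 2: "c11_at (\<lambda>p::'e \<times> 'e. (fst p + \<phi> \<one>, snd p)) (0, 0)"
    by (intro c11_at_Pair c11_at_add_const c11_at_bounded_linear bounded_linear_fst bounded_linear_snd)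
  show ?thesis using c11_at_compose[OF 2 1] by (simp add: pt_def[of "fst _"] co_def zero_prod_def)
qed

lemma I_c11: "c11_at (\<lambda>x. co (inv (pt x))) 0"
proof -
  have 1: "c11_at (\<lambda>x. \<phi> (inv (inv_into U \<phi> x)) + (- \<phi> \<one>)) (\<phi> \<one>)"
    using smooth_map_c11[OF lie_facts(4) chart chart one_U] one_U by (intro c11_at_add_const) simp
  have 2: "c11_at (\<lambda>x::'e. x + \<phi> \<one>) 0"
    by (intro c11_at_add_const c11_at_bounded_linear bounded_linear_ident)
  show ?thesis using c11_at_compose[OF 2 1] by (simp add: pt_def co_def)
qed

text \<open>\<open>\<Phi> (e, q, p)\<close> is the coordinate of \<open>pt(q)\<^sup>-\<^sup>1 pt(e) pt(p)\<close>; since \<open>\<Phi> (e, 0, 0) = e\<close> and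
  \<open>\<Phi> (0, q, q) = 0\<close>, a Lipschitz derivative gives the estimate \<open>conj_ex\<close> of \<open>lie_ball\<close>.\<close>

theorem lie_ball_ex: "\<exists>F R0 R C. lie_ball G pt F R0 R C \<and> (\<forall>v. norm v < R0 \<longrightarrow> v \<in> dom)"
proof -
  define m where "m p = co (pt (fst p) \<otimes> pt (snd p))" for p
  define i where "i x = co (inv (pt x))" for x
  obtain R0 where R0: "R0 > 0" "\<And>v. norm v < R0 \<Longrightarrow> v \<in> dom"
    using pt_nbhd[OF chart_U(1) one_U] by blast
  obtain A B where AB: "openin (topol (mfd G)) A" "openin (topol (mfd G)) B" "\<one> \<in> A" "\<one> \<in> B" "\<forall>x\<in>A. \<forall>y\<in>B. x \<otimes> y \<in> U"
    using continuous_map_prod_nbhd[OF continuous_mult, of \<one> \<one> U] chart_U(1) one_U lie_facts(2) by auto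
  obtain rM where rM: "rM > 0" "\<And>v. norm v < rM \<Longrightarrow> v \<in> dom \<and> pt v \<in> A \<inter> B"
    using pt_nbhd[of "A \<inter> B"] AB by auto
  have "openin (topol (mfd G)) {x \<in> topspace (topol (mfd G)). inv x \<in> U}"
    by (rule openin_continuous_map_preimage[OF continuous_inv chart_U(1)])
  then obtain rI where rI: "rI > 0" "\<And>v. norm v < rI \<Longrightarrow> v \<in> dom \<and> inv (pt v) \<in> U"
    using pt_nbhd[of "{x \<in> topspace (topol (mfd G)). inv x \<in> U}"] one_U lie_facts(2) by auto
  define \<rho> where "\<rho> = min R0 rM"
  have \<rho>: "\<rho> > 0" "\<rho> \<le> R0" "\<rho> \<le> rM" using R0 rM by (auto simp: \<rho>_def)
  have val: "pt x \<otimes> pt y \<in> U" "pt (m (x, y)) = pt x \<otimes> pt y" if "norm x < \<rho>" "norm y < \<rho>" for x y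
    using rM(2)[of x] rM(2)[of y] AB(5) that \<rho> by (auto simp: m_def pt_co)
  have "c11_at m 0" unfolding m_def by (rule M_c11)
  obtain rm Cm Dm where rm: "0 < rm" "0 \<le> Cm" and Dm: "\<And>y. norm (y - 0) < rm \<Longrightarrow> (m has_derivative Dm y) (at y)"
    "\<And>y z v. norm (y - 0) < rm \<Longrightarrow> norm (z - 0) < rm \<Longrightarrow> norm (Dm y v - Dm z v) \<le> Cm * norm (y - z) * norm v"
    and mL: "\<And>y z. norm (y - 0) < rm \<Longrightarrow> norm (z - 0) < rm \<Longrightarrow> norm (m y - m z) \<le> Cm * norm (y - z)"
    by (rule c11_atE[OF \<open>c11_at m 0\<close> zero_less_one]) blast
  have "c11_at i 0" unfolding i_def by (rule I_c11)
  obtain ri Ci where ri: "0 < ri" "0 \<le> Ci" and iL: "\<And>y z. norm (y - 0) < ri \<Longrightarrow> norm (z - 0) < ri \<Longrightarrow> norm (i y - i z) \<le> Ci * norm (y - z)"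
    by (rule c11_atE[OF \<open>c11_at i 0\<close> zero_less_one]) blast
  have m0: "m 0 = 0" and i0: "i 0 = 0" by (simp_all add: m_def i_def pt_zero co_def)
  define \<Phi> where "\<Phi> t = m (i (fst (snd t)), m (fst t, snd (snd t)))" for t
  have "c11_at \<Phi> 0"
  proof -
    have fs: "c11_at (\<lambda>t::'e \<times> 'e \<times> 'e. fst (snd t)) 0" "c11_at (\<lambda>t::'e \<times> 'e \<times> 'e. snd (snd t)) 0" "c11_at (\<lambda>t::'e \<times> 'e \<times> 'e. fst t) 0"
      by (intro c11_at_bounded_linear bounded_linear_intros)+
    have 1: "c11_at (\<lambda>t::'e \<times> 'e \<times> 'e. i (fst (snd t))) 0"
      using \<open>c11_at i 0\<close> by (intro c11_at_compose[OF fs(1)]) simp_all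
    have 2: "c11_at (\<lambda>t::'e \<times> 'e \<times> 'e. m (fst t, snd (snd t))) 0"
      using \<open>c11_at m 0\<close> by (intro c11_at_compose[OF c11_at_Pair[OF fs(3,2)]]) (simp_all add: zero_prod_def)
    show ?thesis unfolding \<Phi>_def
      using \<open>c11_at m 0\<close> by (intro c11_at_compose[OF c11_at_Pair[OF 1 2]]) (simp_all add: zero_prod_def[symmetric] m0 i0)
  qed
  obtain rf Cf Df where rf: "0 < rf" "0 \<le> Cf" and Df: "\<And>y. norm (y - 0) < rf \<Longrightarrow> (\<Phi> has_derivative Df y) (at y)"
    "\<And>y z v. norm (y - 0) < rf \<Longrightarrow> norm (z - 0) < rf \<Longrightarrow> norm (Df y v - Df z v) \<le> Cf * norm (y - z) * norm v"
    and fL: "\<And>y z. norm (y - 0) < rf \<Longrightarrow> norm (z - 0) < rf \<Longrightarrow> norm (\<Phi> y - \<Phi> z) \<le> Cf * norm (y - z)"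
    by (rule c11_atE[OF \<open>c11_at \<Phi> 0\<close> zero_less_one]) blast
  \<comment> \<open>2 Cf is the constant in \<open>est1\<close>, where q occupies two slots of
    \<Phi>, and Cm the one for products; the summand 1 gives C \<ge> 1.\<close>
  define C where "C = 1 + 2 * Cf + Cm"
  have C: "C \<ge> 1" "2 * Cf \<le> C" "Cf \<le> C" "Cm \<le> C" using rf rm by (auto simp: C_def)
  have p1: "0 < Cm + Ci + 1" "0 < C" using rm ri C by auto
  have "0 < rm / 2" "0 < rf / 4" "0 < \<rho> / (4 * (Cm + Ci + 1))" "0 < R0 / (4 * C)" "0 < 1 / (8 * C)"
    using rm rf \<rho>(1) p1 R0(1) by auto
  \<comment> \<open>The bounds rm / 2 and rf / 4 keep pairs and triples in the balls where m and
    \<Phi> are estimated; the seventh keeps m (e, p) and i q below \<rho>, so that their product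
    stays in the chart; the eighth keeps \<Phi> below R0; the last is \<open>CR\<close>.\<close>
  then have "\<forall>x\<in>set [R0, rM, rI, rm / 2, ri, rf / 4, \<rho> / (4 * (Cm + Ci + 1)), R0 / (4 * C), 1 / (8 * C)]. 0 < x"
    unfolding list.set ball_simps by (intro conjI R0(1) rM(1) rI(1) ri(1) TrueI)
  from positive_lower_bound[OF this] obtain R where Rpos: "R > 0"
    and R: "R \<le> R0" "R \<le> rM" "R \<le> rI" "R \<le> rm / 2" "R \<le> ri" "R \<le> rf / 4"
      "R \<le> \<rho> / (4 * (Cm + Ci + 1))" "R \<le> R0 / (4 * C)" "R \<le> 1 / (8 * C)"
    unfolding list.set ball_simps by (elim exE conjE) (rule that)
  have R\<rho>: "4 * (Cm + Ci + 1) * R \<le> \<rho>" "4 * C * R \<le> R0" "8 * C * R \<le> 1"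
    using R(7-9) rm ri C by (simp_all add: field_simps)
  have "R \<le> \<rho>"
  proof -
    have "1 * R \<le> 4 * (Cm + Ci + 1) * R" using rm ri Rpos by (intro mult_right_mono) auto
    then show ?thesis using R\<rho>(1) by simp
  qed
  have np: "norm (x, y) \<le> norm x + norm y" for x y :: 'e by (rule norm_Pair_le)
  have np3: "norm (x, y, z) \<le> norm x + norm y + norm z" for x y z :: 'e
    using norm_Pair_le[of x "(y, z)"] norm_Pair_le[of y z] by simp
  have mb: "norm (m (x, y)) \<le> Cm * (norm x + norm y)" if "norm x < R" "norm y < R" for x y
  proof -
    have "norm (m (x, y) - m 0) \<le> Cm * norm ((x, y) - 0)" using np[of x y] that R(4) rm by (intro mL) auto
    also have "\<dots> \<le> Cm * (norm x + norm y)" using np[of x y] rm by (intro mult_left_mono) auto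
    finally show ?thesis by (simp add: m0)
  qed
  have Pv: "\<Phi> (e, q, p) \<in> dom" "inv (pt q) \<otimes> pt e \<otimes> pt p = pt (\<Phi> (e, q, p))"
    "norm (\<Phi> (e, q, p)) < R0" "pt e \<in> carrier G" "pt q \<in> carrier G" "pt p \<in> carrier G"
    if n: "norm e < R" "norm q < R" "norm p < R" for e q p
  proof -
    show cl: "pt e \<in> carrier G" "pt q \<in> carrier G" "pt p \<in> carrier G"
      using n R(1) R0(2) pt_in_U U_carrier by auto
    have "norm (m (e, p)) \<le> Cm * (R + R)" using mb[OF n(1,3)] n rm by (auto intro: order_trans[OF _ mult_left_mono])
    moreover have "Cm * (R + R) < \<rho>"
    proof -
      have "Cm * (R + R) \<le> 2 * ((Cm + Ci + 1) * R)" using ri Rpos by (simp add: algebra_simps)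
      moreover have "(Cm + Ci + 1) * R > 0" using ri rm Rpos by simp
      ultimately show ?thesis using R\<rho>(1) by linarith
    qed
    ultimately have mr: "norm (m (e, p)) < \<rho>" by linarith
    have "norm (i q - i 0) \<le> Ci * norm (q - 0)" using n R(5) ri by (intro iL) auto
    also have "\<dots> \<le> Ci * R" using n ri by (intro mult_left_mono) auto
    also have "\<dots> < \<rho>"
    proof -
      have "Ci * R \<le> 2 * ((Cm + Ci + 1) * R)" using rm ri Rpos by (simp add: algebra_simps)
      moreover have "(Cm + Ci + 1) * R > 0" using ri rm Rpos by simp
      ultimately show ?thesis using R\<rho>(1) by linarith
    qed
    finally have ir: "norm (i q) < \<rho>" by (simp add: i0)
    have pi: "pt (i q) = inv (pt q)" using rI(2)[of q] n R(3) by (simp add: i_def pt_co)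
    have pm: "pt (m (e, p)) = pt e \<otimes> pt p" using val(2)[of e p] n \<open>R \<le> \<rho>\<close> by simp
    have "pt (i q) \<otimes> pt (m (e, p)) \<in> U" "pt (\<Phi> (e, q, p)) = pt (i q) \<otimes> pt (m (e, p))"
      using val[OF ir mr] by (simp_all add: \<Phi>_def)
    then show "inv (pt q) \<otimes> pt e \<otimes> pt p = pt (\<Phi> (e, q, p))" using cl by (simp add: pi pm m_assoc)
    have "norm (e, q, p) < rf" using np3[of e q p] n R(6) Rpos by linarith
    then have "norm (\<Phi> (e, q, p) - \<Phi> 0) \<le> Cf * norm ((e, q, p) - 0)" using rf by (intro fL) auto
    also have "\<dots> \<le> Cf * (R + R + R)" using np3[of e q p] n rf by (intro mult_left_mono) auto
    also have "\<dots> \<le> C * (R + R + R)" using C Rpos by (intro mult_right_mono) auto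
    also have "\<dots> < 4 * C * R" using C Rpos by simp
    finally show "norm (\<Phi> (e, q, p)) < R0" using R\<rho>(2) by (simp add: \<Phi>_def m0 i0 zero_prod_def[symmetric])
    then show "\<Phi> (e, q, p) \<in> dom" by (rule R0(2))
  qed
  have coPhi: "\<Phi> (e, q, p) = co (inv (pt q) \<otimes> pt e \<otimes> pt p)" if "norm e < R" "norm q < R" "norm p < R" for e q p
    using Pv[OF that] co_pt by simp
  have Pe: "\<Phi> (e, 0, 0) = e" if "norm e < R" for e
    using coPhi[OF that, of 0 0] Rpos Pv(4)[OF that, of 0 0] R0(2)[of e] that R(1) by (simp add: pt_zero co_pt)
  have Pq: "\<Phi> (0, q, q) = 0" if "norm q < R" for q
    using coPhi[OF _ that that, of 0] Rpos Pv(4)[OF that that that] that by (simp add: pt_zero co_def)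
  have mq: "m (q, 0) = q" "m (0, q) = q" if "norm q < R" for q
    using that R0(2)[of q] R(1) Pv(4)[OF that that that] by (simp_all add: m_def pt_zero co_pt)
  have in_rm: "norm ((q, w) - 0) < rm" if "norm q < R" "norm w < R" for q w :: 'e
    using np[of q w] that R(4) by simp
  have in_rf: "norm ((e, q, p) - 0) < rf" if "norm e < R" "norm q < R" "norm p < R" for e q p :: 'e
    using np3[of e q p] that R(6) Rpos by simp
  have DfI: "Df (e, 0, 0) (v, 0, 0) = v" if e: "norm e < R" for e v
  proof -
    have "((\<lambda>x. (x, 0, 0)) has_derivative (\<lambda>v. (v, 0, 0))) (at e)"
      by (intro has_derivative_Pair has_derivative_ident has_derivative_const)
    from has_derivative_compose[OF this Df(1)[OF in_rf[OF e]]] Rpos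
    have "((\<lambda>x. \<Phi> (x, 0, 0)) has_derivative (\<lambda>v. Df (e, 0, 0) (v, 0, 0))) (at e)" by simp
    moreover have "((\<lambda>x. \<Phi> (x, 0, 0)) has_derivative (\<lambda>v. v)) (at e)"
      by (rule has_derivative_transform_within_open[OF has_derivative_ident, of "ball 0 R"]) (use e Pe in auto)
    ultimately show ?thesis using has_derivative_unique by metis
  qed
  \<comment> \<open>The map x -> \<Phi> (x, q, q) - x vanishes at x = 0, and for q = 0 its
    derivative vanishes by \<open>DfI\<close>. The Lipschitz bound for Df makes the derivative
    O(|q|), and the mean value inequality in x supplies the factor |e|.\<close>
  have est1: "norm (\<Phi> (e, q, q) - e) \<le> 2 * Cf * norm q * norm e" if e: "norm e < R" and q: "norm q < R" for e q
  proof -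
    have "norm ((\<Phi> (e, q, q) - e) - (\<Phi> (0, q, q) - 0)) \<le> (2 * Cf * norm q) * norm (e - 0)"
    proof (rule differentiable_bound[where S = "ball 0 R"])
      fix x :: 'e assume "x \<in> ball 0 R"
      then have x: "norm x < R" by simp
      have "((\<lambda>x. (x, q, q)) has_derivative (\<lambda>v. (v, 0, 0))) (at x)"
        by (intro has_derivative_Pair has_derivative_ident has_derivative_const)
      from has_derivative_compose[OF this Df(1)[OF in_rf[OF x q q]]]
      have "((\<lambda>x. \<Phi> (x, q, q) - x) has_derivative (\<lambda>v. Df (x, q, q) (v, 0, 0) - v)) (at x)"
        by (intro has_derivative_diff has_derivative_ident)
      then show "((\<lambda>x. \<Phi> (x, q, q) - x) has_derivative (\<lambda>v. Df (x, q, q) (v, 0, 0) - v)) (at x within ball 0 R)"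
        by (rule has_derivative_at_withinI)
      show "onorm (\<lambda>v. Df (x, q, q) (v, 0, 0) - v) \<le> 2 * Cf * norm q"
      proof (rule onorm_bound)
        fix v
        have "norm (Df (x, q, q) (v, 0, 0) - Df (x, 0, 0) (v, 0, 0)) \<le> Cf * norm ((x, q, q) - (x, 0, 0)) * norm (v, 0::'e, 0::'e)"
          using in_rf[OF x q q] in_rf[OF x] Rpos by (intro Df(2)) auto
        also have "\<dots> = Cf * norm (q, q) * norm v" by (simp add: zero_prod_def[symmetric])
        also have "\<dots> \<le> Cf * (norm q + norm q) * norm v"
          using rf np[of q q] by (intro mult_right_mono mult_left_mono) auto
        finally show "norm (Df (x, q, q) (v, 0, 0) - v) \<le> 2 * Cf * norm q * norm v"
          by (simp add: DfI[OF x] mult_ac)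
      qed (use rf in auto)
    qed (use e Rpos in auto)
    then show ?thesis using Pq[OF q] by simp
  qed
  \<comment> \<open>After subtraction of the linear part, the mean value inequality is applied on
    the ball of radius |w| itself, where the derivative is at most Cm |w|; this makes the remainder
    quadratic.\<close>
  have est2: "norm (m (q, w) - q - Dm (q, 0) (0, w)) \<le> Cm * (norm w)\<^sup>2" if q: "norm q < R" and w: "norm w < R" for q w
  proof -
    have lin: "linear (Dm (q, 0))" using has_derivative_linear[OF Dm(1)[OF in_rm[OF q, of 0]]] Rpos by simp
    have "norm ((m (q, w) - Dm (q, 0) (0, w)) - (m (q, 0) - Dm (q, 0) (0, 0))) \<le> (Cm * norm w) * norm (w - 0)"
    proof (rule differentiable_bound[where S = "cball 0 (norm w)"])
      fix x :: 'e assume "x \<in> cball 0 (norm w)"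
      then have xw: "norm x \<le> norm w" and x: "norm x < R" using w by auto
      have "((\<lambda>x. (q, x)) has_derivative (\<lambda>v. (0, v))) (at x)"
        by (intro has_derivative_Pair has_derivative_ident has_derivative_const)
      have 1: "((\<lambda>x. m (q, x)) has_derivative (\<lambda>v. Dm (q, x) (0, v))) (at x)"
        using has_derivative_compose[OF \<open>((\<lambda>x. (q, x)) has_derivative (\<lambda>v. (0, v))) (at x)\<close> Dm(1)[OF in_rm[OF q x]]] by simp
      have bl: "bounded_linear (Dm (q, 0))"
        using has_derivative_bounded_linear[OF Dm(1)[OF in_rm[OF q, of 0]]] Rpos by simp
      have "bounded_linear (\<lambda>v. Dm (q, 0) (0, v))"
        by (rule bounded_linear_compose[OF bl bounded_linear_Pair[OF bounded_linear_zero bounded_linear_ident]])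
      then have "((\<lambda>x. Dm (q, 0) (0, x)) has_derivative (\<lambda>v. Dm (q, 0) (0, v))) (at x)"
        by (rule bounded_linear_imp_has_derivative)
      then show "((\<lambda>x. m (q, x) - Dm (q, 0) (0, x)) has_derivative (\<lambda>v. Dm (q, x) (0, v) - Dm (q, 0) (0, v))) (at x within cball 0 (norm w))"
        by (rule has_derivative_at_withinI[OF has_derivative_diff[OF 1]])
      show "onorm (\<lambda>v. Dm (q, x) (0, v) - Dm (q, 0) (0, v)) \<le> Cm * norm w"
      proof (rule onorm_bound)
        fix v
        have "norm (Dm (q, x) (0, v) - Dm (q, 0) (0, v)) \<le> Cm * norm ((q, x) - (q, 0)) * norm (0::'e, v)"
          using in_rm[OF q x] in_rm[OF q, of 0] Rpos by (intro Dm(2)) auto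
        also have "\<dots> \<le> Cm * norm w * norm v" using rm xw by (intro mult_mono mult_left_mono) auto
        finally show "norm (Dm (q, x) (0, v) - Dm (q, 0) (0, v)) \<le> Cm * norm w * norm v" .
      qed (use rm in auto)
    qed auto
    moreover have "Dm (q, 0) (0, 0) = 0" using lin linear_0[of "Dm (q, 0)"] by (simp add: zero_prod_def)
    ultimately show ?thesis using mq(1)[OF q] by (simp add: power2_eq_square diff_diff_eq2 add.commute diff_diff_eq)
  qed
  have "lie_ball G pt (\<lambda>q v. Dm (q, 0) (0, v)) R0 R C"
  proof (rule lie_ball.intro[OF is_group lie_ball_axioms.intro])
    show "0 < R" "R \<le> R0" "1 \<le> C" "8 * C * R \<le> 1" using Rpos R C R\<rho> by auto
    show "norm v < R0 \<Longrightarrow> pt v \<in> carrier G" for v using R0(2) pt_in_U U_carrier by blast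
    show "norm v < R0 \<Longrightarrow> norm w < R0 \<Longrightarrow> pt v = pt w \<Longrightarrow> v = w" for v w using R0(2) co_pt by metis
    show "pt 0 = \<one>" by (rule pt_zero)
    show "\<exists>z. norm z < R0 \<and> inv (pt q) \<otimes> pt e \<otimes> pt p = pt z \<and> norm (z - e) \<le> C * (norm e * norm q + norm (p - q))"
      if n: "norm e < R" "norm q < R" "norm p < R" for e q p
    proof (intro exI[of _ "\<Phi> (e, q, p)"] conjI Pv[OF n])
      have "norm (\<Phi> (e, q, p) - \<Phi> (e, q, q)) \<le> Cf * norm ((e, q, p) - (e, q, q))"
        using in_rf[OF n] in_rf[OF n(1,2,2)] by (intro fL)
      then have 1: "norm (\<Phi> (e, q, p) - \<Phi> (e, q, q)) \<le> Cf * norm (p - q)" by simp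
      have "norm (\<Phi> (e, q, p) - e) \<le> norm (\<Phi> (e, q, p) - \<Phi> (e, q, q)) + norm (\<Phi> (e, q, q) - e)"
        using norm_triangle_ineq[of "\<Phi> (e, q, p) - \<Phi> (e, q, q)" "\<Phi> (e, q, q) - e"] by simp
      also have "\<dots> \<le> Cf * norm (p - q) + (2 * Cf) * (norm e * norm q)"
        using 1 est1[OF n(1,2)] by (simp add: mult_ac)
      also have "\<dots> \<le> C * norm (p - q) + C * (norm e * norm q)"
        using C by (intro add_mono mult_right_mono) auto
      finally show "norm (\<Phi> (e, q, p) - e) \<le> C * (norm e * norm q + norm (p - q))" by (simp add: algebra_simps)
    qed
    show "\<exists>z. norm z < R0 \<and> pt q \<otimes> pt w = pt z \<and> norm (z - q - Dm (q, 0) (0, w)) \<le> C * (norm w)\<^sup>2"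
      if n: "norm q < R" "norm w < R" for q w
    proof (intro exI[of _ "m (q, w)"] conjI)
      have "norm (m (q, w)) \<le> Cm * (R + R)" using mb[OF n] n rm by (auto intro: order_trans[OF _ mult_left_mono])
      also have "\<dots> \<le> C * (R + R)" using C Rpos by (intro mult_right_mono) auto
      also have "\<dots> < 4 * C * R" using C Rpos by simp
      finally show "norm (m (q, w)) < R0" using R\<rho>(2) by simp
      show "pt q \<otimes> pt w = pt (m (q, w))" using val(2)[of q w] n \<open>R \<le> \<rho>\<close> by simp
      show "norm (m (q, w) - q - Dm (q, 0) (0, w)) \<le> C * (norm w)\<^sup>2"
        using est2[OF n] C mult_right_mono[of Cm C "(norm w)\<^sup>2"] by simp
    qed
    show "linear (\<lambda>v. Dm (q, 0) (0, v))" if "norm q < R" for q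
    proof -
      have "linear (Dm (q, 0))" using has_derivative_linear[OF Dm(1)[OF in_rm[OF that, of 0]]] Rpos by simp
      moreover have "linear (\<lambda>v::'e. (0::'e, v))" by (rule linearI) auto
      ultimately show ?thesis using linear_compose[of "\<lambda>v. (0, v)" "Dm (q, 0)"] by (simp add: o_def)
    qed
    show "norm (Dm (q, 0) (0, v) - Dm (q', 0) (0, v)) \<le> C * norm (q - q') * norm v"
      if "norm q < R" "norm q' < R" for q q' v
    proof -
      have "norm (Dm (q, 0) (0, v) - Dm (q', 0) (0, v)) \<le> Cm * norm ((q, 0::'e) - (q', 0)) * norm (0::'e, v)"
        using in_rm[OF that(1), of 0] in_rm[OF that(2), of 0] Rpos by (intro Dm(2)) auto
      also have "\<dots> = Cm * norm (q - q') * norm v" by simp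
      also have "\<dots> \<le> C * norm (q - q') * norm v" using C by (intro mult_right_mono) auto
      finally show ?thesis .
    qed
    show "Dm (0, 0) (0, v) = v" for v
    proof -
      have "((\<lambda>x. (0, x)) has_derivative (\<lambda>v. (0, v))) (at (0::'e))"
        by (intro has_derivative_Pair has_derivative_ident has_derivative_const)
      from has_derivative_compose[OF this Dm(1)[OF in_rm]] Rpos
      have "((\<lambda>x. m (0, x)) has_derivative (\<lambda>v. Dm (0, 0) (0, v))) (at 0)" by simp
      moreover have "((\<lambda>x. m (0, x)) has_derivative (\<lambda>v. v)) (at 0)"
        by (rule has_derivative_transform_within_open[OF has_derivative_ident, of "ball 0 R"]) (use Rpos mq in auto)
      ultimately show ?thesis using has_derivative_unique by metis
    qed
  qed
  then show ?thesis using R0(2) by blast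
qed

text \<open>The tangent vector h.v in the coordinates of the chart \<psi>, for v given in the
  centred chart at the identity.\<close>

definition left_deriv :: "'a \<Rightarrow> ('a \<Rightarrow> 'e) \<Rightarrow> 'e \<Rightarrow> 'e" where
  "left_deriv h \<psi> = frechet_derivative (\<lambda>v. \<psi> (h \<otimes> pt v)) (at 0)"

lemma left_deriv:
  assumes "(V, \<psi>) \<in> atlas (mfd G)" "h \<in> V"
  shows "((\<lambda>v. \<psi> (h \<otimes> pt v)) has_derivative left_deriv h \<psi>) (at 0)"
proof -
  have 1: "c11_at (\<lambda>v::'e. (\<psi> h, v)) 0"
    by (intro c11_at_Pair c11_at_const c11_at_bounded_linear bounded_linear_ident)
  have "c11_at (\<lambda>v. \<psi> (h \<otimes> pt v)) 0"
    using c11_at_compose[OF 1 mult_pt_c11[OF assms(1,1,2,2)]] chart_facts(4)[OF lie_facts(1) assms(1)] assms(2)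
    by simp
  then show ?thesis unfolding left_deriv_def by (rule c11_at_differentiable)
qed

lemma left_deriv_one: "left_deriv \<one> \<phi> v = v"
proof -
  obtain r where r: "r > 0" "\<And>v. norm v < r \<Longrightarrow> v \<in> dom" using pt_nbhd[OF chart_U(1) one_U] by blast
  have "((\<lambda>v::'e. v + \<phi> \<one>) has_derivative (\<lambda>v. v)) (at 0)" by (auto intro!: derivative_eq_intros)
  then have "((\<lambda>v. \<phi> (\<one> \<otimes> pt v)) has_derivative (\<lambda>v. v)) (at 0)"
  proof (rule has_derivative_transform_within_open[of _ _ _ "UNIV" "ball 0 r"])
    fix v :: 'e assume "v \<in> ball 0 r"
    then have "v \<in> dom" using r(2) by simp
    then show "v + \<phi> \<one> = \<phi> (\<one> \<otimes> pt v)"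
      using co_pt U_carrier[OF pt_in_U] by (simp add: co_def diff_eq_eq)
  qed (use r in auto)
  from has_derivative_unique[OF left_deriv[OF chart one_U] this] show ?thesis by (simp add: fun_eq_iff)
qed

text \<open>Left translation by inv h provides K, which brings tangent vectors at h back to the
  identity. It is differentiable as multiplication with the left factor fixed in a chart around inv
  h.\<close>

lemma left_deriv_inverse:
  assumes V: "(V, \<psi>) \<in> atlas (mfd G)" and h: "h \<in> V"
  shows "\<exists>K. ((\<lambda>w. co (inv h \<otimes> inv_into V \<psi> w)) has_derivative K) (at (\<psi> h)) \<and> (\<forall>v. K (left_deriv h \<psi> v) = v)"
proof -
  have hc: "h \<in> carrier G" using chart_facts(3)[OF lie_facts(1) V] lie_facts(2) h by auto
  obtain V0 \<psi>0 where V0: "(V0, \<psi>0) \<in> atlas (mfd G)" "inv h \<in> V0"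
    using chart_at[OF lie_facts(1), of "inv h"] hc lie_facts(2) by auto
  have "inv h \<otimes> h \<in> U" using hc one_U by simp
  from c11_at_add_const[OF mult_c11[OF V0(1) V chart V0(2) h this], of "- \<phi> \<one>"]
  have 1: "c11_at (\<lambda>p. \<phi> (inv_into V0 \<psi>0 (fst p) \<otimes> inv_into V \<psi> (snd p)) + - \<phi> \<one>) (\<psi>0 (inv h), \<psi> h)" .
  have 2: "c11_at (\<lambda>w::'e. (\<psi>0 (inv h), w)) (\<psi> h)"
    by (intro c11_at_Pair c11_at_const c11_at_bounded_linear bounded_linear_ident)
  have "c11_at (\<lambda>w. co (inv h \<otimes> inv_into V \<psi> w)) (\<psi> h)"
    using c11_at_compose[OF 2 1] chart_facts(4)[OF lie_facts(1) V0(1)] V0(2) by (simp add: co_def)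
  then obtain K where K: "((\<lambda>w. co (inv h \<otimes> inv_into V \<psi> w)) has_derivative K) (at (\<psi> h))"
    using c11_at_differentiable by blast
  have "((\<lambda>w. co (inv h \<otimes> inv_into V \<psi> w)) has_derivative K) (at (\<psi> (h \<otimes> pt 0)))"
    using K hc by (simp add: pt_zero)
  from has_derivative_compose[OF left_deriv[OF V h] this]
  have c: "((\<lambda>v. co (inv h \<otimes> inv_into V \<psi> (\<psi> (h \<otimes> pt v)))) has_derivative (\<lambda>v. K (left_deriv h \<psi> v))) (at 0)" .
  obtain r where r: "r > 0" "\<And>v. norm v < r \<Longrightarrow> v \<in> dom \<and> h \<otimes> pt v \<in> V"
    using pt_nbhd_at[OF hc chart_facts(1)[OF lie_facts(1) V] h] by blast
  have "((\<lambda>v. co (inv h \<otimes> inv_into V \<psi> (\<psi> (h \<otimes> pt v)))) has_derivative (\<lambda>v. v)) (at 0)"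
  proof (rule has_derivative_transform_within_open[OF has_derivative_ident, of "ball 0 r"])
    fix v :: 'e assume "v \<in> ball 0 r"
    then have v: "v \<in> dom" "h \<otimes> pt v \<in> V" using r(2)[of v] by auto
    have "pt v \<in> carrier G" using U_carrier[OF pt_in_U[OF v(1)]] .
    then show "v = co (inv h \<otimes> inv_into V \<psi> (\<psi> (h \<otimes> pt v)))"
      using chart_facts(4)[OF lie_facts(1) V] v co_pt hc by (simp add: m_assoc[symmetric])
  qed (use r in auto)
  from has_derivative_unique[OF c this] K show ?thesis by (intro exI[of _ K]) (simp add: fun_eq_iff)
qed

end

section \<open>Logarithmic derivatives and derivatives in arbitrary charts\<close>

locale lie_chart_ball = lie_chart G U \<phi> + lie_ball G "lie_chart.pt G U \<phi>" F R0 R C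
  for G :: "('a, 'e::banach) manifold_group" (structure) and U \<phi> F R0 R C +
  assumes ball_dom: "\<And>v. norm v < R0 \<Longrightarrow> v \<in> dom"
begin

lemma ld_vector_derivative:
  assumes ld: "has_ld G pt c v t S" and "t \<in> S" and V: "(V, \<psi>) \<in> atlas (mfd G)" "c t \<in> V"
  shows "((\<lambda>s. \<psi> (c s)) has_vector_derivative left_deriv (c t) \<psi> v) (at t within S)"
proof -
  have ct: "c t \<in> carrier G" using chart_facts(3)[OF lie_facts(1) V(1)] lie_facts(2) V(2) by auto
  obtain p \<delta> where p: "p t = 0" "(p has_vector_derivative v) (at t within S)" "\<delta> > 0"
    "\<And>s. s \<in> S \<Longrightarrow> \<bar>s - t\<bar> < \<delta> \<Longrightarrow> c s = c t \<otimes> pt (p s)"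
    using has_ld_coord[OF ld ct \<open>t \<in> S\<close>] by blast
  have l: "((\<lambda>v. \<psi> (c t \<otimes> pt v)) has_derivative left_deriv (c t) \<psi>) (at (p t))"
    using left_deriv[OF V] p(1) by simp
  have "((\<lambda>s. \<psi> (c t \<otimes> pt (p s))) has_derivative (\<lambda>h. left_deriv (c t) \<psi> (h *\<^sub>R v))) (at t within S)"
    using has_derivative_compose[OF p(2)[unfolded has_vector_derivative_def] l] .
  then have "((\<lambda>s. \<psi> (c s)) has_derivative (\<lambda>h. left_deriv (c t) \<psi> (h *\<^sub>R v))) (at t within S)"
    by (rule has_derivative_transform_within[OF _ p(3) \<open>t \<in> S\<close>]) (use p(4) in \<open>auto simp: dist_real_def\<close>)
  then show ?thesis unfolding has_vector_derivative_def
    using has_derivative_linear[OF l] by (simp add: linear_cmul)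
qed

text \<open>The left inverse K of \<open>left_deriv\<close> takes the derivative back to the
  identity. Continuity of c is a separate hypothesis because \<psi> has arbitrary values off V: a
  derivative of \<psi> after c does not force c into V.\<close>

lemma ld_of_vector_derivative:
  assumes V: "(V, \<psi>) \<in> atlas (mfd G)" "c t \<in> V" and cl: "\<And>s. s \<in> S \<Longrightarrow> c s \<in> carrier G" and "t \<in> S"
    and cont: "\<And>W. openin (topol (mfd G)) W \<Longrightarrow> c t \<in> W \<Longrightarrow> \<exists>\<delta>>0. \<forall>s\<in>S. \<bar>s - t\<bar> < \<delta> \<longrightarrow> c s \<in> W"
    and d: "((\<lambda>s. \<psi> (c s)) has_vector_derivative left_deriv (c t) \<psi> v) (at t within S)"
  shows "has_ld G pt c v t S"
proof -
  obtain K where K: "((\<lambda>w. co (inv (c t) \<otimes> inv_into V \<psi> w)) has_derivative K) (at (\<psi> (c t)))" "\<And>v. K (left_deriv (c t) \<psi> v) = v"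
    using left_deriv_inverse[OF V] by blast
  have ct: "c t \<in> carrier G" using cl \<open>t \<in> S\<close> by blast
  define p where "p s = co (inv (c t) \<otimes> inv_into V \<psi> (\<psi> (c s)))" for s
  have "((\<lambda>s. p s) has_derivative (\<lambda>h. K (h *\<^sub>R left_deriv (c t) \<psi> v))) (at t within S)"
    unfolding p_def using has_derivative_compose[OF d[unfolded has_vector_derivative_def] K(1)] .
  then have pd: "(p has_vector_derivative v) (at t within S)"
    unfolding has_vector_derivative_def using has_derivative_linear[OF K(1)] K(2) by (simp add: linear_cmul)
  have inj: "inv_into V \<psi> (\<psi> x) = x" if "x \<in> V" for x
    using chart_facts(4)[OF lie_facts(1) V(1)] that by simp
  have p0: "p t = 0" using inj[OF V(2)] ct by (simp add: p_def co_def)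
  obtain A B where AB: "openin (topol (mfd G)) B" "inv (c t) \<in> A" "c t \<in> B" "\<forall>x\<in>A. \<forall>y\<in>B. x \<otimes> y \<in> U"
    using continuous_map_prod_nbhd[OF continuous_mult, of "inv (c t)" "c t" U] ct lie_facts(2) chart_U(1) one_U by auto
  have "openin (topol (mfd G)) (B \<inter> V)" using AB(1) chart_facts(1)[OF lie_facts(1) V(1)] by (rule openin_Int)
  then obtain \<delta> where \<delta>: "\<delta> > 0" "\<forall>s\<in>S. \<bar>s - t\<bar> < \<delta> \<longrightarrow> c s \<in> B \<inter> V" using cont[of "B \<inter> V"] AB V by blast
  have "c s = c t \<otimes> pt (p s)" if s: "s \<in> S" "\<bar>s - t\<bar> < \<delta>" for s
  proof -
    have sB: "c s \<in> B" "c s \<in> V" using \<delta> s by auto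
    then have "inv (c t) \<otimes> c s \<in> U" using AB by blast
    then have "pt (p s) = inv (c t) \<otimes> c s" using inj[OF sB(2)] pt_co by (simp add: p_def)
    then show ?thesis using ct cl[OF s(1)] by (simp add: m_assoc[symmetric])
  qed
  with p0 pd \<delta>(1) show ?thesis by (rule has_ldI_coord)
qed

lemma ld_continuous:
  assumes ld: "has_ld G pt c v t S" and ct: "c t \<in> carrier G" and W: "openin (topol (mfd G)) W" "c t \<in> W"
  shows "\<exists>\<delta>>0. \<forall>s\<in>S. \<bar>s - t\<bar> < \<delta> \<longrightarrow> c s \<in> W"
proof -
  obtain r where r: "r > 0" "\<And>v. norm v < r \<Longrightarrow> c t \<otimes> pt v \<in> W" using pt_nbhd_at[OF ct W] by blast
  obtain \<delta> where "\<delta> > 0" "\<And>s. s \<in> S \<Longrightarrow> \<bar>s - t\<bar> < \<delta> \<Longrightarrow> \<exists>z. c s = c t \<otimes> pt z \<and> norm z < r"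
    using has_ld_ex[OF ld order_refl zero_less_one r(1)] by blast
  then show ?thesis using r(2) by metis
qed

lemma ld_continuous_map:
  assumes "\<And>t. t \<in> S \<Longrightarrow> c t \<in> carrier G \<and> has_ld G pt c (\<xi> t) t S"
  shows "continuous_map (top_of_set S) (topol (mfd G)) c"
  unfolding continuous_map_def
proof (intro conjI allI impI)
  show "c \<in> topspace (top_of_set S) \<rightarrow> topspace (topol (mfd G))" using assms lie_facts(2) by auto
  fix W assume W: "openin (topol (mfd G)) W"
  show "openin (top_of_set S) {x \<in> topspace (top_of_set S). c x \<in> W}"
    unfolding openin_euclidean_subtopology_iff
  proof (intro conjI ballI)
    fix t assume "t \<in> {x \<in> topspace (top_of_set S). c x \<in> W}"
    then have t: "t \<in> S" "c t \<in> W" by auto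
    obtain \<delta> where "\<delta> > 0" "\<forall>s\<in>S. \<bar>s - t\<bar> < \<delta> \<longrightarrow> c s \<in> W"
      using ld_continuous[of c "\<xi> t" t S W] assms[OF t(1)] W t(2) by blast
    then show "\<exists>e>0. \<forall>x'\<in>S. dist x' t < e \<longrightarrow> x' \<in> {x \<in> topspace (top_of_set S). c x \<in> W}"
      by (intro exI[of _ \<delta>]) (auto simp: dist_real_def)
  qed auto
qed

text \<open>Near c t, \<open>left_deriv\<close> is a partial derivative of multiplication in charts,
  which is Lipschitz in the base point. This supplies the continuity of velocities that
  \<open>C1_curve\<close> demands.\<close>

lemma left_deriv_continuous:
  assumes ld: "\<And>t. t \<in> S \<Longrightarrow> c t \<in> carrier G \<and> has_ld G pt c (\<xi> t) t S" and \<xi>: "continuous_on S \<xi>"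
    and V: "(V, \<psi>) \<in> atlas (mfd G)"
  shows "continuous_on (S \<inter> c -` V) (\<lambda>t. left_deriv (c t) \<psi> (\<xi> t))"
  unfolding continuous_on_def
proof
  fix t assume "t \<in> S \<inter> c -` V"
  then have t: "t \<in> S" "c t \<in> V" by auto
  have inj: "inv_into V \<psi> (\<psi> x) = x" if "x \<in> V" for x
    using chart_facts(4)[OF lie_facts(1) V(1)] that by simp
  obtain r C D where "0 < r" "0 \<le> C" and
    D: "\<And>y. norm (y - (\<psi> (c t), 0)) < r \<Longrightarrow> ((\<lambda>p. \<psi> (inv_into V \<psi> (fst p) \<otimes> pt (snd p))) has_derivative D y) (at y)"
    and Dl: "\<And>y z v. norm (y - (\<psi> (c t), 0)) < r \<Longrightarrow> norm (z - (\<psi> (c t), 0)) < r \<Longrightarrow> norm (D y v - D z v) \<le> C * norm (y - z) * norm v"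
    and Db: "\<And>y v. norm (y - (\<psi> (c t), 0)) < r \<Longrightarrow> norm (D y v) \<le> C * norm v"
    by (rule c11_atE[OF mult_pt_c11[OF V V t(2,2)] zero_less_one]) blast
  have eq: "left_deriv h \<psi> v = D (\<psi> h, 0) (0, v)" if h: "h \<in> V" "norm (\<psi> h - \<psi> (c t)) < r" for h v
  proof -
    have "((\<lambda>v::'e. (\<psi> h, v)) has_derivative (\<lambda>v. (0, v))) (at 0)"
      by (intro has_derivative_Pair has_derivative_ident has_derivative_const)
    from has_derivative_compose[OF this D] h
    have "((\<lambda>v. \<psi> (h \<otimes> pt v)) has_derivative (\<lambda>v. D (\<psi> h, 0) (0, v))) (at 0)" by (simp add: inj)
    from has_derivative_unique[OF left_deriv[OF V h(1)] this] show ?thesis by (simp add: fun_eq_iff)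
  qed
  have "((\<lambda>s. \<psi> (c s)) has_vector_derivative left_deriv (c t) \<psi> (\<xi> t)) (at t within S)"
    using ld[OF t(1)] t V by (intro ld_vector_derivative) auto
  then have "continuous (at t within S) (\<lambda>s. \<psi> (c s))" by (rule has_vector_derivative_continuous)
  then have \<psi>c: "((\<lambda>s. \<psi> (c s)) \<longlongrightarrow> \<psi> (c t)) (at t within S \<inter> c -` V)"
    unfolding continuous_within by (rule tendsto_within_subset) auto
  have \<xi>t: "(\<xi> \<longlongrightarrow> \<xi> t) (at t within S \<inter> c -` V)"
    using \<xi> t(1) unfolding continuous_on_def by (blast intro: tendsto_within_subset)
  have "((\<lambda>s. left_deriv (c s) \<psi> (\<xi> s) - left_deriv (c t) \<psi> (\<xi> t)) \<longlongrightarrow> 0) (at t within S \<inter> c -` V)"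
  proof (rule Lim_null_comparison)
    have "((\<lambda>s. C * norm (\<psi> (c s) - \<psi> (c t)) * norm (\<xi> s) + C * norm (\<xi> s - \<xi> t)) \<longlongrightarrow>
       C * norm (\<psi> (c t) - \<psi> (c t)) * norm (\<xi> t) + C * norm (\<xi> t - \<xi> t)) (at t within S \<inter> c -` V)"
      by (intro tendsto_intros \<psi>c \<xi>t)
    then show "((\<lambda>s. C * norm (\<psi> (c s) - \<psi> (c t)) * norm (\<xi> s) + C * norm (\<xi> s - \<xi> t)) \<longlongrightarrow> 0) (at t within S \<inter> c -` V)"
      by simp
    have "\<forall>\<^sub>F s in at t within S \<inter> c -` V. dist (\<psi> (c s)) (\<psi> (c t)) < r"
      using tendstoD[OF \<psi>c \<open>0 < r\<close>] .
    moreover have "\<forall>\<^sub>F s in at t within S \<inter> c -` V. s \<in> S \<inter> c -` V" by (auto simp: eventually_at_filter)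
    ultimately show "\<forall>\<^sub>F s in at t within S \<inter> c -` V. norm (left_deriv (c s) \<psi> (\<xi> s) - left_deriv (c t) \<psi> (\<xi> t))
       \<le> C * norm (\<psi> (c s) - \<psi> (c t)) * norm (\<xi> s) + C * norm (\<xi> s - \<xi> t)"
    proof eventually_elim
      case (elim s)
      have near: "norm (\<psi> (c s) - \<psi> (c t)) < r" using elim by (simp add: dist_norm)
      have n0: "norm ((\<psi> (c s), 0) - (\<psi> (c t), 0::'e)) < r" "norm ((\<psi> (c t), 0) - (\<psi> (c t), 0::'e)) < r"
        using near \<open>0 < r\<close> by simp_all
      have e1: "left_deriv (c s) \<psi> (\<xi> s) = D (\<psi> (c s), 0) (0, \<xi> s)" using eq elim near by auto
      have e2: "left_deriv (c t) \<psi> u = D (\<psi> (c t), 0) (0, u)" for u using eq[OF t(2)] \<open>0 < r\<close> by auto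
      have lin: "linear (left_deriv (c t) \<psi>)" using left_deriv[OF V t(2)] has_derivative_linear by blast
      have 1: "norm (D (\<psi> (c s), 0) (0, \<xi> s) - D (\<psi> (c t), 0) (0, \<xi> s)) \<le> C * norm (\<psi> (c s) - \<psi> (c t)) * norm (\<xi> s)"
        using Dl[OF n0, of "(0, \<xi> s)"] by simp
      have 2: "norm (left_deriv (c t) \<psi> (\<xi> s - \<xi> t)) \<le> C * norm (\<xi> s - \<xi> t)"
        using Db[OF n0(2), of "(0, \<xi> s - \<xi> t)"] by (simp add: e2)
      have "left_deriv (c s) \<psi> (\<xi> s) - left_deriv (c t) \<psi> (\<xi> t) =
         (D (\<psi> (c s), 0) (0, \<xi> s) - D (\<psi> (c t), 0) (0, \<xi> s)) + left_deriv (c t) \<psi> (\<xi> s - \<xi> t)"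
        by (simp add: linear_diff[OF lin] e1 e2[of "\<xi> s"])
      then show ?case using norm_triangle_mono[OF 1 2] by simp
    qed
  qed
  then show "((\<lambda>t. left_deriv (c t) \<psi> (\<xi> t)) \<longlongrightarrow> left_deriv (c t) \<psi> (\<xi> t)) (at t within S \<inter> c -` V)"
    by (simp add: LIM_zero_iff)
qed

end

section \<open>The action in charts\<close>

locale lie_chart_action = N: lie_chart N U \<phi> + G: lie_chart G V \<psi>
  for N :: "('n, 'e::banach) manifold_group" and U \<phi>
    and G :: "('g, 'f::banach) manifold_group" and V \<psi> +
  fixes \<pi> :: "'g \<Rightarrow> 'n \<Rightarrow> 'n"
  assumes \<pi>_hom: "\<pi> \<in> hom G (LieAut N)" and \<pi>_continuous: "continuous_action G N \<pi>"
begin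

lemma \<pi>_facts:
  assumes "g \<in> carrier G"
  shows "\<pi> g \<in> hom N N" "bij_betw (\<pi> g) (carrier N) (carrier N)" "smooth_map (mfd N) (mfd N) (\<pi> g)" "\<pi> g \<in> Bij (carrier N)"
proof -
  have "\<pi> g \<in> carrier (LieAut N)" using \<pi>_hom assms by (auto simp: hom_def)
  then have "\<pi> g \<in> auto N" "smooth_map (mfd N) (mfd N) (\<pi> g)" by (auto simp: LieAut_def)
  then show "\<pi> g \<in> hom N N" "bij_betw (\<pi> g) (carrier N) (carrier N)" "smooth_map (mfd N) (mfd N) (\<pi> g)" "\<pi> g \<in> Bij (carrier N)"
    by (auto simp: auto_def Bij_def)
qed

lemma \<pi>_mult:
  assumes "g \<in> carrier G" "h \<in> carrier G" "n \<in> carrier N"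
  shows "\<pi> (g \<otimes>\<^bsub>G\<^esub> h) n = \<pi> g (\<pi> h n)"
proof -
  have "\<pi> (g \<otimes>\<^bsub>G\<^esub> h) = \<pi> g \<otimes>\<^bsub>LieAut N\<^esub> \<pi> h" using \<pi>_hom assms by (auto simp: hom_def)
  also have "\<dots> = compose (carrier N) (\<pi> g) (\<pi> h)"
    using \<pi>_facts(4)[OF assms(1)] \<pi>_facts(4)[OF assms(2)] by (simp add: LieAut_def BijGroup_def)
  finally show ?thesis using assms by (simp add: compose_def)
qed

text \<open>Multiplicativity makes \<pi> of the identity an idempotent map, and an injective
  idempotent map is the identity.\<close>

lemma \<pi>_one:
  assumes "n \<in> carrier N"
  shows "\<pi> \<one>\<^bsub>G\<^esub> n = n"
proof -
  note b = \<pi>_facts(2)[OF G.one_closed]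
  have "\<pi> \<one>\<^bsub>G\<^esub> n \<in> carrier N" using b assms by (auto simp: bij_betw_def)
  moreover have "\<pi> \<one>\<^bsub>G\<^esub> (\<pi> \<one>\<^bsub>G\<^esub> n) = \<pi> \<one>\<^bsub>G\<^esub> n" using \<pi>_mult[of "\<one>\<^bsub>G\<^esub>" "\<one>\<^bsub>G\<^esub>" n] assms by simp
  ultimately show ?thesis using b assms by (auto simp: bij_betw_def inj_on_def)
qed

lemma \<pi>_N_one: "g \<in> carrier G \<Longrightarrow> \<pi> g \<one>\<^bsub>N\<^esub> = \<one>\<^bsub>N\<^esub>"
  using hom_one[OF \<pi>_facts(1)] N.is_group by blast

definition act_coord :: "'g \<Rightarrow> 'e \<Rightarrow> 'e" where "act_coord g y = N.co (\<pi> g (N.pt y))"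

definition L :: "'g \<Rightarrow> 'e \<Rightarrow> 'e" where "L g = frechet_derivative (act_coord g) (at 0)"

lemma act_coord_zero: "g \<in> carrier G \<Longrightarrow> act_coord g 0 = 0"
  by (simp add: act_coord_def N.pt_zero \<pi>_N_one N.co_def)

lemma act_coord_derivative:
  assumes "g \<in> carrier G"
  shows "(act_coord g has_derivative L g) (at 0)"
proof -
  have 1: "c11_at (\<lambda>x. \<phi> (\<pi> g (inv_into U \<phi> x)) + (- \<phi> \<one>\<^bsub>N\<^esub>)) (\<phi> \<one>\<^bsub>N\<^esub>)"
    using smooth_map_c11[OF \<pi>_facts(3)[OF assms] N.chart N.chart N.one_U] N.one_U \<pi>_N_one[OF assms]
    by (intro c11_at_add_const) simp
  have 2: "c11_at (\<lambda>x::'e. x + \<phi> \<one>\<^bsub>N\<^esub>) 0"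
    by (intro c11_at_add_const c11_at_bounded_linear bounded_linear_ident)
  have "c11_at (act_coord g) 0"
    using c11_at_compose[OF 2 1] by (simp add: act_coord_def[abs_def] N.pt_def N.co_def)
  then show ?thesis unfolding L_def by (rule c11_at_differentiable)
qed

lemma act_coord_near_one:
  assumes "g \<in> carrier G"
  shows "\<exists>r>0. \<forall>v. norm v < r \<longrightarrow> v \<in> N.dom \<and> \<pi> g (N.pt v) \<in> U"
proof -
  have "continuous_map (topol (mfd N)) (topol (mfd N)) (\<pi> g)" using \<pi>_facts(3)[OF assms] by (simp add: smooth_map_def)
  then have o: "openin (topol (mfd N)) {x \<in> topspace (topol (mfd N)). \<pi> g x \<in> U}"
    using N.chart_U(1) by (rule openin_continuous_map_preimage)
  have "\<one>\<^bsub>N\<^esub> \<in> {x \<in> topspace (topol (mfd N)). \<pi> g x \<in> U}" using \<pi>_N_one[OF assms] N.one_U N.lie_facts(2) by simp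
  from N.pt_nbhd[OF o this] show ?thesis by blast
qed

lemma L_mult:
  assumes g: "g \<in> carrier G" and h: "h \<in> carrier G"
  shows "L (g \<otimes>\<^bsub>G\<^esub> h) v = L g (L h v)"
proof -
  obtain r where r: "r > 0" "\<And>v. norm v < r \<Longrightarrow> v \<in> N.dom \<and> \<pi> h (N.pt v) \<in> U"
    using act_coord_near_one[OF h] by blast
  have "(act_coord g has_derivative L g) (at (act_coord h 0))"
    using act_coord_derivative[OF g] by (simp add: act_coord_zero[OF h])
  from has_derivative_compose[OF act_coord_derivative[OF h] this]
  have 1: "((\<lambda>v. act_coord g (act_coord h v)) has_derivative (\<lambda>v. L g (L h v))) (at 0)" .
  have "(act_coord (g \<otimes>\<^bsub>G\<^esub> h) has_derivative (\<lambda>v. L g (L h v))) (at 0)"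
  proof (rule has_derivative_transform_within_open[OF 1, of "ball 0 r"])
    fix v :: 'e assume "v \<in> ball 0 r"
    then have v: "v \<in> N.dom" "\<pi> h (N.pt v) \<in> U" using r(2)[of v] by auto
    then show "act_coord g (act_coord h v) = act_coord (g \<otimes>\<^bsub>G\<^esub> h) v"
      using \<pi>_mult[OF g h N.U_carrier[OF N.pt_in_U[OF v(1)]]] by (simp add: act_coord_def N.pt_co)
  qed (use r in auto)
  from has_derivative_unique[OF act_coord_derivative this] show ?thesis using g h by (simp add: fun_eq_iff)
qed

lemma L_one: "L \<one>\<^bsub>G\<^esub> v = v"
proof -
  obtain r where r: "r > 0" "\<And>v. norm v < r \<Longrightarrow> v \<in> N.dom \<and> N.pt v \<in> U"
    using N.pt_nbhd[OF N.chart_U(1) N.one_U] by blast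
  have "(act_coord \<one>\<^bsub>G\<^esub> has_derivative (\<lambda>v. v)) (at 0)"
  proof (rule has_derivative_transform_within_open[OF has_derivative_ident, of "ball 0 r"])
    fix v :: 'e assume "v \<in> ball 0 r"
    then have "v \<in> N.dom" using r(2)[of v] by auto
    then show "v = act_coord \<one>\<^bsub>G\<^esub> v"
      using \<pi>_one N.U_carrier N.pt_in_U by (simp add: act_coord_def N.co_pt)
  qed (use r in auto)
  from has_derivative_unique[OF act_coord_derivative[OF G.one_closed] this] show ?thesis by (simp add: fun_eq_iff)
qed

lemma \<pi>_nbhd:
  assumes "g \<in> carrier G" "n \<in> carrier N" "openin (topol (mfd N)) W" "\<pi> g n \<in> W"
  shows "\<exists>A B. openin (topol (mfd G)) A \<and> openin (topol (mfd N)) B \<and> g \<in> A \<and> n \<in> B \<and> (\<forall>x\<in>A. \<forall>y\<in>B. \<pi> x y \<in> W)"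
  using assms N.lie_facts(2) G.lie_facts(2)
  by (intro continuous_map_prod_nbhd[OF \<pi>_continuous[unfolded continuous_action_def]]) auto

text \<open>The three analytic axioms use joint continuity of the action at different points:
  \<open>quadratic\<close> at (g, 1), \<open>L_cont\<close> at (g, pt(s x)) for one small s, and
  \<open>a_inv\<close> at (inv g, 1).\<close>

theorem lie_action_of_charts:
  assumes ballN: "lie_ball N N.pt FN R0N RN CN" and domN: "\<And>v. norm v < R0N \<Longrightarrow> v \<in> N.dom"
    and ballG: "lie_ball G G.pt FG R0G RG CG" and domG: "\<And>v. norm v < R0G \<Longrightarrow> v \<in> G.dom"
  shows "lie_action N N.pt FN R0N RN CN G G.pt FG R0G RG CG \<pi> L"
proof -
  interpret BN: lie_ball N N.pt FN R0N RN CN by (rule ballN)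
  interpret BG: lie_ball G G.pt FG R0G RG CG by (rule ballG)
  have dN: "v \<in> N.dom" if "norm v < RN" for v using domN[of v] that BN.R_le by simp
  have cl: "g \<otimes>\<^bsub>G\<^esub> G.pt w \<in> carrier G" if "g \<in> carrier G" "norm w < RG" for g w
    using that BG.pt_closed' by simp
  have lin: "linear (L g)" if "g \<in> carrier G" for g
    using act_coord_derivative[OF that] has_derivative_linear by blast
  have quadratic: "\<exists>\<delta>>0. \<forall>w. norm w < \<delta> \<longrightarrow> (\<forall>y. norm y < \<delta> \<longrightarrow>
        (\<exists>z. norm z < RN \<and> \<pi> (g \<otimes>\<^bsub>G\<^esub> G.pt w) (N.pt y) = N.pt z \<and>
          \<delta> * norm (z - L (g \<otimes>\<^bsub>G\<^esub> G.pt w) y) \<le> (norm y)\<^sup>2 \<and> \<delta> * norm (L (g \<otimes>\<^bsub>G\<^esub> G.pt w) y) \<le> norm y))"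
    if g: "g \<in> carrier G" for g
  proof -
    define W where "W = {x \<in> U. norm (N.co x) < RN / 2}"
    have "\<pi> g \<one>\<^bsub>N\<^esub> \<in> W" using N.one_pt_ball[of "RN / 2"] BN.R_pos \<pi>_N_one[OF g] by (simp add: W_def)
    then obtain A B where AB: "openin (topol (mfd G)) A" "openin (topol (mfd N)) B" "g \<in> A" "\<one>\<^bsub>N\<^esub> \<in> B" "\<forall>x\<in>A. \<forall>y\<in>B. \<pi> x y \<in> W"
      using \<pi>_nbhd[OF g N.one_closed, of W] N.openin_pt_ball unfolding W_def by blast
    obtain r1 where r1: "r1 > 0" "\<And>w. norm w < r1 \<Longrightarrow> g \<otimes>\<^bsub>G\<^esub> G.pt w \<in> A" using G.pt_nbhd_at[OF g AB(1,3)] by blast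
    obtain r2 where r2: "r2 > 0" "\<And>v. norm v < r2 \<Longrightarrow> N.pt v \<in> B" using N.pt_nbhd[OF AB(2,4)] by blast
    define \<rho> where "\<rho> = min (r2 / 2) (RN / 2)"
    have \<rho>: "0 < \<rho>" "\<rho> < RN" "\<rho> < r2" using r2 BN.R_pos by (auto simp: \<rho>_def)
    obtain r K where rK: "0 < r" "0 < K" and Q: "\<forall>\<theta> f L'. \<theta> \<in> hom N N \<longrightarrow>
      (\<forall>y. norm y \<le> \<rho> \<longrightarrow> norm (f y) \<le> RN / 2 \<and> \<theta> (N.pt y) = N.pt (f y)) \<longrightarrow>
      (f has_derivative L') (at 0) \<longrightarrow>
      (\<forall>y. norm y \<le> r \<longrightarrow> norm (f y - L' y) \<le> K * (norm y)\<^sup>2 \<and> norm (f y) \<le> K * norm y)"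
      using BN.hom_quadratic[OF \<rho>(1,2)] by (elim exE conjE) (rule that)
    \<comment> \<open>The last entry makes both K and K (1 + r) at most 1 / \<delta>, as the axiom
      with a single \<delta> demands. K (1 + r) bounds L, since |L y| \<le> |f y| + |f y - L y| for
      the coordinate map f.\<close>
    define \<delta> where "\<delta> = min (min r1 RG) (min (min r \<rho>) (1 / (K * (1 + r))))"
    have \<delta>: "\<delta> > 0" "\<delta> \<le> r1" "\<delta> \<le> RG" "\<delta> \<le> r" "\<delta> \<le> \<rho>" using r1 rK \<rho> BG.R_pos by (auto simp: \<delta>_def)
    have "\<delta> \<le> 1 / (K * (1 + r))" by (simp add: \<delta>_def)
    then have K1: "\<delta> * (K * (1 + r)) \<le> 1" using rK by (simp add: pos_le_divide_eq)
    have K2: "\<delta> * K \<le> 1"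
    proof -
      have "\<delta> * (K * 1) \<le> \<delta> * (K * (1 + r))" using \<delta> rK by (intro mult_left_mono) auto
      then show ?thesis using K1 by simp
    qed
    show ?thesis
    proof (intro exI[of _ \<delta>] conjI allI impI \<delta>(1))
      fix w :: 'f and y :: 'e assume w: "norm w < \<delta>" and y: "norm y < \<delta>"
      define h where "h = g \<otimes>\<^bsub>G\<^esub> G.pt w"
      have h: "h \<in> carrier G" "h \<in> A" using cl[OF g] r1(2) w \<delta> by (auto simp: h_def)
      have f: "\<forall>y. norm y \<le> \<rho> \<longrightarrow> norm (act_coord h y) \<le> RN / 2 \<and> \<pi> h (N.pt y) = N.pt (act_coord h y)"
      proof (intro allI impI)
        fix y :: 'e assume "norm y \<le> \<rho>"
        then have "\<pi> h (N.pt y) \<in> W" using AB(5) h r2(2)[of y] \<rho> by simp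
        then show "norm (act_coord h y) \<le> RN / 2 \<and> \<pi> h (N.pt y) = N.pt (act_coord h y)"
          by (simp add: W_def act_coord_def N.pt_co)
      qed
      have "norm y \<le> r" using y \<delta> by simp
      from Q[THEN spec, THEN spec, THEN spec, THEN mp, OF \<pi>_facts(1)[OF h(1)], THEN mp, OF f,
          THEN mp, OF act_coord_derivative[OF h(1)], rule_format, OF this]
      have Qy: "norm (act_coord h y - L h y) \<le> K * (norm y)\<^sup>2" "norm (act_coord h y) \<le> K * norm y" by auto
      have "\<delta> * norm (act_coord h y - L h y) \<le> \<delta> * (K * (norm y)\<^sup>2)" using Qy \<delta> by (intro mult_left_mono) auto
      also have "\<dots> = (\<delta> * K) * (norm y)\<^sup>2" by simp
      also have "\<dots> \<le> 1 * (norm y)\<^sup>2" using K2 by (intro mult_right_mono) auto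
      finally have 1: "\<delta> * norm (act_coord h y - L h y) \<le> (norm y)\<^sup>2" by simp
      have "K * (norm y)\<^sup>2 \<le> K * (r * norm y)"
        using y \<delta> rK by (intro mult_left_mono) (auto simp: power2_eq_square intro!: mult_right_mono)
      then have "norm (L h y) \<le> K * (1 + r) * norm y"
        using Qy norm_triangle_ineq4[of "act_coord h y" "act_coord h y - L h y"] by (simp add: algebra_simps)
      then have "\<delta> * norm (L h y) \<le> \<delta> * (K * (1 + r) * norm y)" using \<delta> by (intro mult_left_mono) auto
      also have "\<dots> = (\<delta> * (K * (1 + r))) * norm y" by simp
      also have "\<dots> \<le> 1 * norm y" using K1 by (intro mult_right_mono) auto
      finally have 2: "\<delta> * norm (L h y) \<le> norm y" by simp
      have "norm (act_coord h y) < RN" using f[rule_format, of y] y \<delta> BN.R_pos by auto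
      then show "\<exists>z. norm z < RN \<and> \<pi> (g \<otimes>\<^bsub>G\<^esub> G.pt w) (N.pt y) = N.pt z \<and>
          \<delta> * norm (z - L (g \<otimes>\<^bsub>G\<^esub> G.pt w) y) \<le> (norm y)\<^sup>2 \<and> \<delta> * norm (L (g \<otimes>\<^bsub>G\<^esub> G.pt w) y) \<le> norm y"
        unfolding h_def[symmetric] using f[rule_format, of y] y \<delta> 1 2 by (intro exI[of _ "act_coord h y"]) auto
    qed
  qed
  have L_cont: "\<exists>\<delta>>0. \<forall>w. norm w < \<delta> \<longrightarrow> norm (L (g \<otimes>\<^bsub>G\<^esub> G.pt w) x - L g x) < \<epsilon>"
    if g: "g \<in> carrier G" and "0 < \<epsilon>" for g x \<epsilon>
  proof -
    obtain \<delta> where "\<delta> > 0" and q: "\<And>w y. norm w < \<delta> \<Longrightarrow> norm y < \<delta> \<Longrightarrow>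
        \<exists>z. norm z < RN \<and> \<pi> (g \<otimes>\<^bsub>G\<^esub> G.pt w) (N.pt y) = N.pt z \<and> \<delta> * norm (z - L (g \<otimes>\<^bsub>G\<^esub> G.pt w) y) \<le> (norm y)\<^sup>2"
      using quadratic[OF g] by blast
    define \<kappa> where "\<kappa> = min \<delta> RN"
    have \<kappa>: "\<kappa> > 0" "\<kappa> \<le> \<delta>" "\<kappa> \<le> RN" using \<open>\<delta> > 0\<close> BN.R_pos by (auto simp: \<kappa>_def)
    \<comment> \<open>s is fixed before h: it is so small that L g x and L h x are, up to \<epsilon>
      / 8 each, the coordinates of \<pi> g n and \<pi> h n divided by s. Only then is h brought so
      close to g that these coordinates differ by less than s \<epsilon> / 2.\<close>
    define s where "s = min (\<kappa> / (norm x + 1) / 2) (\<epsilon> * \<delta> / (8 * ((norm x)\<^sup>2 + 1)))"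
    have x1: "norm x + 1 > 0" "(norm x)\<^sup>2 + 1 > 0" by (auto intro: add_nonneg_pos)
    have s: "s > 0" using \<open>\<delta> > 0\<close> \<kappa> \<open>0 < \<epsilon>\<close> x1 by (simp add: s_def)
    have "s \<le> \<kappa> / (norm x + 1) / 2" "s \<le> \<epsilon> * \<delta> / (8 * ((norm x)\<^sup>2 + 1))" by (auto simp: s_def)
    then have s1: "s * (norm x + 1) \<le> \<kappa> / 2" "s * (8 * ((norm x)\<^sup>2 + 1)) \<le> \<epsilon> * \<delta>"
      using x1 by (simp_all add: pos_le_divide_eq algebra_simps)
    have "norm (s *\<^sub>R x) \<le> s * (norm x + 1)" using s by simp
    then have sx: "norm (s *\<^sub>R x) < \<kappa>" using s1 \<kappa> by linarith
    then have sx\<delta>: "norm (s *\<^sub>R x) < \<delta>" using \<kappa> by simp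
    define n where "n = N.pt (s *\<^sub>R x)"
    have nc: "n \<in> carrier N" using sx \<kappa> BN.pt_closed' by (simp add: n_def)
    obtain z0 where z0: "norm z0 < RN" "\<pi> g n = N.pt z0" "\<delta> * norm (z0 - L g (s *\<^sub>R x)) \<le> (norm (s *\<^sub>R x))\<^sup>2"
      using q[of 0, OF _ sx\<delta>] g \<open>\<delta> > 0\<close> by (auto simp: BG.pt_0 n_def)
    define W where "W = {x \<in> U. \<phi> x \<in> ball (\<phi> (\<pi> g n)) (s * \<epsilon> / 2)}"
    have "openin (topol (mfd N)) W" unfolding W_def by (rule chart_vimage_open[OF N.lie_facts(1) N.chart open_ball])
    moreover have "\<pi> g n \<in> W" using z0 N.pt_in_U[OF dN[OF z0(1)]] s \<open>0 < \<epsilon>\<close> by (simp add: W_def)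
    ultimately obtain A B where AB: "openin (topol (mfd G)) A" "g \<in> A" "n \<in> B" "\<forall>x\<in>A. \<forall>y\<in>B. \<pi> x y \<in> W"
      using \<pi>_nbhd[OF g nc, of W] by blast
    obtain r where r: "r > 0" "\<And>w. norm w < r \<Longrightarrow> g \<otimes>\<^bsub>G\<^esub> G.pt w \<in> A" using G.pt_nbhd_at[OF g AB(1,2)] by blast
    show ?thesis
    proof (intro exI[of _ "min (min \<delta> r) RG"] conjI allI impI)
      fix w :: 'f assume w: "norm w < min (min \<delta> r) RG"
      define h where "h = g \<otimes>\<^bsub>G\<^esub> G.pt w"
      have h: "h \<in> carrier G" "\<pi> h n \<in> W" using cl[OF g] r(2)[of w] w AB by (auto simp: h_def)
      obtain z where z: "norm z < RN" "\<pi> h n = N.pt z" "\<delta> * norm (z - L h (s *\<^sub>R x)) \<le> (norm (s *\<^sub>R x))\<^sup>2"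
        using q[OF _ sx\<delta>, of w] w by (auto simp: n_def h_def)
      have "N.co (\<pi> h n) = z" "N.co (\<pi> g n) = z0" using z z0 N.co_pt dN by simp_all
      then have zz: "norm (z - z0) < s * \<epsilon> / 2"
        using h(2) by (auto simp: W_def N.co_def dist_norm norm_minus_commute)
      have "(norm (s *\<^sub>R x))\<^sup>2 = s * (s * (norm x)\<^sup>2)" using s by (simp add: power_mult_distrib power2_eq_square)
      also have "\<dots> \<le> s * (s * ((norm x)\<^sup>2 + 1))" using s by (intro mult_left_mono) auto
      also have "\<dots> \<le> s * (\<epsilon> * \<delta> / 8)"
        by (rule mult_left_mono) (use s s1(2) in \<open>simp_all add: algebra_simps\<close>)
      finally have b: "(norm (s *\<^sub>R x))\<^sup>2 \<le> \<delta> * (s * \<epsilon> / 8)" by (simp add: mult_ac)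
      have b1: "norm (z - L h (s *\<^sub>R x)) \<le> s * \<epsilon> / 8" "norm (z0 - L g (s *\<^sub>R x)) \<le> s * \<epsilon> / 8"
        using order_trans[OF z(3) b] order_trans[OF z0(3) b] mult_le_cancel_left_pos[OF \<open>\<delta> > 0\<close>] by blast+
      have e: "s *\<^sub>R (L h x - L g x) = (z - z0) + ((z0 - L g (s *\<^sub>R x)) - (z - L h (s *\<^sub>R x)))"
        using lin[OF g] lin[OF h(1)] by (simp add: linear_cmul scaleR_diff_right)
      have "norm (s *\<^sub>R (L h x - L g x)) \<le> norm (z - z0) + (s * \<epsilon> / 8 + s * \<epsilon> / 8)"
        unfolding e by (rule norm_triangle_mono[OF order_refl norm_triangle_le_diff[OF add_mono[OF b1(2,1)]]])
      moreover have "norm (s *\<^sub>R (L h x - L g x)) = s * norm (L h x - L g x)" using s by simp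
      ultimately have "s * norm (L h x - L g x) < s * \<epsilon>"
        using zz mult_pos_pos[OF s \<open>0 < \<epsilon>\<close>] by linarith
      then show "norm (L (g \<otimes>\<^bsub>G\<^esub> G.pt w) x - L g x) < \<epsilon>" using s by (simp add: h_def)
    qed (use \<open>\<delta> > 0\<close> r BG.R_pos in auto)
  qed
  have a_inv: "\<exists>\<delta>>0. \<forall>w. norm w < \<delta> \<longrightarrow> (\<forall>y. norm y < \<delta> \<longrightarrow>
          (\<exists>z. norm z < \<epsilon> \<and> \<pi> (inv\<^bsub>G\<^esub> (g \<otimes>\<^bsub>G\<^esub> G.pt w)) (N.pt y) = N.pt z))"
    if g: "g \<in> carrier G" and "0 < \<epsilon>" for g \<epsilon>
  proof -
    define W where "W = {x \<in> U. norm (N.co x) < \<epsilon>}"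
    have "\<pi> (inv\<^bsub>G\<^esub> g) \<one>\<^bsub>N\<^esub> \<in> W" using N.one_pt_ball[OF \<open>0 < \<epsilon>\<close>] \<pi>_N_one[of "inv\<^bsub>G\<^esub> g"] g by (simp add: W_def)
    then obtain A B where AB: "openin (topol (mfd G)) A" "openin (topol (mfd N)) B" "inv\<^bsub>G\<^esub> g \<in> A" "\<one>\<^bsub>N\<^esub> \<in> B" "\<forall>x\<in>A. \<forall>y\<in>B. \<pi> x y \<in> W"
      using \<pi>_nbhd[OF G.inv_closed[OF g] N.one_closed, of W] N.openin_pt_ball unfolding W_def by blast
    have o: "openin (topol (mfd G)) {x \<in> topspace (topol (mfd G)). inv\<^bsub>G\<^esub> x \<in> A}"
      by (rule openin_continuous_map_preimage[OF G.continuous_inv AB(1)])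
    have "g \<in> {x \<in> topspace (topol (mfd G)). inv\<^bsub>G\<^esub> x \<in> A}" using g AB G.lie_facts(2) by simp
    from G.pt_nbhd_at[OF g o this]
    obtain r1 where r1: "r1 > 0" "\<And>w. norm w < r1 \<Longrightarrow> inv\<^bsub>G\<^esub> (g \<otimes>\<^bsub>G\<^esub> G.pt w) \<in> A" by blast
    obtain r2 where r2: "r2 > 0" "\<And>v. norm v < r2 \<Longrightarrow> N.pt v \<in> B" using N.pt_nbhd[OF AB(2,4)] by blast
    show ?thesis
    proof (intro exI[of _ "min r1 r2"] conjI allI impI)
      fix w :: 'f and y :: 'e assume "norm w < min r1 r2" "norm y < min r1 r2"
      then have "\<pi> (inv\<^bsub>G\<^esub> (g \<otimes>\<^bsub>G\<^esub> G.pt w)) (N.pt y) \<in> W" using AB(5) r1(2) r2(2) by simp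
      then show "\<exists>z. norm z < \<epsilon> \<and> \<pi> (inv\<^bsub>G\<^esub> (g \<otimes>\<^bsub>G\<^esub> G.pt w)) (N.pt y) = N.pt z"
        by (intro exI[of _ "N.co (\<pi> (inv\<^bsub>G\<^esub> (g \<otimes>\<^bsub>G\<^esub> G.pt w)) (N.pt y))"]) (simp add: W_def N.pt_co)
    qed (use r1 r2 in auto)
  qed
  show ?thesis
    by (rule lie_action.intro[OF ballN ballG lie_action_axioms.intro])
       (rule \<pi>_facts(1) \<pi>_mult \<pi>_one lin L_mult L_one quadratic L_cont a_inv; assumption)+
qed

end

section \<open>The exponential function of the semidirect product\<close>

lemma continuous_map_real_nbhd:
  assumes "continuous_map (top_of_set S) X f" "t \<in> S" "openin X W" "f t \<in> W"
  shows "\<exists>\<delta>>0. \<forall>s\<in>S. \<bar>s - t\<bar> < (\<delta>::real) \<longrightarrow> f s \<in> W"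
proof -
  have "openin (top_of_set S) {x \<in> topspace (top_of_set S). f x \<in> W}"
    by (rule openin_continuous_map_preimage[OF assms(1,3)])
  then show ?thesis using assms(2,4) unfolding openin_euclidean_subtopology_iff dist_real_def by fastforce
qed

text \<open>\<open>tangent_map\<close> reads a tangent vector in the chart picked by SOME. The
  charts of N and G are therefore the factors of the chart picked at the identity of H, and tangent
  vectors at the identity are evaluated there.\<close>

locale semidirect_charts = lie_chart_action N U \<phi> G V \<psi> \<pi> +
    BN: lie_chart_ball N U \<phi> FN R0N RN CN + BG: lie_chart_ball G V \<psi> FG R0G RG CG
  for N :: "('n, 'e::banach) manifold_group" and U \<phi>
    and G :: "('g, 'f::banach) manifold_group" and V \<psi> \<pi> FN R0N RN CN FG R0G RG CG +
  fixes H :: "('n \<times> 'g, 'e \<times> 'f) manifold_group"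
  assumes H_eq: "H = semidirect_product N \<pi> G"
    and some_chart: "(SOME c. c \<in> atlas (mfd H) \<and> \<one>\<^bsub>H\<^esub> \<in> fst c) = (U \<times> V, map_prod \<phi> \<psi>)"
begin

sublocale A: lie_action N N.pt FN R0N RN CN G G.pt FG R0G RG CG \<pi> L
  using BN.lie_ball_axioms BN.ball_dom BG.lie_ball_axioms BG.ball_dom by (rule lie_action_of_charts)

abbreviation base_chart :: "('n \<times> 'g, 'e \<times> 'f) chart" where "base_chart \<equiv> (U \<times> V, map_prod \<phi> \<psi>)"

lemma H_simps:
  "carrier H = carrier N \<times> carrier G" "\<one>\<^bsub>H\<^esub> = (\<one>\<^bsub>N\<^esub>, \<one>\<^bsub>G\<^esub>)"
  "(n, g) \<otimes>\<^bsub>H\<^esub> (m, h) = (n \<otimes>\<^bsub>N\<^esub> \<pi> g m, g \<otimes>\<^bsub>G\<^esub> h)"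
  "mfd H = prod_manifold (mfd N) (mfd G)" "topol (mfd H) = prod_topology (topol (mfd N)) (topol (mfd G))"
  by (simp_all add: H_eq semidirect_product_def prod_manifold_def)

lemma mult_H: "p \<otimes>\<^bsub>H\<^esub> q = (fst p \<otimes>\<^bsub>N\<^esub> \<pi> (snd p) (fst q), snd p \<otimes>\<^bsub>G\<^esub> snd q)"
  by (cases p; cases q) (simp add: H_simps)

lemma atlas_H: "(W, \<omega>) \<in> atlas (mfd H) \<longleftrightarrow>
    (\<exists>U1 \<phi>1 V1 \<psi>1. W = U1 \<times> V1 \<and> \<omega> = map_prod \<phi>1 \<psi>1 \<and> (U1, \<phi>1) \<in> atlas (mfd N) \<and> (V1, \<psi>1) \<in> atlas (mfd G))"
  by (auto simp: H_simps prod_manifold_def)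

text \<open>With g fixed, the first component is m -> n \<pi>(g)(m), and the single map \<pi> g is
  smooth; so left translations of H are differentiable although the action is only continuous in
  g.\<close>

lemma left_translation_derivative:
  assumes c: "(U1, \<phi>1) \<in> atlas (mfd N)" "(V1, \<psi>1) \<in> atlas (mfd G)" and ng: "n \<in> U1" "g \<in> V1"
  shows "((map_prod \<phi>1 \<psi>1 \<circ> (\<lambda>y. (n, g) \<otimes>\<^bsub>H\<^esub> y) \<circ> inv_into (U \<times> V) (map_prod \<phi> \<psi>)) has_derivative
      (\<lambda>p. (N.left_deriv n \<phi>1 (L g (fst p)), G.left_deriv g \<psi>1 (snd p)))) (at (map_prod \<phi> \<psi> \<one>\<^bsub>H\<^esub>))"
proof -
  have gG: "g \<in> carrier G" using chart_facts(3)[OF G.lie_facts(1) c(2)] G.lie_facts(2) ng by auto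
  obtain r where r: "r > 0" "\<And>v. norm v < r \<Longrightarrow> v \<in> N.dom \<and> \<pi> g (N.pt v) \<in> U"
    using act_coord_near_one[OF gG] by blast
  have "((\<lambda>v. \<phi>1 (n \<otimes>\<^bsub>N\<^esub> N.pt v)) has_derivative N.left_deriv n \<phi>1) (at (act_coord g 0))"
    using N.left_deriv[OF c(1) ng(1)] by (simp add: act_coord_zero[OF gG])
  from has_derivative_compose[OF act_coord_derivative[OF gG] this]
  have "((\<lambda>v. \<phi>1 (n \<otimes>\<^bsub>N\<^esub> \<pi> g (N.pt v))) has_derivative (\<lambda>v. N.left_deriv n \<phi>1 (L g v))) (at 0)"
    by (rule has_derivative_transform_within_open[of _ _ _ _ "ball 0 r"])
       (use r N.pt_co in \<open>auto simp: act_coord_def\<close>)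
  then have "((\<lambda>v. \<phi>1 (n \<otimes>\<^bsub>N\<^esub> \<pi> g (N.pt v))) has_derivative (\<lambda>v. N.left_deriv n \<phi>1 (L g v))) (at (fst (\<phi> \<one>\<^bsub>N\<^esub>, \<psi> \<one>\<^bsub>G\<^esub>) - \<phi> \<one>\<^bsub>N\<^esub>))"
    by simp
  moreover have "((\<lambda>p::'e \<times> 'f. fst p - \<phi> \<one>\<^bsub>N\<^esub>) has_derivative fst) (at (\<phi> \<one>\<^bsub>N\<^esub>, \<psi> \<one>\<^bsub>G\<^esub>))"
    by (auto intro!: derivative_eq_intros)
  ultimately have 1: "((\<lambda>p. \<phi>1 (n \<otimes>\<^bsub>N\<^esub> \<pi> g (N.pt (fst p - \<phi> \<one>\<^bsub>N\<^esub>)))) has_derivative (\<lambda>p. N.left_deriv n \<phi>1 (L g (fst p)))) (at (\<phi> \<one>\<^bsub>N\<^esub>, \<psi> \<one>\<^bsub>G\<^esub>))"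
    using has_derivative_compose by blast
  have "((\<lambda>v. \<psi>1 (g \<otimes>\<^bsub>G\<^esub> G.pt v)) has_derivative G.left_deriv g \<psi>1) (at (snd (\<phi> \<one>\<^bsub>N\<^esub>, \<psi> \<one>\<^bsub>G\<^esub>) - \<psi> \<one>\<^bsub>G\<^esub>))"
    using G.left_deriv[OF c(2) ng(2)] by simp
  moreover have "((\<lambda>p::'e \<times> 'f. snd p - \<psi> \<one>\<^bsub>G\<^esub>) has_derivative snd) (at (\<phi> \<one>\<^bsub>N\<^esub>, \<psi> \<one>\<^bsub>G\<^esub>))"
    by (auto intro!: derivative_eq_intros)
  ultimately have 2: "((\<lambda>p. \<psi>1 (g \<otimes>\<^bsub>G\<^esub> G.pt (snd p - \<psi> \<one>\<^bsub>G\<^esub>))) has_derivative (\<lambda>p. G.left_deriv g \<psi>1 (snd p))) (at (\<phi> \<one>\<^bsub>N\<^esub>, \<psi> \<one>\<^bsub>G\<^esub>))"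
    using has_derivative_compose by blast
  have "((map_prod \<phi>1 \<psi>1 \<circ> (\<lambda>y. (n, g) \<otimes>\<^bsub>H\<^esub> y) \<circ> inv_into (U \<times> V) (map_prod \<phi> \<psi>)) has_derivative
      (\<lambda>p. (N.left_deriv n \<phi>1 (L g (fst p)), G.left_deriv g \<psi>1 (snd p)))) (at (\<phi> \<one>\<^bsub>N\<^esub>, \<psi> \<one>\<^bsub>G\<^esub>))"
  proof (rule has_derivative_transform_within_open[OF has_derivative_Pair[OF 1 2], of "\<phi> ` U \<times> \<psi> ` V"])
    show "open (\<phi> ` U \<times> \<psi> ` V)" using N.chart_U(2) G.chart_U(2) by (rule open_Times)
    show "(\<phi> \<one>\<^bsub>N\<^esub>, \<psi> \<one>\<^bsub>G\<^esub>) \<in> \<phi> ` U \<times> \<psi> ` V" using N.one_U G.one_U by simp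
    fix p assume p: "p \<in> \<phi> ` U \<times> \<psi> ` V"
    then have "inv_into (U \<times> V) (map_prod \<phi> \<psi>) p = (inv_into U \<phi> (fst p), inv_into V \<psi> (snd p))"
      using inv_into_map_prod[OF N.chart_U(4) G.chart_U(4), of "fst p" "snd p"] by (simp add: mem_Times_iff)
    then show "(\<phi>1 (n \<otimes>\<^bsub>N\<^esub> \<pi> g (N.pt (fst p - \<phi> \<one>\<^bsub>N\<^esub>))), \<psi>1 (g \<otimes>\<^bsub>G\<^esub> G.pt (snd p - \<psi> \<one>\<^bsub>G\<^esub>))) =
        (map_prod \<phi>1 \<psi>1 \<circ> (\<lambda>y. (n, g) \<otimes>\<^bsub>H\<^esub> y) \<circ> inv_into (U \<times> V) (map_prod \<phi> \<psi>)) p"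
      by (simp add: H_simps N.pt_def G.pt_def)
  qed
  then show ?thesis by (simp add: H_simps)
qed

lemma left_translate_H:
  assumes h: "n \<in> carrier N" "g \<in> carrier G" and X: "X base_chart = (x, y)"
  shows "left_translate H (n, g) X (W, \<omega>) = (if (W, \<omega>) \<in> atlas (mfd H) \<and> (n, g) \<in> W
      then frechet_derivative (\<omega> \<circ> (\<lambda>y. (n, g) \<otimes>\<^bsub>H\<^esub> y) \<circ> inv_into (U \<times> V) (map_prod \<phi> \<psi>)) (at (map_prod \<phi> \<psi> \<one>\<^bsub>H\<^esub>)) (x, y)
      else 0)"
proof -
  have "(n, g) \<otimes>\<^bsub>H\<^esub> \<one>\<^bsub>H\<^esub> = (n, g)" using h by (simp add: H_simps \<pi>_N_one)
  then show ?thesis unfolding left_translate_def tangent_map_def some_chart by (simp add: X)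
qed

lemma left_translate_chart:
  assumes c: "(U1, \<phi>1) \<in> atlas (mfd N)" "(V1, \<psi>1) \<in> atlas (mfd G)" and ng: "n \<in> U1" "g \<in> V1"
    and X: "X base_chart = (x, y)"
  shows "left_translate H (n, g) X (U1 \<times> V1, map_prod \<phi>1 \<psi>1) = (N.left_deriv n \<phi>1 (L g x), G.left_deriv g \<psi>1 y)"
proof -
  have h: "n \<in> carrier N" "g \<in> carrier G"
    using chart_facts(3)[OF G.lie_facts(1) c(2)] chart_facts(3)[OF N.lie_facts(1) c(1)] G.lie_facts(2) N.lie_facts(2) ng by auto
  have "(U1 \<times> V1, map_prod \<phi>1 \<psi>1) \<in> atlas (mfd H)" using c by (auto simp: atlas_H)
  then show ?thesis
    unfolding left_translate_H[of n g X x y, OF h X] frechet_derivative_at[OF left_translation_derivative[OF c ng], symmetric]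
    using ng by simp
qed

lemma C1_curve_H:
  assumes "C1_curve (mfd H) \<gamma>"
  shows "continuous_map (top_of_set {0..1}) (topol (mfd N)) (\<lambda>t. fst (\<gamma> t))"
    "continuous_map (top_of_set {0..1}) (topol (mfd G)) (\<lambda>t. snd (\<gamma> t))"
    "t \<in> {0..1} \<Longrightarrow> fst (\<gamma> t) \<in> carrier N" "t \<in> {0..1} \<Longrightarrow> snd (\<gamma> t) \<in> carrier G"
proof -
  have "continuous_map (top_of_set {0..1}) (prod_topology (topol (mfd N)) (topol (mfd G))) \<gamma>"
    using assms unfolding C1_curve_def H_simps(5)[symmetric] by blast
  then show *: "continuous_map (top_of_set {0..1}) (topol (mfd N)) (\<lambda>t. fst (\<gamma> t))"
    "continuous_map (top_of_set {0..1}) (topol (mfd G)) (\<lambda>t. snd (\<gamma> t))"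
    by (simp_all add: continuous_map_pairwise o_def)
  show "t \<in> {0..1} \<Longrightarrow> fst (\<gamma> t) \<in> carrier N" "t \<in> {0..1} \<Longrightarrow> snd (\<gamma> t) \<in> carrier G"
    using * N.lie_facts(2) G.lie_facts(2) by (auto simp: continuous_map_def Pi_iff)
qed

lemma C1_curve_velocity:
  assumes \<gamma>: "C1_curve (mfd H) \<gamma>" and t: "t \<in> {0..1}"
    and c: "(U1, \<phi>1) \<in> atlas (mfd N)" "(V1, \<psi>1) \<in> atlas (mfd G)" "fst (\<gamma> t) \<in> U1" "snd (\<gamma> t) \<in> V1"
    and v: "velocity (mfd H) \<gamma> t (U1 \<times> V1, map_prod \<phi>1 \<psi>1) = (v, w)"
  shows "((\<lambda>s. \<phi>1 (fst (\<gamma> s))) has_vector_derivative v) (at t within {0..1})"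
    "((\<lambda>s. \<psi>1 (snd (\<gamma> s))) has_vector_derivative w) (at t within {0..1})"
proof -
  have a: "(U1 \<times> V1, map_prod \<phi>1 \<psi>1) \<in> atlas (mfd H)" using c by (auto simp: atlas_H)
  have i: "\<gamma> t \<in> U1 \<times> V1" using c by (simp add: mem_Times_iff)
  have "\<forall>(U, \<phi>)\<in>atlas (mfd H). \<exists>d. continuous_on ({0..1} \<inter> \<gamma> -` U) d \<and>
        (\<forall>t\<in>{0..1} \<inter> \<gamma> -` U. ((\<phi> \<circ> \<gamma>) has_vector_derivative d t) (at t within {0..1}))"
    using \<gamma> unfolding C1_curve_def by blast
  from bspec[OF this a] obtain d where "\<forall>t\<in>{0..1} \<inter> \<gamma> -` (U1 \<times> V1).
      ((map_prod \<phi>1 \<psi>1 \<circ> \<gamma>) has_vector_derivative d t) (at t within {0..1})"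
    unfolding prod.case by blast
  then have "((map_prod \<phi>1 \<psi>1 \<circ> \<gamma>) has_vector_derivative d t) (at t within {0..1})"
    using t i by blast
  moreover have "vector_derivative (map_prod \<phi>1 \<psi>1 \<circ> \<gamma>) (at t within {0..1}) = (v, w)"
    using v a i by (simp add: velocity_def)
  ultimately have d: "((map_prod \<phi>1 \<psi>1 \<circ> \<gamma>) has_vector_derivative (v, w)) (at t within {0..1})"
    by (metis differentiableI_vector vector_derivative_works)
  show "((\<lambda>s. \<phi>1 (fst (\<gamma> s))) has_vector_derivative v) (at t within {0..1})"
    using bounded_linear.has_vector_derivative[OF bounded_linear_fst d] by simp
  show "((\<lambda>s. \<psi>1 (snd (\<gamma> s))) has_vector_derivative w) (at t within {0..1})"
    using bounded_linear.has_vector_derivative[OF bounded_linear_snd d] by simp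
qed

text \<open>At the identity, \<open>left_deriv\<close> in the chosen chart is the identity map, so
  the coordinates of the velocity are already the logarithmic derivative.\<close>

lemma curve0_of_C1_curve:
  assumes \<gamma>: "C1_curve (mfd H) \<gamma>" "\<gamma> 0 = \<one>\<^bsub>H\<^esub>" and v: "velocity (mfd H) \<gamma> 0 base_chart = (v, w)"
  shows "curve0 N.pt (\<lambda>t. fst (\<gamma> t)) v" "curve0 G.pt (\<lambda>t. snd (\<gamma> t)) w"
proof -
  have one: "fst (\<gamma> 0) = \<one>\<^bsub>N\<^esub>" "snd (\<gamma> 0) = \<one>\<^bsub>G\<^esub>" using \<gamma>(2) by (simp_all add: H_simps)
  have z: "(0::real) \<in> {0..1}" by simp
  note d = C1_curve_velocity[OF \<gamma>(1) z N.chart G.chart _ _ v, unfolded one, OF N.one_U G.one_U]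
  have "has_ld N N.pt (\<lambda>t. fst (\<gamma> t)) v 0 {0..1}"
    by (rule BN.ld_of_vector_derivative[OF N.chart])
       (use one N.one_U d N.left_deriv_one C1_curve_H[OF \<gamma>(1)] continuous_map_real_nbhd[OF C1_curve_H(1)[OF \<gamma>(1)] z] in auto)
  then show "curve0 N.pt (\<lambda>t. fst (\<gamma> t)) v" using one by (intro BN.curve0_of_ld)
  have "has_ld G G.pt (\<lambda>t. snd (\<gamma> t)) w 0 {0..1}"
    by (rule BG.ld_of_vector_derivative[OF G.chart])
       (use one G.one_U d G.left_deriv_one C1_curve_H[OF \<gamma>(1)] continuous_map_real_nbhd[OF C1_curve_H(2)[OF \<gamma>(1)] z] in auto)
  then show "curve0 G.pt (\<lambda>t. snd (\<gamma> t)) w" using one by (intro BG.curve0_of_ld)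
qed

text \<open>By \<open>left_translate_chart\<close>, the equation eta' = eta.X is the triangular
  system of two logarithmic derivatives. The chart may be chosen anew for each t, since a velocity
  records its coordinates in all charts.\<close>

lemma ld_of_solution:
  assumes \<eta>: "C1_curve (mfd H) \<eta>" and X: "X base_chart = (x, y)"
    and v: "\<And>t. t \<in> {0..1} \<Longrightarrow> velocity (mfd H) \<eta> t = left_translate H (\<eta> t) X" and t: "t \<in> {0..1}"
  shows "has_ld G G.pt (\<lambda>t. snd (\<eta> t)) y t {0..1}" "has_ld N N.pt (\<lambda>t. fst (\<eta> t)) (L (snd (\<eta> t)) x) t {0..1}"
proof -
  obtain U1 \<phi>1 where U1: "(U1, \<phi>1) \<in> atlas (mfd N)" "fst (\<eta> t) \<in> U1"
    using chart_at[OF N.lie_facts(1)] C1_curve_H(3)[OF \<eta> t] N.lie_facts(2) by blast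
  obtain V1 \<psi>1 where V1: "(V1, \<psi>1) \<in> atlas (mfd G)" "snd (\<eta> t) \<in> V1"
    using chart_at[OF G.lie_facts(1)] C1_curve_H(4)[OF \<eta> t] G.lie_facts(2) by blast
  have "velocity (mfd H) \<eta> t (U1 \<times> V1, map_prod \<phi>1 \<psi>1) =
     (N.left_deriv (fst (\<eta> t)) \<phi>1 (L (snd (\<eta> t)) x), G.left_deriv (snd (\<eta> t)) \<psi>1 y)"
    using left_translate_chart[where X = X and x = x and y = y, OF U1(1) V1(1) U1(2) V1(2) X] v[OF t] by simp
  note d = C1_curve_velocity[OF \<eta> t U1(1) V1(1) U1(2) V1(2) this]
  show "has_ld G G.pt (\<lambda>t. snd (\<eta> t)) y t {0..1}"
    by (rule BG.ld_of_vector_derivative[OF V1(1)])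
       (use V1 t d C1_curve_H[OF \<eta>] continuous_map_real_nbhd[OF C1_curve_H(2)[OF \<eta>] t] in auto)
  show "has_ld N N.pt (\<lambda>t. fst (\<eta> t)) (L (snd (\<eta> t)) x) t {0..1}"
    by (rule BN.ld_of_vector_derivative[OF U1(1)])
       (use U1 t d C1_curve_H[OF \<eta>] continuous_map_real_nbhd[OF C1_curve_H(1)[OF \<eta>] t] in auto)
qed

lemma solution_of_ld:
  assumes c: "\<And>t. t \<in> {0..1} \<Longrightarrow> c t \<in> carrier G \<and> has_ld G G.pt c y t {0..1}"
    and d: "\<And>t. t \<in> {0..1} \<Longrightarrow> d t \<in> carrier N \<and> has_ld N N.pt d (L (c t) x) t {0..1}"
    and X: "X base_chart = (x, y)"
  shows "C1_curve (mfd H) (\<lambda>t. (d t, c t))"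
    "t \<in> {0..1} \<Longrightarrow> velocity (mfd H) (\<lambda>t. (d t, c t)) t = left_translate H (d t, c t) X"
proof -
  have deriv: "((map_prod \<phi>1 \<psi>1 \<circ> (\<lambda>t. (d t, c t))) has_vector_derivative
      (N.left_deriv (d t) \<phi>1 (L (c t) x), G.left_deriv (c t) \<psi>1 y)) (at t within {0..1})"
    if "(U1, \<phi>1) \<in> atlas (mfd N)" "(V1, \<psi>1) \<in> atlas (mfd G)" "t \<in> {0..1}" "d t \<in> U1" "c t \<in> V1" for U1 \<phi>1 V1 \<psi>1 t
    using has_vector_derivative_Pair[OF BN.ld_vector_derivative[OF d[OF that(3), THEN conjunct2] that(3,1,4)]
      BG.ld_vector_derivative[OF c[OF that(3), THEN conjunct2] that(3,2,5)]] by (simp add: o_def)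
  show "C1_curve (mfd H) (\<lambda>t. (d t, c t))"
    unfolding C1_curve_def
  proof (intro conjI ballI)
    show "continuous_map (top_of_set {0..1}) (topol (mfd H)) (\<lambda>t. (d t, c t))"
      unfolding H_simps(5) continuous_map_paired
      using BN.ld_continuous_map[OF d] BG.ld_continuous_map[OF c] by blast
    fix Q assume QH: "Q \<in> atlas (mfd H)"
    obtain W \<omega> where W: "Q = (W, \<omega>)" by (cases Q)
    from QH[unfolded W atlas_H] obtain U1 \<phi>1 V1 \<psi>1
      where "W = U1 \<times> V1" "\<omega> = map_prod \<phi>1 \<psi>1" and c1: "(U1, \<phi>1) \<in> atlas (mfd N)" "(V1, \<psi>1) \<in> atlas (mfd G)"
      by (elim exE conjE) (rule that)
    then have Q: "Q = (U1 \<times> V1, map_prod \<phi>1 \<psi>1)" "(U1, \<phi>1) \<in> atlas (mfd N)" "(V1, \<psi>1) \<in> atlas (mfd G)"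
      using W by simp_all
    \<comment> \<open>The first component is continuous because L is strongly continuous along c;
      this is where the solution becomes C^1 and not merely differentiable.\<close>
    have "continuous_on ({0..1} \<inter> (\<lambda>t. (d t, c t)) -` (U1 \<times> V1)) (\<lambda>t. (N.left_deriv (d t) \<phi>1 (L (c t) x), G.left_deriv (c t) \<psi>1 y))"
      by (intro continuous_on_Pair continuous_on_subset[OF BN.left_deriv_continuous[OF d A.continuous_L[OF c] Q(2)]]
          continuous_on_subset[OF BG.left_deriv_continuous[OF c continuous_on_const Q(3)]]) auto
    then show "case Q of (U, \<phi>) \<Rightarrow> \<exists>d'. continuous_on ({0..1} \<inter> (\<lambda>t. (d t, c t)) -` U) d' \<and>
        (\<forall>t\<in>{0..1} \<inter> (\<lambda>t. (d t, c t)) -` U. ((\<phi> \<circ> (\<lambda>t. (d t, c t))) has_vector_derivative d' t) (at t within {0..1}))"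
      unfolding Q(1) prod.case
      by (intro exI[of _ "\<lambda>t. (N.left_deriv (d t) \<phi>1 (L (c t) x), G.left_deriv (c t) \<psi>1 y)"] conjI ballI deriv[OF Q(2,3)]) auto
  qed
  assume t: "t \<in> {0..1}"
  show "velocity (mfd H) (\<lambda>t. (d t, c t)) t = left_translate H (d t, c t) X"
  proof
    fix Q :: "('n \<times> 'g, 'e \<times> 'f) chart"
    obtain W \<omega> where Q: "Q = (W, \<omega>)" by (cases Q)
    show "velocity (mfd H) (\<lambda>t. (d t, c t)) t Q = left_translate H (d t, c t) X Q"
    proof (cases "(W, \<omega>) \<in> atlas (mfd H) \<and> (d t, c t) \<in> W")
      case True
      from True[THEN conjunct1, unfolded atlas_H] obtain U1 \<phi>1 V1 \<psi>1
        where W: "W = U1 \<times> V1" "\<omega> = map_prod \<phi>1 \<psi>1" "(U1, \<phi>1) \<in> atlas (mfd N)" "(V1, \<psi>1) \<in> atlas (mfd G)"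
        by (elim exE conjE) (rule that)
      then have m: "d t \<in> U1" "c t \<in> V1" using True by auto
      have "vector_derivative (\<omega> \<circ> (\<lambda>t. (d t, c t))) (at t within {0..1}) = (N.left_deriv (d t) \<phi>1 (L (c t) x), G.left_deriv (c t) \<psi>1 y)"
        unfolding W(2) using t by (intro vector_derivative_within_cbox[of 0 1, simplified] deriv[OF W(3,4)] m) auto
      then show ?thesis
        using True left_translate_chart[where X = X and x = x and y = y, OF W(3,4) m X] by (simp add: Q velocity_def W(1,2))
    next
      \<comment> \<open>Off the charts at the point, both sides take the default value 0; so they
        agree as functions on all pairs, not only on charts around the point.\<close>
      case False
      then show ?thesis
        using left_translate_H[of "d t" "c t" X x y, OF _ _ X] c[OF t] d[OF t] by (auto simp: Q velocity_def)
    qed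
  qed
qed

text \<open>\<open>solution_of_ld\<close> and \<open>ld_semigroup_unique\<close> supply existence
  and uniqueness for the definite description in \<open>lie_exp\<close>; the factor t is moved into
  the time of the curve, s -> t s.\<close>

lemma lie_exp_ld_semigroup:
  assumes sg: "A.ld_semigroup y x c d" and "0 \<le> t" and X: "X base_chart = (t *\<^sub>R x, t *\<^sub>R y)"
  shows "lie_exp H X = (d t, c t)"
  unfolding lie_exp_def
proof (rule the_equality)
  note sg' = A.ld_semigroupD[OF sg]
  have c: "c (t * s) \<in> carrier G \<and> has_ld G G.pt (\<lambda>s. c (t * s)) (t *\<^sub>R y) s {0..1}" if "s \<in> {0..1}" for s
    using that \<open>0 \<le> t\<close> sg'(3) A.ld_semigroup_scale(1)[OF sg \<open>0 \<le> t\<close>] by auto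
  have d: "d (t * s) \<in> carrier N \<and> has_ld N N.pt (\<lambda>s. d (t * s)) (L (c (t * s)) (t *\<^sub>R x)) s {0..1}" if "s \<in> {0..1}" for s
    using that \<open>0 \<le> t\<close> sg'(4) A.ld_semigroup_scale(2)[OF sg \<open>0 \<le> t\<close>] by auto
  show "\<exists>\<eta>. C1_curve (mfd H) \<eta> \<and> \<eta> 0 = \<one>\<^bsub>H\<^esub> \<and>
      (\<forall>t\<in>{0..1}. velocity (mfd H) \<eta> t = left_translate H (\<eta> t) X) \<and> (d t, c t) = \<eta> 1"
    using solution_of_ld[where c = "\<lambda>s. c (t * s)" and d = "\<lambda>s. d (t * s)" and X = X
        and x = "t *\<^sub>R x" and y = "t *\<^sub>R y", OF c d X] sg'(1,2)
    by (intro exI[of _ "\<lambda>s. (d (t * s), c (t * s))"]) (simp add: H_simps)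
  fix z assume "\<exists>\<eta>. C1_curve (mfd H) \<eta> \<and> \<eta> 0 = \<one>\<^bsub>H\<^esub> \<and>
      (\<forall>t\<in>{0..1}. velocity (mfd H) \<eta> t = left_translate H (\<eta> t) X) \<and> z = \<eta> 1"
  then obtain \<eta> where \<eta>: "C1_curve (mfd H) \<eta>" "\<eta> 0 = \<one>\<^bsub>H\<^esub>" "z = \<eta> 1"
      "\<And>t. t \<in> {0..1} \<Longrightarrow> velocity (mfd H) \<eta> t = left_translate H (\<eta> t) X" by blast
  have "snd (\<eta> 1) = c t" "fst (\<eta> 1) = d t"
    using A.ld_semigroup_unique[OF sg \<open>0 \<le> t\<close>, of "\<lambda>t. snd (\<eta> t)" "\<lambda>t. fst (\<eta> t)"]
      ld_of_solution[OF \<eta>(1) X \<eta>(4)] C1_curve_H(3,4)[OF \<eta>(1)] \<eta>(2) by (simp_all add: H_simps)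
  then show "z = (d t, c t)" using \<eta>(3) by (simp add: prod_eq_iff)
qed

theorem trotter_product:
  assumes \<gamma>1: "C1_curve (mfd H) \<gamma>1" "\<gamma>1 0 = \<one>\<^bsub>H\<^esub>" and \<gamma>2: "C1_curve (mfd H) \<gamma>2" "\<gamma>2 0 = \<one>\<^bsub>H\<^esub>"
    and K: "compact K" "K \<subseteq> {0..}"
  shows "group_uniform_limit H K
     (\<lambda>n t. (\<gamma>1 (t / real n) \<otimes>\<^bsub>H\<^esub> \<gamma>2 (t / real n)) [^]\<^bsub>H\<^esub> n)
     (\<lambda>t. lie_exp H (tangent_scale t (tangent_add (velocity (mfd H) \<gamma>1 0) (velocity (mfd H) \<gamma>2 0))))"
proof -
  note H_group = A.semidirect_group[OF H_simps(1-3)]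
  interpret H: group H by (rule H_group(1))
  obtain x1 y1 where v1: "velocity (mfd H) \<gamma>1 0 base_chart = (x1, y1)" by fastforce
  obtain x2 y2 where v2: "velocity (mfd H) \<gamma>2 0 base_chart = (x2, y2)" by fastforce
  note c1 = curve0_of_C1_curve[OF \<gamma>1 v1]
  note c2 = curve0_of_C1_curve[OF \<gamma>2 v2]
  obtain c d where sg: "A.ld_semigroup (y1 + y2) (x1 + x2) c d" using A.ld_semigroup_exists by blast
  note sg' = A.ld_semigroupD[OF sg]
  define \<gamma> where "\<gamma> s = \<gamma>1 s \<otimes>\<^bsub>H\<^esub> \<gamma>2 s" for s
  have \<gamma>eq: "\<gamma> s = (fst (\<gamma>1 s) \<otimes>\<^bsub>N\<^esub> \<pi> (snd (\<gamma>1 s)) (fst (\<gamma>2 s)), snd (\<gamma>1 s) \<otimes>\<^bsub>G\<^esub> snd (\<gamma>2 s))" for s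
    by (simp add: \<gamma>_def mult_H)
  \<comment> \<open>\<open>curve0_act\<close> shows that the action along \<gamma>1 leaves the
    velocity x2 unchanged, and \<open>curve0_mult\<close> adds it to x1.\<close>
  have a: "curve0 N.pt (\<lambda>s. fst (\<gamma> s)) (x1 + x2)"
    using BN.curve0_mult[OF c1(1) A.curve0_act[OF c1(2) c2(1)]] by (simp add: \<gamma>eq)
  have b: "curve0 G.pt (\<lambda>s. snd (\<gamma> s)) (y1 + y2)"
    using BG.curve0_mult[OF c1(2) c2(2)] by (simp add: \<gamma>eq)
  have "lie_exp H (tangent_scale t (tangent_add (velocity (mfd H) \<gamma>1 0) (velocity (mfd H) \<gamma>2 0))) = (d t, c t)" if "t \<in> K" for t
    using that K v1 v2 by (intro lie_exp_ld_semigroup[OF sg]) (auto simp: tangent_scale_def tangent_add_def)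
  note exp = this
  obtain T0 where "\<And>t. t \<in> K \<Longrightarrow> norm t \<le> T0" using compact_imp_bounded[OF K(1)] bounded_iff by blast
  \<comment> \<open>For empty K the bound T0 may be negative, while
    \<open>trotter_convergence\<close> asks for T \<ge> 0; hence |T0|.\<close>
  then have T: "t \<le> \<bar>T0\<bar>" if "t \<in> K" for t using that by fastforce
  have pow: "snd (\<gamma> s [^]\<^bsub>H\<^esub> k) = snd (\<gamma> s) [^]\<^bsub>G\<^esub> k" for s and k :: nat
    by (induction k) (simp_all add: mult_H H_simps(2))
  show ?thesis
    unfolding group_uniform_limit_def
  proof (intro allI impI)
    fix O' assume "\<exists>W. openin (topol (mfd H)) W \<and> \<one>\<^bsub>H\<^esub> \<in> W \<and> W \<subseteq> O'"
    then obtain W where W: "openin (prod_topology (topol (mfd N)) (topol (mfd G))) W" "(\<one>\<^bsub>N\<^esub>, \<one>\<^bsub>G\<^esub>) \<in> W" "W \<subseteq> O'"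
      unfolding H_simps(2,5) by blast
    from openin_prod_topology_alt[THEN iffD1, rule_format, OF W(1,2)]
    obtain WN WG where WNG: "openin (topol (mfd N)) WN" "openin (topol (mfd G)) WG" "\<one>\<^bsub>N\<^esub> \<in> WN" "\<one>\<^bsub>G\<^esub> \<in> WG" "WN \<times> WG \<subseteq> W"
      by (elim exE conjE) (rule that)
    obtain r1 where r1: "r1 > 0" "\<And>v. norm v < r1 \<Longrightarrow> N.pt v \<in> WN" using N.pt_nbhd[OF WNG(1,3)] by blast
    obtain r2 where r2: "r2 > 0" "\<And>v. norm v < r2 \<Longrightarrow> G.pt v \<in> WG" using G.pt_nbhd[OF WNG(2,4)] by blast
    have "min r1 r2 > 0" using r1 r2 by simp
    from A.trotter_convergence[OF sg a b abs_ge_zero this, of T0]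
    obtain s1 where "s1 > 0" and main: "\<And>s n u. 0 \<le> s \<Longrightarrow> s < s1 \<Longrightarrow> real n * s \<le> \<bar>T0\<bar> \<Longrightarrow> u 0 = \<one>\<^bsub>N\<^esub> \<Longrightarrow>
        \<forall>k. u (Suc k) = u k \<otimes>\<^bsub>N\<^esub> \<pi> (snd (\<gamma> s) [^]\<^bsub>G\<^esub> k) (fst (\<gamma> s)) \<Longrightarrow>
        u n \<in> carrier N \<and> snd (\<gamma> s) \<in> carrier G \<and>
        (\<exists>z w. norm z < min r1 r2 \<and> norm w < min r1 r2 \<and> inv\<^bsub>G\<^esub> (c (n * s)) \<otimes>\<^bsub>G\<^esub> (snd (\<gamma> s) [^]\<^bsub>G\<^esub> n) = G.pt w \<and>
         \<pi> (inv\<^bsub>G\<^esub> (c (n * s))) (inv\<^bsub>N\<^esub> (d (n * s)) \<otimes>\<^bsub>N\<^esub> u n) = N.pt z)"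
      by (elim exE conjE) (rule that, assumption, simp only: simp_thms)
    obtain n0 :: nat where n0: "\<bar>T0\<bar> / s1 < real n0" using reals_Archimedean2 by blast
    show "\<forall>\<^sub>F n in sequentially. \<forall>t\<in>K. inv\<^bsub>H\<^esub> (lie_exp H (tangent_scale t (tangent_add (velocity (mfd H) \<gamma>1 0) (velocity (mfd H) \<gamma>2 0)))) \<otimes>\<^bsub>H\<^esub>
          ((\<gamma>1 (t / real n) \<otimes>\<^bsub>H\<^esub> \<gamma>2 (t / real n)) [^]\<^bsub>H\<^esub> n) \<in> O'"
    \<comment> \<open>The successor makes n positive, so that n (t / n) = t.\<close>
    proof (rule eventually_sequentiallyI[of "Suc n0"], intro ballI)
      fix n t assume n: "Suc n0 \<le> n" and t: "t \<in> K"
      define s where "s = t / real n"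
      define u where "u k = fst (\<gamma> s [^]\<^bsub>H\<^esub> k)" for k :: nat
      have t0: "0 \<le> t" using t K by auto
      have ns: "real n * s = t" using n by (simp add: s_def)
      have "\<bar>T0\<bar> < real n0 * s1" using n0 \<open>s1 > 0\<close> by (simp add: divide_less_eq)
      also have "\<dots> \<le> real n * s1" using n \<open>s1 > 0\<close> by (intro mult_right_mono) auto
      finally have "s < s1" using T[OF t] n by (simp add: s_def divide_less_eq mult.commute)
      have "u (Suc k) = u k \<otimes>\<^bsub>N\<^esub> \<pi> (snd (\<gamma> s) [^]\<^bsub>G\<^esub> k) (fst (\<gamma> s))" for k
        by (simp add: u_def mult_H pow)
      then obtain z w where zw: "u n \<in> carrier N" "snd (\<gamma> s) \<in> carrier G" "norm z < min r1 r2" "norm w < min r1 r2"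
         "inv\<^bsub>G\<^esub> (c t) \<otimes>\<^bsub>G\<^esub> (snd (\<gamma> s) [^]\<^bsub>G\<^esub> n) = G.pt w"
         "\<pi> (inv\<^bsub>G\<^esub> (c t)) (inv\<^bsub>N\<^esub> (d t) \<otimes>\<^bsub>N\<^esub> u n) = N.pt z"
        using main[of s n u] t0 \<open>s < s1\<close> T[OF t] n unfolding ns by (auto simp: s_def u_def H_simps)
      have cd: "c t \<in> carrier G" "d t \<in> carrier N" using sg'(3,4) t0 by auto
      have "inv\<^bsub>H\<^esub> (d t, c t) \<otimes>\<^bsub>H\<^esub> (\<gamma> s [^]\<^bsub>H\<^esub> n) =
          (\<pi> (inv\<^bsub>G\<^esub> (c t)) (inv\<^bsub>N\<^esub> (d t)) \<otimes>\<^bsub>N\<^esub> \<pi> (inv\<^bsub>G\<^esub> (c t)) (u n), inv\<^bsub>G\<^esub> (c t) \<otimes>\<^bsub>G\<^esub> (snd (\<gamma> s) [^]\<^bsub>G\<^esub> n))"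
        using H_group(2)[OF cd(2,1)] by (simp add: mult_H u_def pow)
      also have "\<pi> (inv\<^bsub>G\<^esub> (c t)) (inv\<^bsub>N\<^esub> (d t)) \<otimes>\<^bsub>N\<^esub> \<pi> (inv\<^bsub>G\<^esub> (c t)) (u n) = N.pt z"
        using zw(1,6) cd A.act_distrib[of "inv\<^bsub>G\<^esub> (c t)" "inv\<^bsub>N\<^esub> (d t)" "u n"] by simp
      finally have "inv\<^bsub>H\<^esub> (d t, c t) \<otimes>\<^bsub>H\<^esub> (\<gamma> s [^]\<^bsub>H\<^esub> n) = (N.pt z, G.pt w)" using zw(5) by simp
      moreover have "(N.pt z, G.pt w) \<in> O'" using r1(2) r2(2) zw(3,4) WNG(5) W(3) by auto
      ultimately show "inv\<^bsub>H\<^esub> (lie_exp H (tangent_scale t (tangent_add (velocity (mfd H) \<gamma>1 0) (velocity (mfd H) \<gamma>2 0)))) \<otimes>\<^bsub>H\<^esub>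
          ((\<gamma>1 (t / real n) \<otimes>\<^bsub>H\<^esub> \<gamma>2 (t / real n)) [^]\<^bsub>H\<^esub> n) \<in> O'"
        using exp[OF t] by (simp add: \<gamma>_def s_def)
    qed
  qed
qed

end

theorem theorem4p14:
  fixes G :: "('g, 'f::banach) manifold_group"
    and N :: "('n, 'e::banach) manifold_group"
    and \<pi> :: "'g \<Rightarrow> 'n \<Rightarrow> 'n"
    and H :: "('n \<times> 'g, 'e \<times> 'f) manifold_group"
    and \<gamma>1 \<gamma>2 :: "real \<Rightarrow> 'n \<times> 'g"
    and \<alpha>1 \<alpha>2 :: "real \<Rightarrow> 'n"
    and \<beta>1 \<beta>2 :: "real \<Rightarrow> 'g"
  assumes "banach_lie_group G" and "banach_lie_group N"
    and "\<pi> \<in> hom G (LieAut N)"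
    and "continuous_action G N \<pi>"
    and "H = semidirect_product N \<pi> G"
    and "\<gamma>1 = (\<lambda>t. (\<alpha>1 t, \<beta>1 t))" and "\<gamma>2 = (\<lambda>t. (\<alpha>2 t, \<beta>2 t))"
    and "C1_curve (mfd H) \<gamma>1" and "C1_curve (mfd H) \<gamma>2"
    and "\<gamma>1 0 = \<one>\<^bsub>H\<^esub>" and "\<gamma>2 0 = \<one>\<^bsub>H\<^esub>"
    and star: "\<exists>\<alpha>3. C1_curve (mfd N) \<alpha>3 \<and> \<alpha>3 0 = \<one>\<^bsub>N\<^esub> \<and>
           C1_curve (mfd N) (\<lambda>t. \<pi> (\<beta>1 t) (\<alpha>3 t)) \<and>
           velocity (mfd N) \<alpha>3 0 = velocity (mfd N) (\<lambda>t. \<pi> (\<beta>1 t) (\<alpha>3 t)) 0 \<and>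
           velocity (mfd N) (\<lambda>t. \<pi> (\<beta>1 t) (\<alpha>3 t)) 0 = velocity (mfd N) \<alpha>2 0"
  shows "\<forall>K. compact K \<and> K \<subseteq> {0..} \<longrightarrow>
           group_uniform_limit H K
             (\<lambda>n t. (\<gamma>1 (t / real n) \<otimes>\<^bsub>H\<^esub> \<gamma>2 (t / real n)) [^]\<^bsub>H\<^esub> n)
             (\<lambda>t. lie_exp H (tangent_scale t
                (tangent_add (velocity (mfd H) \<gamma>1 0) (velocity (mfd H) \<gamma>2 0))))"
proof -
  have N: "group N" "banach_manifold (mfd N)" "topspace (topol (mfd N)) = carrier N"
    and G: "group G" "banach_manifold (mfd G)" "topspace (topol (mfd G)) = carrier G"
    using assms(1,2) by (auto simp: banach_lie_group_def)
  \<comment> \<open>The same choice as in \<open>tangent_map\<close> at the identity. Every chart of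
    H is a product, so Q splits into charts of N and G.\<close>
  define Q where "Q = (SOME c. c \<in> atlas (mfd H) \<and> \<one>\<^bsub>H\<^esub> \<in> fst c)"
  have H: "atlas (mfd H) = {(U \<times> V, map_prod \<phi> \<psi>) | U \<phi> V \<psi>. (U, \<phi>) \<in> atlas (mfd N) \<and> (V, \<psi>) \<in> atlas (mfd G)}"
    "\<one>\<^bsub>H\<^esub> = (\<one>\<^bsub>N\<^esub>, \<one>\<^bsub>G\<^esub>)"
    by (simp_all add: assms(5) semidirect_product_def prod_manifold_def)
  have "\<exists>c. c \<in> atlas (mfd H) \<and> \<one>\<^bsub>H\<^esub> \<in> fst c"
  proof -
    have "\<one>\<^bsub>N\<^esub> \<in> carrier N" "\<one>\<^bsub>G\<^esub> \<in> carrier G" using N(1) G(1) by (simp_all add: group.is_monoid monoid.one_closed)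
    then obtain U \<phi> V \<psi> where "(U, \<phi>) \<in> atlas (mfd N)" "\<one>\<^bsub>N\<^esub> \<in> U" "(V, \<psi>) \<in> atlas (mfd G)" "\<one>\<^bsub>G\<^esub> \<in> V"
      using chart_at[OF N(2), of "\<one>\<^bsub>N\<^esub>"] chart_at[OF G(2), of "\<one>\<^bsub>G\<^esub>"] N(3) G(3) by auto
    then show ?thesis by (intro exI[of _ "(U \<times> V, map_prod \<phi> \<psi>)"]) (auto simp: H)
  qed
  then have "Q \<in> atlas (mfd H) \<and> \<one>\<^bsub>H\<^esub> \<in> fst Q" unfolding Q_def by (rule someI_ex)
  then obtain U \<phi> V \<psi> where Q: "Q = (U \<times> V, map_prod \<phi> \<psi>)" "(U, \<phi>) \<in> atlas (mfd N)" "(V, \<psi>) \<in> atlas (mfd G)"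
    "\<one>\<^bsub>N\<^esub> \<in> U" "\<one>\<^bsub>G\<^esub> \<in> V"
    by (auto simp: H)
  have cN: "lie_chart N U \<phi>" and cG: "lie_chart G V \<psi>" using assms(1,2) Q by (auto intro: lie_chart.intro)
  obtain FN R0N RN CN where BN: "lie_ball N (lie_chart.pt N U \<phi>) FN R0N RN CN" "\<And>v. norm v < R0N \<Longrightarrow> v \<in> lie_chart.dom N U \<phi>"
    using lie_chart.lie_ball_ex[OF cN] by blast
  obtain FG R0G RG CG where BG: "lie_ball G (lie_chart.pt G V \<psi>) FG R0G RG CG" "\<And>v. norm v < R0G \<Longrightarrow> v \<in> lie_chart.dom G V \<psi>"
    using lie_chart.lie_ball_ex[OF cG] by blast
  have "semidirect_charts N U \<phi> G V \<psi> \<pi> FN R0N RN CN FG R0G RG CG H"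
    using cN cG BN BG assms(3-5) Q(1)[unfolded Q_def]
    by (intro semidirect_charts.intro lie_chart_action.intro lie_chart_action_axioms.intro lie_chart_ball.intro
        lie_chart_ball_axioms.intro semidirect_charts_axioms.intro)
  then show ?thesis
    using semidirect_charts.trotter_product assms(8-11) by blast
qed

end
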